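(* A class function $F:\mathcal W_{[0,1]}\to\mathbb R$ is a homomorphism density $t(H,-)$ for $H\in\mathcal H$ (resp. $H\in\mathcal G$) if and only if it satisfies the following properties: (i) $F$ is continuous in the $L^1$-topology (resp. cut topology) on $\mathcal W_{[0,1]}$; (ii) there exists $n>0$ such that $d^nF(f;g_1,\dots,g_n)=0$ for all $f\in\mathcal W_{[0,1]}$ and $g_1,\dots,g_n\in\operatorname{Adm}(f)$; and (iii) $F(f)^m=F(f^{\otimes m})$ for some even integer $m\in\mathbb N=\{1,2,\dots\}$, for all $f\in\mathcal W_{[0,1]}$.
   Context: $\mathcal W$ is the vector space of bounded symmetric measurable functions $f:[0,1]^2\to\mathbb R$, and $\mathcal W_{[0,1]}\subset\mathcal W$ the set of those with values in $[0,1]$ (graphons). The cut topology is that of the cut norm $\|f\|_{\rm cut}=\sup_{S,T\subset[0,1]}\left|\int_{S\times T}f\right|$ over measurable $S,T$. $S_{[0,1]}$ is the group of invertible Lebesgue measure-preserving maps of $[0,1]$, $f^\sigma(x,y)=f(\sigma(x),\sigma(y))$, $\delta_\Box(f,g)=\inf_{\psi\in S_{[0,1]}}\|f-g^\psi\|_{\rm cut}$; write $f\sim g$ (weakly equivalent) if $\delta_\Box(f,g)=0$. A class function is a function with $F(f)=F(g)$ whenever $f\sim g$. For $f\in\mathcal W_{[0,1]}$, $\operatorname{Adm}(f)=\{g\in\mathcal W:f+\epsilon g\in\mathcal W_{[0,1]}\text{ for all sufficiently small }\epsilon\in[0,1)\}$. For admissible directions, the G\^ateaux derivatives are $dF(f;g)=\lim_{\lambda\to0,\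 f+\lambda g\in\mathcal W_{[0,1]}}\frac1\lambda(F(f+\lambda g)-F(f))$ and inductively $d^nF(f;g_1,\dots,g_n)=\lim_{\lambda\to0,\ f+\lambda g_n\in\mathcal W_{[0,1]}}\frac1\lambda(d^{n-1}F(f+\lambda g_n;g_1,\dots,g_{n-1})-d^{n-1}F(f;g_1,\dots,g_{n-1}))$. Condition (ii) includes that these derivatives exist. Multigraphs are finite, undirected, without loops, possibly with multiple edges; an edge $e$ has endpoints $\{e_s,e_t\}$. $\mathcal H$ (resp. $\mathcal G$) is the set of isomorphism classes of multigraphs (resp. simple graphs) with no isolated vertices, including the graph with no edges. $t(H,f)=\int_{[0,1]^{V(H)}}\prod_{e\in E(H)}f(x_{e_s},x_{e_t})\prod_idx_i$, with $t(H,f)\equiv1$ if $H$ has no edges. Tensor product: for graphons $f,g$, $(f\otimes g)(x_1,x_2,y_1,y_2)=f(x_1,y_1)g(x_2,y_2)$ on $[0,1]^4$; fixing a measure-preserving map $\phi:[0,1]\to[0,1]^2$, one identifies $f\otimes g$ with the graphon $(x,y)\mapsto(f\otimes g)(\phi(x),\phi(y))$ (different $\phi$ give weakly equivalent graphons). $f^{\otimes m}$ is the $m$-fold tensor power.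
   Formalization: The class function F is additionally assumed not to be identically zero on graphons, since F = 0 satisfies (i)–(iii) but is not a homomorphism density (every t(H,-) equals 1 at the constant graphon 1). *)

theory Defs
  imports "HOL-Analysis.Analysis"
begin

section \<open>Kernels and graphons\<close>

abbreviation unit_interval :: "real measure" where
  "unit_interval \<equiv> lebesgue_on {0..1}"

abbreviation unit_square :: "(real \<times> real) measure" where
  "unit_square \<equiv> lebesgue_on ({0..1} \<times> {0..1})"

text \<open>Functions on the unit square are represented by total functions on
  \<^typ>\<open>real \<times> real\<close> whose values off the square are irrelevant: all conditions and integrals
  below only look at the square, and a class function (see below) cannot distinguish graphons that
  agree there. As usual, measurable means Lebesgue measurable.\<close>

type_synonym kernel = "real \<times> real \<Rightarrow> real"

definition kernels :: "kernel set" where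
  "kernels = {f. f \<in> borel_measurable unit_square \<and>
     (\<exists>B. \<forall>p\<in>{0..1} \<times> {0..1}. \<bar>f p\<bar> \<le> B) \<and>
     (\<forall>x\<in>{0..1}. \<forall>y\<in>{0..1}. f (x, y) = f (y, x))}"

definition graphons :: "kernel set" where
  "graphons = {f \<in> kernels. \<forall>p\<in>{0..1} \<times> {0..1}. f p \<in> {0..1}}"

definition L1_norm :: "kernel \<Rightarrow> real" where
  "L1_norm f = (LINT p|unit_square. \<bar>f p\<bar>)"

definition cut_norm :: "kernel \<Rightarrow> real" where
  "cut_norm f = (SUP (S, T) \<in> sets unit_interval \<times> sets unit_interval.
     \<bar>LINT p:S \<times> T|lebesgue. f p\<bar>)"

definition graphon_topology :: "(kernel \<Rightarrow> real) \<Rightarrow> kernel topology" where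
  "graphon_topology N = topology (\<lambda>U. U \<subseteq> graphons \<and>
     (\<forall>f\<in>U. \<exists>r>0. \<forall>g\<in>graphons. N (\<lambda>p. g p - f p) < r \<longrightarrow> g \<in> U))"

lemma openin_graphon_topology:
  "openin (graphon_topology N) U \<longleftrightarrow> U \<subseteq> graphons \<and>
     (\<forall>f\<in>U. \<exists>r>0. \<forall>g\<in>graphons. N (\<lambda>p. g p - f p) < r \<longrightarrow> g \<in> U)"
proof -
  let ?P = "\<lambda>U. U \<subseteq> graphons \<and>
     (\<forall>f\<in>U. \<exists>r>0. \<forall>g\<in>graphons. N (\<lambda>p. g p - f p) < r \<longrightarrow> g \<in> U)"
  have "?P (U \<inter> V)" if U: "?P U" and V: "?P V" for U V
  proof (intro conjI ballI)
    show "U \<inter> V \<subseteq> graphons" using U by blast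
    fix f assume f: "f \<in> U \<inter> V"
    obtain r where r: "r > 0" "\<forall>g\<in>graphons. N (\<lambda>p. g p - f p) < r \<longrightarrow> g \<in> U"
      using U f by blast
    obtain s where s: "s > 0" "\<forall>g\<in>graphons. N (\<lambda>p. g p - f p) < s \<longrightarrow> g \<in> V"
      using V f by blast
    show "\<exists>r>0. \<forall>g\<in>graphons. N (\<lambda>p. g p - f p) < r \<longrightarrow> g \<in> U \<inter> V"
      using r s by (intro exI[of _ "min r s"]) auto
  qed
  moreover have "?P (\<Union>K)" if "\<forall>U\<in>K. ?P U" for K
  proof (intro conjI ballI)
    show "\<Union>K \<subseteq> graphons" using that by blast
    fix f assume "f \<in> \<Union>K"
    then obtain U where U: "U \<in> K" "f \<in> U" by blast
    then obtain r where "r > 0" "\<forall>g\<in>graphons. N (\<lambda>p. g p - f p) < r \<longrightarrow> g \<in> U"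
      using \<open>\<forall>U\<in>K. ?P U\<close> by blast
    then show "\<exists>r>0. \<forall>g\<in>graphons. N (\<lambda>p. g p - f p) < r \<longrightarrow> g \<in> \<Union>K"
      using U(1) by blast
  qed
  ultimately have "istopology ?P"
    unfolding istopology_def by blast
  then show ?thesis
    unfolding graphon_topology_def by (simp add: topology_inverse')
qed

abbreviation L1_topology :: "kernel topology" where
  "L1_topology \<equiv> graphon_topology L1_norm"

abbreviation cut_topology :: "kernel topology" where
  "cut_topology \<equiv> graphon_topology cut_norm"

section \<open>Weak equivalence and class functions\<close>

definition measure_preserving :: "'a measure \<Rightarrow> 'b measure \<Rightarrow> ('a \<Rightarrow> 'b) \<Rightarrow> bool" where
  "measure_preserving M N \<phi> \<longleftrightarrow> \<phi> \<in> M \<rightarrow>\<^sub>M N \<and> distr M N \<phi> = N"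

definition relabelings :: "(real \<Rightarrow> real) set" where
  "relabelings = {\<sigma>. bij_betw \<sigma> {0..1} {0..1} \<and>
     measure_preserving unit_interval unit_interval \<sigma> \<and>
     measure_preserving unit_interval unit_interval (the_inv_into {0..1} \<sigma>)}"

definition relabel :: "kernel \<Rightarrow> (real \<Rightarrow> real) \<Rightarrow> kernel" where
  "relabel f \<sigma> = (\<lambda>(x, y). f (\<sigma> x, \<sigma> y))"

definition cut_distance :: "kernel \<Rightarrow> kernel \<Rightarrow> real" where
  "cut_distance f g = (INF \<psi>\<in>relabelings. cut_norm (\<lambda>p. f p - relabel g \<psi> p))"

definition weakly_equivalent :: "kernel \<Rightarrow> kernel \<Rightarrow> bool" where
  "weakly_equivalent f g \<longleftrightarrow> cut_distance f g = 0"

definition class_function :: "(kernel \<Rightarrow> real) \<Rightarrow> bool" where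
  "class_function F \<longleftrightarrow>
     (\<forall>f\<in>graphons. \<forall>g\<in>graphons. weakly_equivalent f g \<longrightarrow> F f = F g)"

section \<open>Higher Gateaux derivatives\<close>

definition Adm :: "kernel \<Rightarrow> kernel set" where
  "Adm f = {g \<in> kernels. \<forall>\<^sub>F \<epsilon> in at_right 0. (\<lambda>p. f p + \<epsilon> * g p) \<in> graphons}"

definition steps :: "kernel \<Rightarrow> kernel \<Rightarrow> real set" where
  "steps f g = {l. (\<lambda>p. f p + l * g p) \<in> graphons}"

text \<open>\<open>gateaux F n f g\<close> is $d^nF(f; g_1, \dots, g_n)$; the directions are the values of \<open>g\<close> at
  \<open>1, \<dots>, n\<close>, and other values of \<open>g\<close> are not used. It is meaningful if \<open>gateaux_exists F n f g\<close>,
  which also requires the derivatives of order \<open>n - 1\<close> in the difference quotients to exist.\<close>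

primrec gateaux :: "(kernel \<Rightarrow> real) \<Rightarrow> nat \<Rightarrow> kernel \<Rightarrow> (nat \<Rightarrow> kernel) \<Rightarrow> real" where
  "gateaux F 0 f g = F f"
| "gateaux F (Suc n) f g = Lim (at 0 within steps f (g (Suc n)))
     (\<lambda>l. (gateaux F n (\<lambda>p. f p + l * g (Suc n) p) g - gateaux F n f g) / l)"

primrec gateaux_exists :: "(kernel \<Rightarrow> real) \<Rightarrow> nat \<Rightarrow> kernel \<Rightarrow> (nat \<Rightarrow> kernel) \<Rightarrow> bool" where
  "gateaux_exists F 0 f g \<longleftrightarrow> True"
| "gateaux_exists F (Suc n) f g \<longleftrightarrow>
     gateaux_exists F n f g \<and>
     (\<forall>\<^sub>F l in at 0 within steps f (g (Suc n)).
        gateaux_exists F n (\<lambda>p. f p + l * g (Suc n) p) g) \<and>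
     (\<exists>D. ((\<lambda>l. (gateaux F n (\<lambda>p. f p + l * g (Suc n) p) g - gateaux F n f g) / l)
        \<longlongrightarrow> D) (at 0 within steps f (g (Suc n))))"

section \<open>Multigraphs and homomorphism densities\<close>

text \<open>Edges are abstract objects, so that there may be several between the same two vertices. The
  order of the two endpoints of an edge carries no information, since kernels are symmetric. Every
  isomorphism class of finite multigraphs has representatives of this type.\<close>

record multigraph =
  verts :: "nat set"
  edges :: "nat set"
  src :: "nat \<Rightarrow> nat"
  tgt :: "nat \<Rightarrow> nat"

definition is_multigraph :: "multigraph \<Rightarrow> bool" where
  "is_multigraph H \<longleftrightarrow> finite (verts H) \<and> finite (edges H) \<and>
     (\<forall>e\<in>edges H. src H e \<in> verts H \<and> tgt H e \<in> verts H \<and> src H e \<noteq> tgt H e)"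

definition no_isolated_vertices :: "multigraph \<Rightarrow> bool" where
  "no_isolated_vertices H \<longleftrightarrow> (\<forall>v\<in>verts H. \<exists>e\<in>edges H. v \<in> {src H e, tgt H e})"

definition no_multiple_edges :: "multigraph \<Rightarrow> bool" where
  "no_multiple_edges H \<longleftrightarrow> inj_on (\<lambda>e. {src H e, tgt H e}) (edges H)"

definition multigraphs :: "multigraph set" where
  "multigraphs = {H. is_multigraph H \<and> no_isolated_vertices H}"

definition simple_graphs :: "multigraph set" where
  "simple_graphs = {H \<in> multigraphs. no_multiple_edges H}"

text \<open>The product measure has to be completed because \<open>f\<close> is merely Lebesgue measurable.\<close>

definition hom_density :: "multigraph \<Rightarrow> kernel \<Rightarrow> real" where
  "hom_density H f =
     (LINT x|completion (\<Pi>\<^sub>M v\<in>verts H. restrict_space lborel {0..1}).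
        (\<Prod>e\<in>edges H. f (x (src H e), x (tgt H e))))"

section \<open>Tensor powers\<close>

definition tensor :: "(real \<Rightarrow> real \<times> real) \<Rightarrow> kernel \<Rightarrow> kernel \<Rightarrow> kernel" where
  "tensor \<phi> f g = (\<lambda>(x, y). f (fst (\<phi> x), fst (\<phi> y)) * g (snd (\<phi> x), snd (\<phi> y)))"

text \<open>Only used for \<open>m \<ge> 1\<close>.\<close>

definition tensor_power :: "(real \<Rightarrow> real \<times> real) \<Rightarrow> kernel \<Rightarrow> nat \<Rightarrow> kernel" where
  "tensor_power \<phi> f m = ((\<lambda>g. tensor \<phi> g f) ^^ (m - 1)) f"

section \<open>The conditions of the characterisation\<close>

definition some_derivative_vanishes :: "(kernel \<Rightarrow> real) \<Rightarrow> bool" where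
  "some_derivative_vanishes F \<longleftrightarrow>
     (\<exists>n>0. \<forall>f\<in>graphons. \<forall>g. (\<forall>i\<in>{1..n}. g i \<in> Adm f) \<longrightarrow>
        gateaux_exists F n f g \<and> gateaux F n f g = 0)"

definition multiplicative_on_tensor_powers ::
    "(real \<Rightarrow> real \<times> real) \<Rightarrow> (kernel \<Rightarrow> real) \<Rightarrow> bool" where
  "multiplicative_on_tensor_powers \<phi> F \<longleftrightarrow>
     (\<exists>m>0. even m \<and> (\<forall>f\<in>graphons. F f ^ m = F (tensor_power \<phi> f m)))"

text \<open>The zero functional satisfies all conditions but is not a homomorphism density, because
  every density takes the value 1 at the constant graphon 1. So it has to be excluded.\<close>

lemma const_graphon: "c \<in> {0..1} \<Longrightarrow> (\<lambda>_. c) \<in> graphons"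
  by (auto simp: graphons_def kernels_def)

lemma hom_density_one: "is_multigraph H \<Longrightarrow> hom_density H (\<lambda>_. 1) = 1"
proof -
  assume H: "is_multigraph H"
  define M where "M = restrict_space lborel {0..1::real}"
  have sp: "space M = {0..1}" and e1: "emeasure M {0..1} = 1"
    by (auto simp: M_def space_restrict_space emeasure_restrict_space)
  interpret M: finite_measure M
    by standard (simp add: sp e1)
  interpret product_sigma_finite "\<lambda>_::nat. M"
    by standard
  have fin: "finite (verts H)"
    using H by (simp add: is_multigraph_def)
  have top: "{0..1} \<in> sets M"
    using sets.top[of M] by (simp add: sp)
  have "emeasure (\<Pi>\<^sub>M v\<in>verts H. M) (\<Pi>\<^sub>E v\<in>verts H. {0..1}) = (\<Prod>v\<in>verts H. emeasure M {0..1})"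
    by (rule emeasure_PiM[OF fin]) (rule top)
  then have "emeasure (\<Pi>\<^sub>M v\<in>verts H. M) (space (\<Pi>\<^sub>M v\<in>verts H. M)) = 1"
    by (simp add: space_PiM sp e1)
  then have "measure (completion (\<Pi>\<^sub>M v\<in>verts H. M)) (space (\<Pi>\<^sub>M v\<in>verts H. M)) = 1"
    by (simp add: measure_def emeasure_completion)
  then show ?thesis
    by (simp add: hom_density_def M_def)
qed

lemma zero_functional:
  defines "Z \<equiv> \<lambda>_::kernel. 0::real"
  shows "class_function Z" "continuous_map L1_topology euclideanreal Z"
    "continuous_map cut_topology euclideanreal Z"
    "some_derivative_vanishes Z" "multiplicative_on_tensor_powers \<phi> Z"
    "\<nexists>H. H \<in> multigraphs \<and> (\<forall>f\<in>graphons. Z f = hom_density H f)"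
proof -
  have ev: "at (0::real) within steps f g \<noteq> bot" if "g \<in> Adm f" for f g
  proof -
    have "\<forall>\<^sub>F e in at_right 0. e \<in> steps f g"
      using that by (simp add: Adm_def steps_def)
    then obtain b where b: "b > 0" "\<And>e. 0 < e \<Longrightarrow> e < b \<Longrightarrow> e \<in> steps f g"
      unfolding eventually_at_right_field by blast
    have "at (0::real) within {0<..<b} \<noteq> bot"
      using b(1) by (simp add: at_within_eq_bot_iff trivial_limit_within islimpt_greaterThanLessThan1)
    moreover have "at (0::real) within {0<..<b} \<le> at 0 within steps f g"
      by (rule at_le) (use b(2) in auto)
    ultimately show ?thesis
      using bot.extremum_unique by fastforce
  qed
  show "some_derivative_vanishes Z"
    unfolding some_derivative_vanishes_def
    by (rule exI[of _ 1]) (auto simp: Z_def intro!: tendsto_Lim ev)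
  show "multiplicative_on_tensor_powers \<phi> Z"
    unfolding multiplicative_on_tensor_powers_def by (rule exI[of _ 2]) (simp add: Z_def)
  show "\<nexists>H. H \<in> multigraphs \<and> (\<forall>f\<in>graphons. Z f = hom_density H f)"
    using hom_density_one const_graphon[of 1] by (fastforce simp: Z_def multigraphs_def)
qed (auto simp: Z_def class_function_def)

end

theory Submission
  imports Defs "HOL-Probability.Probability" "HOL-Computational_Algebra.Computational_Algebra" "HOL-Combinatorics.Permutations"
begin

text \<open>A vanishing derivative of order \<open>N\<close> makes \<open>F\<close> a polynomial of degree less than \<open>N\<close> on segments
  (Taylor), hence, by interpolation, a polynomial in the entries of a symmetric matrix with zero diagonal
  when it is restricted to the corresponding step graphons with \<open>n\<close> blocks. Now colour the \<open>n\<close> blocks at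
  random with the \<open>m\<close> blocks of a step graphon \<open>f\<close>. The average of a monomial over the colourings is
  exactly a density \<open>t(H, f)\<close> with fewer than \<open>N\<close> edges, so the average of \<open>F\<close> lies in the span of these
  finitely many densities. On the other hand, by the law of large numbers the sampled graphon is, up to
  a permutation of its blocks, close to \<open>f\<close> in \<open>L\<^sup>1\<close>, so the averages converge to \<open>F f\<close>. A finite-dimensional
  space of functions is closed under pointwise limits; therefore \<open>F\<close> is a linear combination of densities
  on step graphons, and by density on all graphons.

  The densities are multiplicative for tensor products. At a graphon where the finitely many densities
  in a shortest representation take distinct positive values \<open>a i\<close>, the condition on tensor powers reads
  \<open>(\<Sum>i. c i * a i ^ k) ^ m = (\<Sum>i. c i * a i ^ (m * k))\<close> for all \<open>k\<close>, and comparison of the two leading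
  terms shows that there is only one summand. Its coefficient is 1, because \<open>m\<close> is even.

  A multiple edge does not affect the density in a 0/1-valued graphon, and these graphons approximate every
  step graphon in the cut norm (entries \<open>x x' + y + y'\<close> modulo a large prime, compared with a threshold).
  So a density which is continuous for the cut norm equals that of the underlying simple graph.\<close>

section \<open>Densities as integrals over the completed cube\<close>

text \<open>Kernels are only Lebesgue measurable, whereas Fubini is applied to uncompleted products.
  Hence densities live on completions of Borel cubes, integrands are exchanged for Borel versions
  almost everywhere, and the tensor identity is checked on step graphons and extended by a Lipschitz
  bound. Gateaux derivatives use sets of steps that may be one-sided. Taylor expansion therefore
  works inside a segment, and its endpoints are reached by continuity. The number of coefficients of
  the polynomial on \<open>n\<close> blocks grows with \<open>n\<close>. Averaging over colourings
  puts everything into a span that does not depend on \<open>n\<close>, since fewer than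
  \<open>N\<close> edges touch fewer than \<open>2 * N\<close> vertices.\<close>

abbreviation borel_unit :: "real measure" where
  "borel_unit \<equiv> restrict_space lborel {0..1}"

text \<open>A null set cut down to the measurable set \<open>S\<close> is still null, so completing
  before or after the restriction adds the same sets. Hence \<open>lebesgue_on\<close> becomes the
  completion of a Borel measure, to which product constructions apply.\<close>

lemma restrict_space_completion:
  assumes "S \<in> sets M"
  shows "restrict_space (completion M) S = completion (restrict_space M S)"
proof (rule measure_eqI)
  have *: "A \<in> sets (restrict_space (completion M) S) \<longleftrightarrow> A \<in> sets (completion M) \<and> A \<subseteq> S" for A
    using assms by (subst sets_restrict_space_iff) auto
  have **: "A \<in> sets (completion (restrict_space M S)) \<longleftrightarrow> A \<in> sets (completion M) \<and> A \<subseteq> S" for A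
  proof
    assume "A \<in> sets (completion (restrict_space M S))"
    then obtain T N N' where A: "A = T \<union> N" "N \<subseteq> N'" "N' \<in> null_sets (restrict_space M S)"
        "T \<in> sets (restrict_space M S)"
      by (rule sets_completionE)
    then have "N' \<in> null_sets M" "T \<in> sets M" "T \<subseteq> S" "N' \<subseteq> S"
      using assms by (auto simp: null_sets_restrict_space sets_restrict_space_iff)
    with A show "A \<in> sets (completion M) \<and> A \<subseteq> S"
      using sets_completionI[of A T N N' M] by auto
  next
    assume "A \<in> sets (completion M) \<and> A \<subseteq> S"
    moreover then obtain T N N' where A: "A = T \<union> N" "N \<subseteq> N'" "N' \<in> null_sets M" "T \<in> sets M"
      using sets_completionE by metis
    ultimately show "A \<in> sets (completion (restrict_space M S))"
      using assms
      by (intro sets_completionI[of A T N "N' \<inter> S"])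
        (auto simp: null_sets_restrict_space sets_restrict_space_iff intro: null_set_Int2)
  qed
  show "sets (restrict_space (completion M) S) = sets (completion (restrict_space M S))"
    by (rule set_eqI) (simp only: * **)
  fix A assume "A \<in> sets (restrict_space (completion M) S)"
  with * have A: "A \<in> sets (completion M)" "A \<subseteq> S" by auto
  obtain T N N' where T: "A = T \<union> N" "N \<subseteq> N'" "N' \<in> null_sets M" "T \<in> sets M"
    using A(1) by (rule sets_completionE)
  have 1: "emeasure (completion M) A = emeasure M T"
  proof -
    have "emeasure (completion M) A = emeasure (completion M) T"
      by (rule emeasure_eq_AE)
         (use T A in \<open>auto intro!: AE_completion AE_I'[OF T(3)] \<close>)
    then show ?thesis using T by simp
  qed
  have TS: "T \<in> sets (restrict_space M S)" using T A assms by (auto simp: sets_restrict_space_iff)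
  have "emeasure (completion (restrict_space M S)) A = emeasure (completion (restrict_space M S)) T"
  proof (rule emeasure_eq_AE)
    have "N' \<inter> S \<in> null_sets (restrict_space M S)"
      using T assms by (auto simp: null_sets_restrict_space intro: null_set_Int2)
    then show "AE x in completion (restrict_space M S). (x \<in> A) = (x \<in> T)"
      by (rule AE_completion[OF AE_I']) (use T A in auto)
    show "A \<in> sets (completion (restrict_space M S))" using A ** by blast
    show "T \<in> sets (completion (restrict_space M S))" using TS by simp
  qed
  also have "\<dots> = emeasure M T"
    using TS T A assms by (simp add: emeasure_restrict_space)
  finally show "emeasure (restrict_space (completion M) S) A = emeasure (completion (restrict_space M S)) A"
    using 1 A assms by (simp add: emeasure_restrict_space)
qed

text \<open>The identity is measurable in both directions, which identifies the sigma-algebras; the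
  measures then have to be compared on rectangles only.\<close>

lemma pair_measure_restrict_space:
  assumes "sigma_finite_measure M" "sigma_finite_measure N" "A \<in> sets M" "B \<in> sets N"
  shows "restrict_space M A \<Otimes>\<^sub>M restrict_space N B = restrict_space (M \<Otimes>\<^sub>M N) (A \<times> B)"
proof (rule pair_measure_eqI)
  interpret N: sigma_finite_measure N by fact
  show "sigma_finite_measure (restrict_space M A)" "sigma_finite_measure (restrict_space N B)"
    using assms by (auto intro: sigma_finite_measure_restrict_space)
  have id: "(\<lambda>x. x) \<in> restrict_space (M \<Otimes>\<^sub>M N) (A \<times> B) \<rightarrow>\<^sub>M restrict_space M A \<Otimes>\<^sub>M restrict_space N B"
  proof (rule measurable_pair)
    show "fst \<circ> (\<lambda>x. x) \<in> restrict_space (M \<Otimes>\<^sub>M N) (A \<times> B) \<rightarrow>\<^sub>M restrict_space M A"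
      using measurable_restrict_space1[OF measurable_fst]
      by (intro measurable_restrict_space2) (auto simp: comp_def space_restrict_space space_pair_measure)
    show "snd \<circ> (\<lambda>x. x) \<in> restrict_space (M \<Otimes>\<^sub>M N) (A \<times> B) \<rightarrow>\<^sub>M restrict_space N B"
      using measurable_restrict_space1[OF measurable_snd]
      by (intro measurable_restrict_space2) (auto simp: comp_def space_restrict_space space_pair_measure)
  qed
  have di: "(\<lambda>x. x) \<in> restrict_space M A \<Otimes>\<^sub>M restrict_space N B \<rightarrow>\<^sub>M restrict_space (M \<Otimes>\<^sub>M N) (A \<times> B)"
  proof (rule measurable_restrict_space2)
    have "(\<lambda>x. (fst x, snd x)) \<in> restrict_space M A \<Otimes>\<^sub>M restrict_space N B \<rightarrow>\<^sub>M M \<Otimes>\<^sub>M N"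
      by (rule measurable_Pair)
         (auto intro: measurable_compose[OF measurable_fst measurable_restrict_space1[OF measurable_ident_sets[OF refl]]]
           measurable_compose[OF measurable_snd measurable_restrict_space1[OF measurable_ident_sets[OF refl]]])
    then show "(\<lambda>x. x) \<in> restrict_space M A \<Otimes>\<^sub>M restrict_space N B \<rightarrow>\<^sub>M M \<Otimes>\<^sub>M N" by simp
  qed (auto simp: space_restrict_space space_pair_measure)
  show "sets (restrict_space M A \<Otimes>\<^sub>M restrict_space N B) = sets (restrict_space (M \<Otimes>\<^sub>M N) (A \<times> B))"
  proof -
    have sp: "space (restrict_space M A \<Otimes>\<^sub>M restrict_space N B) = space (restrict_space (M \<Otimes>\<^sub>M N) (A \<times> B))"
      by (auto simp: space_restrict_space space_pair_measure)
    have "X \<inter> space (restrict_space (M \<Otimes>\<^sub>M N) (A \<times> B)) \<in> sets (restrict_space (M \<Otimes>\<^sub>M N) (A \<times> B))"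
      if "X \<in> sets (restrict_space M A \<Otimes>\<^sub>M restrict_space N B)" for X
      using measurable_sets[OF id that] by simp
    moreover have "X \<inter> space (restrict_space (M \<Otimes>\<^sub>M N) (A \<times> B)) \<in> sets (restrict_space M A \<Otimes>\<^sub>M restrict_space N B)"
      if "X \<in> sets (restrict_space (M \<Otimes>\<^sub>M N) (A \<times> B))" for X
      using measurable_sets[OF di that] sp by simp
    ultimately show ?thesis
      using sp by (metis sets.Int_space_eq2 subsetI subset_antisym)
  qed
  fix X Y assume XY: "X \<in> sets (restrict_space M A)" "Y \<in> sets (restrict_space N B)"
  then have "X \<in> sets M" "Y \<in> sets N" "X \<subseteq> A" "Y \<subseteq> B"
    using assms by (auto simp: sets_restrict_space_iff)
  then show "emeasure (restrict_space M A) X * emeasure (restrict_space N B) Y =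
      emeasure (restrict_space (M \<Otimes>\<^sub>M N) (A \<times> B)) (X \<times> Y)"
    using assms by (subst (1 2 3) emeasure_restrict_space) (auto simp: N.emeasure_pair_measure_Times)
qed

lemma prob_space_borel_unit: "prob_space borel_unit"
  by (rule prob_spaceI) (simp add: space_restrict_space emeasure_restrict_space)

interpretation unit: prob_space borel_unit
  by (rule prob_space_borel_unit)

interpretation unit_pair: pair_prob_space borel_unit borel_unit ..

interpretation unit_product: product_sigma_finite "\<lambda>_::nat. borel_unit" ..

lemma space_borel_unit [simp]: "space borel_unit = {0..1}"
  by (simp add: space_restrict_space)

lemma unit_interval_eq_completion: "unit_interval = completion borel_unit"
  by (rule restrict_space_completion) simp

lemma borel_unit_pair: "borel_unit \<Otimes>\<^sub>M borel_unit = restrict_space lborel ({0..1} \<times> {0..1})"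
  by (subst pair_measure_restrict_space) (auto simp: lborel_prod intro: lborel.sigma_finite_measure_axioms)

lemma unit_square_eq_completion: "unit_square = completion (borel_unit \<Otimes>\<^sub>M borel_unit)"
  unfolding borel_unit_pair
  by (rule restrict_space_completion) (auto simp: closed_Times intro!: borel_closed)

text \<open>The image measure of \<open>M\<close> is \<open>N\<close>, so preimages of null sets are
  null and \<open>T\<close> stays measurable between the completions.\<close>

lemma measure_preserving_completion:
  assumes "measure_preserving M N T"
  shows "measure_preserving (completion M) (completion N) T"
proof -
  have T: "T \<in> M \<rightarrow>\<^sub>M N" "distr M N T = N"
    using assms by (auto simp: measure_preserving_def)
  have T': "T \<in> completion M \<rightarrow>\<^sub>M N" using T(1) by (rule measurable_completion)
  have d: "distr (completion M) N T = N" using T by (simp add: distr_completion)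
  have "T \<in> completion M \<rightarrow>\<^sub>M completion N"
    by (rule completion.measurable_completion2[OF T']) (simp add: d)
  moreover have "distr (completion M) (completion N) T = completion N"
    using completion.completion_distr_eq[OF T'] by (simp add: d)
  ultimately show ?thesis by (simp add: measure_preserving_def)
qed

abbreviation unit_cube :: "nat set \<Rightarrow> (nat \<Rightarrow> real) measure" where
  "unit_cube V \<equiv> Pi\<^sub>M V (\<lambda>_. borel_unit)"

lemma prob_space_unit_cube: "prob_space (unit_cube V)"
  by (intro prob_space_PiM prob_space_borel_unit)

text \<open>The preimage of a rectangle is a box whose remaining sides have mass 1. The absence of
  loops enters here: for \<open>s = t\<close> the image measure would sit on the diagonal, which is
  a null set of the square.\<close>

lemma measure_preserving_unit_cube_pair:
  assumes "finite V" "s \<in> V" "t \<in> V" "s \<noteq> t"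
  shows "measure_preserving (unit_cube V) (borel_unit \<Otimes>\<^sub>M borel_unit) (\<lambda>x. (x s, x t))"
proof -
  have [measurable]: "(\<lambda>x. (x s, x t)) \<in> unit_cube V \<rightarrow>\<^sub>M borel_unit \<Otimes>\<^sub>M borel_unit"
    using assms by (intro measurable_Pair measurable_component_singleton)
  have "borel_unit \<Otimes>\<^sub>M borel_unit = distr (unit_cube V) (borel_unit \<Otimes>\<^sub>M borel_unit) (\<lambda>x. (x s, x t))"
  proof (rule pair_measure_eqI)
    fix A B assume A: "A \<in> sets borel_unit" and B: "B \<in> sets borel_unit"
    define C where "C v = (if v = s then A else if v = t then B else {0..1})" for v
    have C: "C v \<in> sets borel_unit" for v
      using A B sets.top[of borel_unit] by (auto simp: C_def)
    have "A \<subseteq> {0..1}" "B \<subseteq> {0..1}" using sets.sets_into_space[OF A] sets.sets_into_space[OF B] by auto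
    then have "C v \<subseteq> {0..1}" for v by (auto simp: C_def)
    then have eq: "(\<lambda>x. (x s, x t)) -` (A \<times> B) \<inter> space (unit_cube V) = (\<Pi>\<^sub>E v\<in>V. C v)"
      (is "?L = ?R")
    proof (intro equalityI subsetI)
      fix x assume "x \<in> ?L"
      then have "x s \<in> A" "x t \<in> B" "x \<in> extensional V" "\<And>v. v \<in> V \<Longrightarrow> x v \<in> {0..1}"
        by (simp_all add: space_PiM PiE_iff)
      then show "x \<in> ?R" by (simp add: PiE_iff C_def)
    next
      fix x assume "x \<in> ?R"
      then have x: "x v \<in> C v" if "v \<in> V" for v using that by (simp add: PiE_iff)
      have "x s \<in> A" "x t \<in> B" using x[OF assms(2)] x[OF assms(3)] assms(4) by (simp_all add: C_def)
      moreover have "x \<in> space (unit_cube V)"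
        using \<open>x \<in> ?R\<close> \<open>\<And>v. C v \<subseteq> {0..1}\<close> by (fastforce simp: space_PiM PiE_iff)
      ultimately show "x \<in> ?L" by simp
    qed
    have "emeasure (distr (unit_cube V) (borel_unit \<Otimes>\<^sub>M borel_unit) (\<lambda>x. (x s, x t))) (A \<times> B)
       = emeasure (unit_cube V) (\<Pi>\<^sub>E v\<in>V. C v)"
      using A B by (subst emeasure_distr) (auto simp: eq)
    also have "\<dots> = (\<Prod>v\<in>V. emeasure borel_unit (C v))"
      using assms C by (intro unit_product.emeasure_PiM) auto
    also have "\<dots> = (\<Prod>v\<in>{s, t}. emeasure borel_unit (C v))"
      using assms unit.emeasure_space_1 by (intro prod.mono_neutral_right) (auto simp: C_def)
    finally show "emeasure borel_unit A * emeasure borel_unit B =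
        emeasure (distr (unit_cube V) (borel_unit \<Otimes>\<^sub>M borel_unit) (\<lambda>x. (x s, x t))) (A \<times> B)"
      using assms by (simp add: C_def)
  qed (auto intro: unit.sigma_finite_measure_axioms)
  then show ?thesis by (simp add: measure_preserving_def)
qed

text \<open>Symmetry is dropped, because the counting lemma multiplies kernels by weights
  \<open>u x * v y\<close>, which destroys it.\<close>

definition bounded_kernels :: "kernel set" where
  "bounded_kernels = {h \<in> borel_measurable unit_square. \<exists>B. \<forall>p\<in>{0..1} \<times> {0..1}. \<bar>h p\<bar> \<le> B}"

text \<open>With a separate kernel on every edge the density is multilinear. Telescoping sums and
  derivatives both rest on this.\<close>

definition decorated_density :: "multigraph \<Rightarrow> (nat \<Rightarrow> kernel) \<Rightarrow> real" where
  "decorated_density H h =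
     (LINT x|completion (unit_cube (verts H)). (\<Prod>e\<in>edges H. h e (x (src H e), x (tgt H e))))"

lemma hom_density_eq_decorated: "hom_density H f = decorated_density H (\<lambda>_. f)"
  by (simp add: hom_density_def decorated_density_def)

lemma kernels_subset_bounded: "kernels \<subseteq> bounded_kernels"
  by (auto simp: kernels_def bounded_kernels_def)

lemma graphons_subset_kernels: "graphons \<subseteq> kernels"
  by (auto simp: graphons_def)

lemma space_unit_square [simp]: "space unit_square = {0..1} \<times> {0..1}"
  by (simp add: space_restrict_space)

lemma prob_space_unit_square: "prob_space unit_square"
  unfolding unit_square_eq_completion by (rule unit_pair.prob_space_completion)

interpretation unit_square: prob_space unit_square
  by (rule prob_space_unit_square)

lemma bounded_kernels_integrable:
  assumes "h \<in> bounded_kernels"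
  shows "integrable unit_square h"
proof -
  obtain B where "h \<in> borel_measurable unit_square" "\<And>p. p \<in> {0..1} \<times> {0..1} \<Longrightarrow> \<bar>h p\<bar> \<le> B"
    using assms unfolding bounded_kernels_def by blast
  then show ?thesis
    by (intro unit_square.integrable_const_bound[where B = B] AE_I2) simp_all
qed

lemma measurable_edge:
  assumes "is_multigraph H" "e \<in> edges H"
  shows "(\<lambda>x. (x (src H e), x (tgt H e))) \<in> completion (unit_cube (verts H)) \<rightarrow>\<^sub>M unit_square"
    and "distr (completion (unit_cube (verts H))) unit_square (\<lambda>x. (x (src H e), x (tgt H e))) = unit_square"
  using assms measure_preserving_completion[OF measure_preserving_unit_cube_pair, of "verts H" "src H e" "tgt H e"]
  by (auto simp: measure_preserving_def unit_square_eq_completion is_multigraph_def)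

lemma edge_in_unit_square:
  assumes "is_multigraph H" "e \<in> edges H" "x \<in> space (unit_cube (verts H))"
  shows "(x (src H e), x (tgt H e)) \<in> {0..1} \<times> {0..1}"
  using assms by (auto simp: is_multigraph_def space_PiM PiE_iff)

lemma integral_edge:
  fixes h :: kernel
  assumes "is_multigraph H" "e \<in> edges H" "h \<in> borel_measurable unit_square"
  shows "(LINT x|completion (unit_cube (verts H)). h (x (src H e), x (tgt H e))) = (LINT p|unit_square. h p)"
proof -
  have "(LINT p|unit_square. h p) =
      (LINT p|distr (completion (unit_cube (verts H))) unit_square (\<lambda>x. (x (src H e), x (tgt H e))). h p)"
    using measurable_edge(2)[OF assms(1,2)] by simp
  also have "\<dots> = (LINT x|completion (unit_cube (verts H)). h (x (src H e), x (tgt H e)))"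
    by (rule integral_distr[OF measurable_edge(1)[OF assms(1,2)] assms(3)])
  finally show ?thesis by simp
qed

lemma measurable_decorated:
  fixes h :: "nat \<Rightarrow> kernel"
  assumes "is_multigraph H" "\<And>e. e \<in> edges H \<Longrightarrow> h e \<in> borel_measurable unit_square"
  shows "(\<lambda>x. \<Prod>e\<in>edges H. h e (x (src H e), x (tgt H e))) \<in> borel_measurable (completion (unit_cube (verts H)))"
  by (rule borel_measurable_prod, rule measurable_compose[OF measurable_edge(1)[OF assms(1)] assms(2)])

lemma integrable_decorated:
  assumes H: "is_multigraph H" and h: "\<And>e. e \<in> edges H \<Longrightarrow> h e \<in> bounded_kernels"
  shows "integrable (completion (unit_cube (verts H))) (\<lambda>x. \<Prod>e\<in>edges H. h e (x (src H e), x (tgt H e)))"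
proof -
  interpret c: prob_space "completion (unit_cube (verts H))"
    by (rule prob_space.prob_space_completion[OF prob_space_unit_cube])
  obtain B where B: "\<And>e p. e \<in> edges H \<Longrightarrow> p \<in> {0..1} \<times> {0..1} \<Longrightarrow> \<bar>h e p\<bar> \<le> B e"
  proof -
    have "\<forall>e\<in>edges H. \<exists>B. \<forall>p\<in>{0..1} \<times> {0..1}. \<bar>h e p\<bar> \<le> B"
      using h by (auto simp: bounded_kernels_def)
    then show ?thesis using that by (auto dest!: bchoice)
  qed
  show ?thesis
  proof (rule c.integrable_const_bound[where B = "\<Prod>e\<in>edges H. B e"])
    show "AE x in completion (unit_cube (verts H)).
        norm (\<Prod>e\<in>edges H. h e (x (src H e), x (tgt H e))) \<le> (\<Prod>e\<in>edges H. B e)"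
    proof (rule AE_I2)
      fix x assume "x \<in> space (completion (unit_cube (verts H)))"
      then have "\<bar>h e (x (src H e), x (tgt H e))\<bar> \<le> B e" if "e \<in> edges H" for e
        using B[OF that edge_in_unit_square[OF H that]] by simp
      then show "norm (\<Prod>e\<in>edges H. h e (x (src H e), x (tgt H e))) \<le> (\<Prod>e\<in>edges H. B e)"
        unfolding real_norm_def abs_prod by (intro prod_mono) auto
    qed
  qed (use h in \<open>auto intro!: measurable_decorated[OF H] simp: bounded_kernels_def\<close>)
qed

lemma bounded_kernels_diff:
  "f \<in> bounded_kernels \<Longrightarrow> g \<in> bounded_kernels \<Longrightarrow> (\<lambda>p. f p - g p) \<in> bounded_kernels"
  unfolding bounded_kernels_def
proof (safe, goal_cases)
  case (2 B C)
  then show ?case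
    by (intro exI[of _ "B + C"] ballI) (meson abs_triangle_ineq4 add_mono order_trans)
qed auto

lemma L1_norm_nonneg: "0 \<le> L1_norm f"
  by (simp add: L1_norm_def)

text \<open>For factors of absolute value at most 1, two products differ by at most the sum of the
  differences of the factors. Each summand depends on one edge, and the coordinates at its endpoints
  are distributed as Lebesgue measure on the square.\<close>

lemma decorated_density_L1:
  assumes H: "is_multigraph H"
    and f: "\<And>e. e \<in> edges H \<Longrightarrow> f e \<in> bounded_kernels" and g: "\<And>e. e \<in> edges H \<Longrightarrow> g e \<in> bounded_kernels"
    and f1: "\<And>e p. e \<in> edges H \<Longrightarrow> p \<in> {0..1} \<times> {0..1} \<Longrightarrow> \<bar>f e p\<bar> \<le> 1"
    and g1: "\<And>e p. e \<in> edges H \<Longrightarrow> p \<in> {0..1} \<times> {0..1} \<Longrightarrow> \<bar>g e p\<bar> \<le> 1"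
  shows "\<bar>decorated_density H f - decorated_density H g\<bar> \<le> (\<Sum>e\<in>edges H. L1_norm (\<lambda>p. f e p - g e p))"
proof -
  let ?M = "completion (unit_cube (verts H))"
  let ?F = "\<lambda>f x. \<Prod>e\<in>edges H. f e (x (src H e), x (tgt H e)) :: real"
  have int: "integrable ?M (\<lambda>x. \<bar>f e (x (src H e), x (tgt H e)) - g e (x (src H e), x (tgt H e))\<bar>)"
    if e: "e \<in> edges H" for e
  proof -
    have "integrable (distr ?M unit_square (\<lambda>x. (x (src H e), x (tgt H e)))) (\<lambda>p. f e p - g e p)"
      using bounded_kernels_integrable[OF bounded_kernels_diff[OF f[OF e] g[OF e]]]
      by (simp add: measurable_edge(2)[OF H e])
    from integrable_abs[OF integrable_distr[OF measurable_edge(1)[OF H e] this]]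
    show ?thesis by simp
  qed
  have "\<bar>decorated_density H f - decorated_density H g\<bar> = \<bar>LINT x|?M. ?F f x - ?F g x\<bar>"
    unfolding decorated_density_def
    by (subst Bochner_Integration.integral_diff) (auto intro!: integrable_decorated H f g)
  also have "\<dots> \<le> (LINT x|?M. \<bar>?F f x - ?F g x\<bar>)"
    using integral_norm_bound[of ?M "\<lambda>x. ?F f x - ?F g x"] by simp
  also have "\<dots> \<le> (LINT x|?M. (\<Sum>e\<in>edges H. \<bar>f e (x (src H e), x (tgt H e)) - g e (x (src H e), x (tgt H e))\<bar>))"
  proof (rule integral_mono)
    show "integrable ?M (\<lambda>x. \<bar>?F f x - ?F g x\<bar>)"
      by (intro integrable_abs Bochner_Integration.integrable_diff integrable_decorated H f g)
    fix x assume x: "x \<in> space ?M"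
    show "\<bar>?F f x - ?F g x\<bar> \<le> (\<Sum>e\<in>edges H. \<bar>f e (x (src H e), x (tgt H e)) - g e (x (src H e), x (tgt H e))\<bar>)"
      using norm_prod_diff[of "edges H" "\<lambda>e. f e (x (src H e), x (tgt H e))" "\<lambda>e. g e (x (src H e), x (tgt H e))"]
        f1[OF _ edge_in_unit_square[OF H]] g1[OF _ edge_in_unit_square[OF H]] x by simp
  qed (use int in auto)
  also have "\<dots> = (\<Sum>e\<in>edges H. LINT x|?M. \<bar>f e (x (src H e), x (tgt H e)) - g e (x (src H e), x (tgt H e))\<bar>)"
    by (rule Bochner_Integration.integral_sum) (use int in auto)
  also have "\<dots> = (\<Sum>e\<in>edges H. L1_norm (\<lambda>p. f e p - g e p))"
  proof (rule sum.cong[OF refl])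
    fix e assume e: "e \<in> edges H"
    have "(\<lambda>p. \<bar>f e p - g e p\<bar>) \<in> borel_measurable unit_square"
      using f[OF e] g[OF e] by (auto simp: bounded_kernels_def)
    from integral_edge[OF H e this] show
      "(LINT x|?M. \<bar>f e (x (src H e), x (tgt H e)) - g e (x (src H e), x (tgt H e))\<bar>) = L1_norm (\<lambda>p. f e p - g e p)"
      by (simp add: L1_norm_def)
  qed
  finally show ?thesis .
qed

lemma graphons_abs_le_1: "f \<in> graphons \<Longrightarrow> p \<in> {0..1} \<times> {0..1} \<Longrightarrow> \<bar>f p\<bar> \<le> 1"
  by (fastforce simp: graphons_def)

lemma graphons_bounded: "f \<in> graphons \<Longrightarrow> f \<in> bounded_kernels"
  using graphons_subset_kernels kernels_subset_bounded by blast

lemma hom_density_L1: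
  assumes "is_multigraph H" "f \<in> graphons" "g \<in> graphons"
  shows "\<bar>hom_density H f - hom_density H g\<bar> \<le> card (edges H) * L1_norm (\<lambda>p. f p - g p)"
  using decorated_density_L1[of H "\<lambda>_. f" "\<lambda>_. g"] assms
  by (auto simp: hom_density_eq_decorated graphons_abs_le_1 graphons_bounded)

text \<open>One epsilon-delta criterion serves both topologies, which are instances of
  \<open>graphon_topology\<close>: openness of a preimage is a condition at each of its
  points.\<close>

lemma continuous_map_graphon_topology:
  assumes z: "\<And>f. f \<in> graphons \<Longrightarrow> N (\<lambda>p. f p - f p) = 0"
  shows "continuous_map (graphon_topology N) euclideanreal F \<longleftrightarrow>
    (\<forall>f\<in>graphons. \<forall>e>0. \<exists>r>0. \<forall>g\<in>graphons. N (\<lambda>p. g p - f p) < r \<longrightarrow> \<bar>F g - F f\<bar> < e)"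
proof -
  have top: "topspace (graphon_topology N) = graphons"
  proof -
    have "openin (graphon_topology N) graphons"
      by (auto simp: openin_graphon_topology intro!: exI[of _ 1])
    moreover have "topspace (graphon_topology N) \<subseteq> graphons"
      using openin_topspace[of "graphon_topology N"] unfolding openin_graphon_topology by blast
    ultimately show ?thesis using openin_subset by blast
  qed
  show ?thesis
  proof safe
    fix f and e :: real assume cont: "continuous_map (graphon_topology N) euclideanreal F" and f: "f \<in> graphons" and e: "e > 0"
    have "openin (graphon_topology N) {h \<in> topspace (graphon_topology N). F h \<in> ball (F f) e}"
      by (rule openin_continuous_map_preimage[OF cont]) simp
    then have "\<forall>f'\<in>{h \<in> graphons. F h \<in> ball (F f) e}. \<exists>r>0. \<forall>g\<in>graphons. N (\<lambda>p. g p - f' p) < r \<longrightarrow> g \<in> {h \<in> graphons. F h \<in> ball (F f) e}"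
      unfolding openin_graphon_topology top by blast
    moreover have "f \<in> {h \<in> graphons. F h \<in> ball (F f) e}" using f e by simp
    ultimately obtain r where "r > 0" "\<forall>g\<in>graphons. N (\<lambda>p. g p - f p) < r \<longrightarrow> g \<in> {h \<in> graphons. F h \<in> ball (F f) e}"
      by blast
    then show "\<exists>r>0. \<forall>g\<in>graphons. N (\<lambda>p. g p - f p) < r \<longrightarrow> \<bar>F g - F f\<bar> < e"
      by (intro exI[of _ r]) (auto simp: dist_real_def abs_minus_commute)
  next
    assume *: "\<forall>f\<in>graphons. \<forall>e>0. \<exists>r>0. \<forall>g\<in>graphons. N (\<lambda>p. g p - f p) < r \<longrightarrow> \<bar>F g - F f\<bar> < e"
    show "continuous_map (graphon_topology N) euclideanreal F"
      unfolding continuous_map top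
    proof safe
      fix U :: "real set" assume "openin euclideanreal U"
      then have U: "open U" by simp
      show "openin (graphon_topology N) {x \<in> graphons. F x \<in> U}"
        unfolding openin_graphon_topology
      proof safe
        fix f assume f: "f \<in> graphons" "F f \<in> U"
        then obtain e where e: "e > 0" "\<And>y. \<bar>y - F f\<bar> < e \<Longrightarrow> y \<in> U"
          using U unfolding open_dist dist_real_def by metis
        then obtain r where "r > 0" "\<forall>g\<in>graphons. N (\<lambda>p. g p - f p) < r \<longrightarrow> \<bar>F g - F f\<bar> < e"
          using * f by blast
        then show "\<exists>r>0. \<forall>g\<in>graphons. N (\<lambda>p. g p - f p) < r \<longrightarrow> g \<in> {x \<in> graphons. F x \<in> U}"
          using e by blast
      qed
    qed auto
  qed
qed

section \<open>Step kernels\<close>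

lemma measure_preserving_unit_cube_component:
  assumes "v \<in> V"
  shows "measure_preserving (unit_cube V) borel_unit (\<lambda>x. x v)"
proof -
  have "distr (unit_cube V) borel_unit (\<lambda>x. x v) = borel_unit"
    using assms by (intro distr_PiM_component prob_space_borel_unit)
  then show ?thesis using assms by (simp add: measure_preserving_def)
qed

lemma measurable_component_completion:
  assumes "v \<in> V"
  shows "(\<lambda>x. x v) \<in> completion (unit_cube V) \<rightarrow>\<^sub>M unit_interval"
  using measure_preserving_completion[OF measure_preserving_unit_cube_component[OF assms]]
  by (simp add: measure_preserving_def unit_interval_eq_completion)

lemma space_unit_interval [simp]: "space unit_interval = {0..1}"
  by (simp add: space_restrict_space)

lemma prob_space_unit_interval: "prob_space unit_interval"
  unfolding unit_interval_eq_completion by (rule unit.prob_space_completion)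

interpretation unit_interval: prob_space unit_interval
  by (rule prob_space_unit_interval)

text \<open>The product formula is applied on the uncompleted cube. Each factor is therefore
  replaced by a Borel version; the exceptional null sets are finitely many, one for each
  coordinate.\<close>

lemma integral_unit_cube_prod:
  fixes w :: "nat \<Rightarrow> real \<Rightarrow> real"
  assumes V: "finite V" and w: "\<And>v. v \<in> V \<Longrightarrow> w v \<in> borel_measurable unit_interval"
    and b: "\<And>v x. v \<in> V \<Longrightarrow> x \<in> {0..1} \<Longrightarrow> \<bar>w v x\<bar> \<le> 1"
  shows "integrable (completion (unit_cube V)) (\<lambda>x. \<Prod>v\<in>V. w v (x v))"
    and "(LINT x|completion (unit_cube V). (\<Prod>v\<in>V. w v (x v))) = (\<Prod>v\<in>V. LINT t|unit_interval. w v t)"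
proof -
  interpret c: prob_space "completion (unit_cube V)"
    by (rule prob_space.prob_space_completion[OF prob_space_unit_cube])
  have meas: "(\<lambda>x. \<Prod>v\<in>V. w v (x v)) \<in> borel_measurable (completion (unit_cube V))"
    by (rule borel_measurable_prod, rule measurable_compose[OF measurable_component_completion w]) auto
  show "integrable (completion (unit_cube V)) (\<lambda>x. \<Prod>v\<in>V. w v (x v))"
  proof (rule c.integrable_const_bound[where B = 1])
    show "AE x in completion (unit_cube V). norm (\<Prod>v\<in>V. w v (x v)) \<le> 1"
    proof (rule AE_I2)
      fix x assume "x \<in> space (completion (unit_cube V))"
      then have "\<And>v. v \<in> V \<Longrightarrow> x v \<in> {0..1}" by (auto simp: space_PiM PiE_iff)
      then show "norm (\<Prod>v\<in>V. w v (x v)) \<le> 1"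
        using b by (auto simp: abs_prod intro!: prod_le_1)
    qed
  qed (fact meas)
  have "\<exists>w'. w' \<in> borel_measurable borel_unit \<and> (AE t in borel_unit. w v t = w' t)" if "v \<in> V" for v
    using completion_ex_borel_measurable_real[of "w v" borel_unit] w[OF that]
    by (auto simp: unit_interval_eq_completion)
  then obtain w' where w': "\<And>v. v \<in> V \<Longrightarrow> w' v \<in> borel_measurable borel_unit"
      "\<And>v. v \<in> V \<Longrightarrow> AE t in borel_unit. w v t = w' v t"
    by metis
  have [measurable]: "(\<lambda>x. \<Prod>v\<in>V. w' v (x v)) \<in> borel_measurable (unit_cube V)"
    by (rule borel_measurable_prod) (simp add: measurable_compose[OF measurable_component_singleton[of _ V "\<lambda>_. borel_unit"] w'(1)])
  have ae: "AE x in completion (unit_cube V). (\<Prod>v\<in>V. w v (x v)) = (\<Prod>v\<in>V. w' v (x v))"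
  proof (rule AE_completion)
    have "AE x in unit_cube V. \<forall>v\<in>V. w v (x v) = w' v (x v)"
      using V w'(2) by (intro AE_finite_allI AE_PiM_component prob_space_borel_unit) auto
    then show "AE x in unit_cube V. (\<Prod>v\<in>V. w v (x v)) = (\<Prod>v\<in>V. w' v (x v))"
      by eventually_elim (auto intro: prod.cong)
  qed
  have int_w': "integral\<^sup>L borel_unit (w' v) = integral\<^sup>L unit_interval (w v)" if "v \<in> V" for v
    using w'[OF that] w[OF that] unfolding unit_interval_eq_completion
    by (subst integral_completion[symmetric, of "w' v"]) (auto intro!: integral_cong_AE AE_completion measurable_completion)
  have b_w': "AE t in borel_unit. \<bar>w' v t\<bar> \<le> 1" if "v \<in> V" for v
    using w'(2)[OF that] AE_space by eventually_elim (use b[OF that] in \<open>metis space_borel_unit\<close>)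
  have "(LINT x|completion (unit_cube V). (\<Prod>v\<in>V. w v (x v))) = (LINT x|completion (unit_cube V). (\<Prod>v\<in>V. w' v (x v)))"
    by (rule integral_cong_AE[OF meas _ ae]) (auto intro: measurable_completion)
  also have "\<dots> = (LINT x|unit_cube V. (\<Prod>v\<in>V. w' v (x v)))"
    by (rule integral_completion) simp
  also have "\<dots> = (\<Prod>v\<in>V. LINT t|borel_unit. w' v t)"
    using V w' b_w' by (intro unit_product.product_integral_prod unit.integrable_const_bound[where B = 1]) auto
  also have "\<dots> = (\<Prod>v\<in>V. LINT t|unit_interval. w v t)"
    using int_w' by (intro prod.cong) auto
  finally show "(LINT x|completion (unit_cube V). (\<Prod>v\<in>V. w v (x v))) = (\<Prod>v\<in>V. LINT t|unit_interval. w v t)" .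
qed

lemma measure_preserving_compose:
  assumes "measure_preserving M N f" "measure_preserving N L g"
  shows "measure_preserving M L (g \<circ> f)"
  using assms distr_distr[of g N L f M] by (auto simp: measure_preserving_def)

lemma measure_preserving_fst: "measure_preserving unit_square unit_interval fst"
proof -
  have "measure_preserving (borel_unit \<Otimes>\<^sub>M borel_unit) borel_unit fst"
    using unit.distr_pair_fst[of borel_unit] by (simp add: measure_preserving_def)
  then show ?thesis
    unfolding unit_square_eq_completion unit_interval_eq_completion by (rule measure_preserving_completion)
qed

lemma measure_preserving_swap: "measure_preserving unit_square unit_square prod.swap"
proof -
  have "measure_preserving (borel_unit \<Otimes>\<^sub>M borel_unit) (borel_unit \<Otimes>\<^sub>M borel_unit) (\<lambda>(x, y). (y, x))"
    unfolding measure_preserving_def using unit_pair.distr_pair_swap[symmetric] by (simp add: measurable_pair_swap')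
  moreover have "(\<lambda>(x, y). (y, x)) = prod.swap" by auto
  ultimately show ?thesis
    unfolding unit_square_eq_completion using measure_preserving_completion by metis
qed

lemma measure_preserving_snd: "measure_preserving unit_square unit_interval snd"
  using measure_preserving_compose[OF measure_preserving_swap measure_preserving_fst]
  by (simp add: comp_def)

lemma AE_unit_pair_fst:
  assumes "AE x in borel_unit. P x"
  shows "AE p in borel_unit \<Otimes>\<^sub>M borel_unit. P (fst p)"
  by (rule AE_distrD[OF measurable_fst]) (subst unit.distr_pair_fst, rule assms)

lemma measurable_unit_square_fst:
  fixes u :: "real \<Rightarrow> real"
  assumes "u \<in> borel_measurable unit_interval"
  shows "(\<lambda>p. u (fst p)) \<in> borel_measurable unit_square"
  by (rule measurable_compose[OF _ assms]) (use measure_preserving_fst in \<open>simp add: measure_preserving_def\<close>)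

lemma measurable_unit_square_snd:
  fixes u :: "real \<Rightarrow> real"
  assumes "u \<in> borel_measurable unit_interval"
  shows "(\<lambda>p. u (snd p)) \<in> borel_measurable unit_square"
  by (rule measurable_compose[OF _ assms]) (use measure_preserving_snd in \<open>simp add: measure_preserving_def\<close>)

lemma integral_unit_square_mult:
  fixes u v :: "real \<Rightarrow> real"
  assumes "u \<in> borel_measurable unit_interval" "v \<in> borel_measurable unit_interval"
    and "\<And>x. x \<in> {0..1} \<Longrightarrow> \<bar>u x\<bar> \<le> 1" "\<And>x. x \<in> {0..1} \<Longrightarrow> \<bar>v x\<bar> \<le> 1"
  shows "integrable unit_square (\<lambda>(x, y). u x * v y)"
    and "(LINT (x, y)|unit_square. u x * v y) = (LINT x|unit_interval. u x) * (LINT y|unit_interval. v y)"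
proof -
  \<comment> \<open>The square is viewed as the cube over the two vertices of a single edge, so that
    the product formula over a finite index set applies.\<close>
  define H where "H = \<lparr>verts = {0, 1}, edges = {0}, src = \<lambda>_. 0, tgt = \<lambda>_. 1\<rparr>"
  have H: "is_multigraph H" by (auto simp: H_def is_multigraph_def)
  have m: "(\<lambda>(x, y). u x * v y) \<in> borel_measurable unit_square"
    using measurable_unit_square_fst[OF assms(1)] measurable_unit_square_snd[OF assms(2)] by (simp add: case_prod_unfold)
  then have "(\<lambda>(x, y). u x * v y) \<in> bounded_kernels"
    unfolding bounded_kernels_def using assms(3,4)
    by (auto intro!: exI[of _ 1] mult_le_one simp: abs_mult)
  then show "integrable unit_square (\<lambda>(x, y). u x * v y)" by (rule bounded_kernels_integrable)
  have "(LINT (x, y)|unit_square. u x * v y) = (LINT x|completion (unit_cube {0, 1}). (\<lambda>(x, y). u x * v y) (x 0, x 1))"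
    using integral_edge[OF H, of 0, OF _ m] by (simp add: H_def)
  also have "\<dots> = (LINT x|completion (unit_cube {0, 1}). (\<Prod>i\<in>{0,1}. (if i = 0 then u else v) (x i)))"
    by simp
  also have "\<dots> = (\<Prod>i\<in>{0,1::nat}. LINT t|unit_interval. (if i = 0 then u else v) t)"
    by (rule integral_unit_cube_prod(2)) (use assms in auto)
  finally show "(LINT (x, y)|unit_square. u x * v y) = (LINT x|unit_interval. u x) * (LINT y|unit_interval. v y)"
    by simp
qed

text \<open>Only the colouring \<open>restrict k V\<close> makes all indicators equal to 1. Read
  from right to left, this expands a function of finitely many colours into products of functions of
  one variable.\<close>

lemma sum_PiE_indicator:
  fixes c :: "('a \<Rightarrow> 'k) \<Rightarrow> real"
  assumes "finite V" "finite K" "\<And>v. v \<in> V \<Longrightarrow> k v \<in> K"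
  shows "(\<Sum>\<tau>\<in>V \<rightarrow>\<^sub>E K. c \<tau> * (\<Prod>v\<in>V. if k v = \<tau> v then 1 else 0)) = c (restrict k V)"
proof -
  have "(\<Prod>v\<in>V. if k v = \<tau> v then 1 else (0::real)) = (if \<tau> = restrict k V then 1 else 0)" if "\<tau> \<in> V \<rightarrow>\<^sub>E K" for \<tau>
  proof (cases "\<tau> = restrict k V")
    case False
    then have "\<exists>v\<in>V. k v \<noteq> \<tau> v"
      using that by (metis PiE_restrict restrict_ext)
    then show ?thesis using False assms(1) by auto
  qed auto
  then have "(\<Sum>\<tau>\<in>V \<rightarrow>\<^sub>E K. c \<tau> * (\<Prod>v\<in>V. if k v = \<tau> v then 1 else 0)) =
      (\<Sum>\<tau>\<in>V \<rightarrow>\<^sub>E K. if \<tau> = restrict k V then c \<tau> else 0)"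
    by (intro sum.cong) auto
  also have "\<dots> = c (restrict k V)"
    using assms by (subst sum.delta) (auto intro: finite_PiE)
  finally show ?thesis .
qed

text \<open>The integrand depends only on the colours \<open>\<kappa> (x v)\<close>. Expanded over
  colourings it becomes a sum of products of one-variable indicators, whose integrals are the masses
  of the colour classes. The type of colours is arbitrary, so that pairs of blocks can serve as
  colours for tensor products.\<close>

lemma hom_density_partition:
  fixes \<kappa> :: "real \<Rightarrow> 'k"
  assumes H: "is_multigraph H" and K: "finite K" "\<And>x. x \<in> {0..1} \<Longrightarrow> \<kappa> x \<in> K"
    and meas: "\<And>k. k \<in> K \<Longrightarrow> (\<kappa> -` {k} \<inter> {0..1}) \<in> sets unit_interval"
  shows "hom_density H (\<lambda>(x, y). A (\<kappa> x) (\<kappa> y)) =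
    (\<Sum>\<tau>\<in>verts H \<rightarrow>\<^sub>E K. (\<Prod>e\<in>edges H. A (\<tau> (src H e)) (\<tau> (tgt H e))) *
       (\<Prod>v\<in>verts H. measure unit_interval (\<kappa> -` {\<tau> v} \<inter> {0..1})))"
proof -
  have V: "finite (verts H)" using H by (simp add: is_multigraph_def)
  define w where "w k x = (if \<kappa> x = k then 1 else 0 :: real)" for k x
  have w_ind: "w k x = indicator (\<kappa> -` {k} \<inter> {0..1}) x" if "x \<in> {0..1}" for k x
    using that by (auto simp: w_def)
  have w: "w k \<in> borel_measurable unit_interval" if "k \<in> K" for k
    by (subst measurable_cong[where g = "indicator (\<kappa> -` {k} \<inter> {0..1})"]) (use w_ind meas[OF that] in auto)
  have b_w: "\<bar>w k x\<bar> \<le> 1" for k x by (simp add: w_def)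
  have int_w: "(LINT x|unit_interval. w k x) = measure unit_interval (\<kappa> -` {k} \<inter> {0..1})" if "k \<in> K" for k
  proof -
    have "(LINT x|unit_interval. w k x) = (LINT x|unit_interval. indicator (\<kappa> -` {k} \<inter> {0..1}) x)"
      by (rule Bochner_Integration.integral_cong) (use w_ind in auto)
    then show ?thesis using meas[OF that] by simp
  qed
  let ?c = "\<lambda>\<tau>. \<Prod>e\<in>edges H. A (\<tau> (src H e)) (\<tau> (tgt H e))"
  have "hom_density H (\<lambda>(x, y). A (\<kappa> x) (\<kappa> y)) =
      (LINT x|completion (unit_cube (verts H)). (\<Sum>\<tau>\<in>verts H \<rightarrow>\<^sub>E K. ?c \<tau> * (\<Prod>v\<in>verts H. w (\<tau> v) (x v))))"
    unfolding hom_density_def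
  proof (rule Bochner_Integration.integral_cong[OF refl])
    fix x assume "x \<in> space (completion (unit_cube (verts H)))"
    then have x: "x v \<in> {0..1}" if "v \<in> verts H" for v
      using that by (auto simp: space_PiM PiE_iff)
    have "(\<Sum>\<tau>\<in>verts H \<rightarrow>\<^sub>E K. ?c \<tau> * (\<Prod>v\<in>verts H. w (\<tau> v) (x v))) = ?c (restrict (\<lambda>v. \<kappa> (x v)) (verts H))"
      unfolding w_def using V K x by (intro sum_PiE_indicator) auto
    also have "\<dots> = (\<Prod>e\<in>edges H. A (\<kappa> (x (src H e))) (\<kappa> (x (tgt H e))))"
      using H by (intro prod.cong) (auto simp: is_multigraph_def)
    finally show "(\<Prod>e\<in>edges H. case (x (src H e), x (tgt H e)) of (x, y) \<Rightarrow> A (\<kappa> x) (\<kappa> y)) =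
        (\<Sum>\<tau>\<in>verts H \<rightarrow>\<^sub>E K. ?c \<tau> * (\<Prod>v\<in>verts H. w (\<tau> v) (x v)))" by simp
  qed
  also have "\<dots> = (\<Sum>\<tau>\<in>verts H \<rightarrow>\<^sub>E K. (LINT x|completion (unit_cube (verts H)). ?c \<tau> * (\<Prod>v\<in>verts H. w (\<tau> v) (x v))))"
    by (rule Bochner_Integration.integral_sum)
       (use w b_w in \<open>auto intro!: integrable_mult_right integral_unit_cube_prod(1)[OF V] simp: PiE_iff\<close>)
  also have "\<dots> = (\<Sum>\<tau>\<in>verts H \<rightarrow>\<^sub>E K. ?c \<tau> * (\<Prod>v\<in>verts H. measure unit_interval (\<kappa> -` {\<tau> v} \<inter> {0..1})))"
  proof (rule sum.cong[OF refl])
    fix \<tau> assume \<tau>: "\<tau> \<in> verts H \<rightarrow>\<^sub>E K"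
    have "(LINT x|completion (unit_cube (verts H)). ?c \<tau> * (\<Prod>v\<in>verts H. w (\<tau> v) (x v))) =
        ?c \<tau> * (LINT x|completion (unit_cube (verts H)). (\<Prod>v\<in>verts H. w (\<tau> v) (x v)))"
      by simp
    also have "(LINT x|completion (unit_cube (verts H)). (\<Prod>v\<in>verts H. w (\<tau> v) (x v))) =
        (\<Prod>v\<in>verts H. LINT x|unit_interval. w (\<tau> v) x)"
      by (rule integral_unit_cube_prod(2)[OF V]) (use w b_w \<tau> in \<open>auto simp: PiE_iff\<close>)
    also have "\<dots> = (\<Prod>v\<in>verts H. measure unit_interval (\<kappa> -` {\<tau> v} \<inter> {0..1}))"
      using int_w \<tau> by (intro prod.cong) (auto simp: PiE_iff)
    finally show "(LINT x|completion (unit_cube (verts H)). ?c \<tau> * (\<Prod>v\<in>verts H. w (\<tau> v) (x v))) =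
        ?c \<tau> * (\<Prod>v\<in>verts H. measure unit_interval (\<kappa> -` {\<tau> v} \<inter> {0..1}))" .
  qed
  finally show ?thesis .
qed

text \<open>The intervals are half-open on the left; the point 0 is put into the first one by truncated
  subtraction.\<close>

definition block :: "nat \<Rightarrow> real \<Rightarrow> nat" where
  "block n x = nat \<lceil>real n * x\<rceil> - 1"

definition step :: "nat \<Rightarrow> (nat \<Rightarrow> nat \<Rightarrow> real) \<Rightarrow> kernel" where
  "step n A = (\<lambda>(x, y). A (block n x) (block n y))"

definition sym_matrices :: "nat \<Rightarrow> (nat \<Rightarrow> nat \<Rightarrow> real) set" where
  "sym_matrices n = {A. \<forall>i<n. \<forall>j<n. A i j \<in> {0..1} \<and> A i j = A j i}"

lemma block_less: "n > 0 \<Longrightarrow> x \<in> {0..1} \<Longrightarrow> block n x < n"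
proof -
  assume n: "n > 0" "x \<in> {0..1}"
  then have "real n * x \<le> real n" by (simp add: mult_left_le)
  then have "\<lceil>real n * x\<rceil> \<le> int n" by (simp add: ceiling_le_iff)
  then show ?thesis using n by (auto simp: block_def)
qed

lemma block_eq_iff:
  assumes "n > 0" "x \<in> {0<..1}"
  shows "block n x = i \<longleftrightarrow> real i / n < x \<and> x \<le> (real i + 1) / n"
proof -
  have "\<lceil>real n * x\<rceil> \<ge> 1" using assms by simp
  then have "block n x = i \<longleftrightarrow> \<lceil>real n * x\<rceil> = int i + 1" unfolding block_def by linarith
  also have "\<dots> \<longleftrightarrow> real i < real n * x \<and> real n * x \<le> real i + 1" by (simp add: ceiling_eq_iff)
  also have "\<dots> \<longleftrightarrow> real i / n < x \<and> x \<le> (real i + 1) / n" using assms by (simp add: field_simps)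
  finally show ?thesis .
qed

lemma block_0 [simp]: "block n 0 = 0"
  by (simp add: block_def)

lemma block_preimage:
  assumes "n > 0" "i < n"
  shows "block n -` {i} \<inter> {0..1} = (if i = 0 then {0..1 / n} else {real i / n<..(real i + 1) / n})"
proof (rule set_eqI)
  fix x
  have le: "(real i + 1) / n \<le> 1" "1 / real n \<le> 1" using assms by simp_all
  have "x \<in> block n -` {i} \<inter> {0..1} \<longleftrightarrow> x = 0 \<and> i = 0 \<or> 0 < x \<and> x \<le> 1 \<and> real i / n < x \<and> x \<le> (real i + 1) / n"
    using block_eq_iff[OF assms(1), of x i] by (cases "x = 0") auto
  also have "\<dots> \<longleftrightarrow> x \<in> (if i = 0 then {0..1 / n} else {real i / n<..(real i + 1) / n})"
  proof (cases "i = 0")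
    case False
    then have "real i / n > 0" using assms by simp
    then show ?thesis using le False by (simp del: divide_le_eq_1) (use le in linarith)
  qed (use le in auto)
  finally show "x \<in> block n -` {i} \<inter> {0..1} \<longleftrightarrow> x \<in> (if i = 0 then {0..1 / n} else {real i / n<..(real i + 1) / n})" .
qed

lemma block_preimage_sets: "n > 0 \<Longrightarrow> i < n \<Longrightarrow> (block n -` {i} \<inter> {0..1}) \<in> sets borel"
  by (subst block_preimage) auto

lemma block_preimage_measure:
  assumes "n > 0" "i < n"
  shows "(block n -` {i} \<inter> {0..1}) \<in> sets unit_interval"
    and "measure unit_interval (block n -` {i} \<inter> {0..1}) = 1 / n"
proof -
  have s: "(block n -` {i} \<inter> {0..1}) \<in> sets borel" by (rule block_preimage_sets[OF assms])
  then show "(block n -` {i} \<inter> {0..1}) \<in> sets unit_interval"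
    by (auto simp: sets_restrict_space_iff)
  have "measure unit_interval (block n -` {i} \<inter> {0..1}) = measure lborel (block n -` {i} \<inter> {0..1})"
    using s by (subst measure_restrict_space) auto
  also have "\<dots> = 1 / n"
    using assms by (subst block_preimage[OF assms]) (auto simp: field_simps divide_right_mono)
  finally show "measure unit_interval (block n -` {i} \<inter> {0..1}) = 1 / n" .
qed

lemma hom_density_step:
  assumes "is_multigraph H" "n > 0"
  shows "hom_density H (step n A) =
    (\<Sum>\<tau>\<in>verts H \<rightarrow>\<^sub>E {..<n}. \<Prod>e\<in>edges H. A (\<tau> (src H e)) (\<tau> (tgt H e))) / n ^ card (verts H)"
proof -
  have "hom_density H (step n A) =
    (\<Sum>\<tau>\<in>verts H \<rightarrow>\<^sub>E {..<n}. (\<Prod>e\<in>edges H. A (\<tau> (src H e)) (\<tau> (tgt H e))) *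
       (\<Prod>v\<in>verts H. measure unit_interval (block n -` {\<tau> v} \<inter> {0..1})))"
    unfolding step_def using assms
    by (intro hom_density_partition) (auto simp: block_less block_preimage_measure)
  also have "\<dots> = (\<Sum>\<tau>\<in>verts H \<rightarrow>\<^sub>E {..<n}. (\<Prod>e\<in>edges H. A (\<tau> (src H e)) (\<tau> (tgt H e))) / n ^ card (verts H))"
  proof (rule sum.cong[OF refl])
    fix \<tau> assume "\<tau> \<in> verts H \<rightarrow>\<^sub>E {..<n}"
    then have "(\<Prod>v\<in>verts H. measure unit_interval (block n -` {\<tau> v} \<inter> {0..1})) = (\<Prod>v\<in>verts H. 1 / n)"
      using assms by (intro prod.cong) (auto simp: block_preimage_measure PiE_iff)
    then show "(\<Prod>e\<in>edges H. A (\<tau> (src H e)) (\<tau> (tgt H e))) *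
       (\<Prod>v\<in>verts H. measure unit_interval (block n -` {\<tau> v} \<inter> {0..1})) =
       (\<Prod>e\<in>edges H. A (\<tau> (src H e)) (\<tau> (tgt H e))) / n ^ card (verts H)"
      by (simp add: power_one_over)
  qed
  finally show ?thesis by (simp add: sum_divide_distrib)
qed

text \<open>At each point exactly one pair of block indicators is nonzero. Constant weights yield
  the \<open>L1_norm\<close> of a step kernel, indicator weights the integrals in the cut
  norm.\<close>

lemma integral_step:
  fixes D :: "nat \<Rightarrow> nat \<Rightarrow> real" and u v :: "real \<Rightarrow> real"
  assumes n: "n > 0" and u: "u \<in> borel_measurable unit_interval" and v: "v \<in> borel_measurable unit_interval"
    and bu: "\<And>x. x \<in> {0..1} \<Longrightarrow> \<bar>u x\<bar> \<le> 1" and bv: "\<And>x. x \<in> {0..1} \<Longrightarrow> \<bar>v x\<bar> \<le> 1"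
  shows "integrable unit_square (\<lambda>(x, y). step n D (x, y) * (u x * v y))" (is ?int)
    and "(LINT (x, y)|unit_square. step n D (x, y) * (u x * v y)) =
      (\<Sum>i<n. \<Sum>j<n. D i j * ((LINT x|unit_interval. indicator (block n -` {i} \<inter> {0..1}) x * u x) *
         (LINT y|unit_interval. indicator (block n -` {j} \<inter> {0..1}) y * v y)))" (is ?eq)
proof -
  define U where "U i x = indicator (block n -` {i} \<inter> {0..1}) x * u x" for i x
  define W where "W j y = indicator (block n -` {j} \<inter> {0..1}) y * v y" for j y
  have ind: "(indicator (block n -` {i} \<inter> {0..1}) :: real \<Rightarrow> real) \<in> borel_measurable unit_interval" if "i < n" for i
    using block_preimage_measure(1)[OF n that] by simp
  have U: "U i \<in> borel_measurable unit_interval" if "i < n" for i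
    unfolding U_def using ind[OF that] u by simp
  have W: "W i \<in> borel_measurable unit_interval" if "i < n" for i
    unfolding W_def using ind[OF that] v by simp
  have bU: "\<bar>U i x\<bar> \<le> 1" "\<bar>W i x\<bar> \<le> 1" if "x \<in> {0..1}" for i x
    using bu[OF that] bv[OF that] by (auto simp: U_def W_def indicator_def)
  note R = integral_unit_square_mult[OF U W bU]
  have eq: "step n D p * (u (fst p) * v (snd p)) = (\<Sum>i<n. \<Sum>j<n. D i j * (case p of (x, y) \<Rightarrow> U i x * W j y))"
    if sp: "p \<in> space unit_square" for p
  proof -
    obtain x y where p: "p = (x, y)" "x \<in> {0..1}" "y \<in> {0..1}" using sp by auto
    let ?i = "block n x" and ?j = "block n y" and ?c = "D (block n x) (block n y) * (u x * v y)"
    have "(\<Sum>i<n. \<Sum>j<n. D i j * (U i x * W j y)) = (\<Sum>i<n. \<Sum>j<n. if i = ?i \<and> j = ?j then ?c else 0)"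
      using p by (intro sum.cong refl) (auto simp: U_def W_def indicator_def)
    also have "\<dots> = (\<Sum>i<n. if i = ?i then ?c else 0)"
    proof (rule sum.cong[OF refl])
      fix i
      show "(\<Sum>j<n. if i = ?i \<and> j = ?j then ?c else 0) = (if i = ?i then ?c else 0)"
        using p block_less[OF n, of y] by (cases "i = ?i") (simp_all add: sum.delta')
    qed
    also have "\<dots> = ?c"
      using p block_less[OF n, of x] by (simp add: sum.delta')
    finally show ?thesis using p by (simp add: step_def)
  qed
  have int: "integrable unit_square (\<lambda>p. \<Sum>i<n. \<Sum>j<n. D i j * (case p of (x, y) \<Rightarrow> U i x * W j y))"
    by (intro Bochner_Integration.integrable_sum integrable_mult_right R) auto
  then have "integrable unit_square (\<lambda>p. step n D p * (u (fst p) * v (snd p)))"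
    by (subst Bochner_Integration.integrable_cong[OF refl eq]) auto
  then show ?int by (simp add: case_prod_unfold)
  have "(LINT (x, y)|unit_square. step n D (x, y) * (u x * v y)) =
      (LINT p|unit_square. (\<Sum>i<n. \<Sum>j<n. D i j * (case p of (x, y) \<Rightarrow> U i x * W j y)))"
    by (rule Bochner_Integration.integral_cong) (use eq in \<open>auto simp: case_prod_unfold\<close>)
  also have "\<dots> = (\<Sum>i<n. \<Sum>j<n. (LINT p|unit_square. D i j * (case p of (x, y) \<Rightarrow> U i x * W j y)))"
    by (subst Bochner_Integration.integral_sum; (intro sum.cong refl Bochner_Integration.integral_sum)?)
       (auto intro!: Bochner_Integration.integrable_sum integrable_mult_right R)
  also have "\<dots> = (\<Sum>i<n. \<Sum>j<n. D i j * ((LINT x|unit_interval. U i x) * (LINT y|unit_interval. W j y)))"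
    using R(2) by (intro sum.cong refl) auto
  finally show ?eq by (simp add: U_def W_def)
qed

lemma step_graphon:
  assumes "n > 0" "A \<in> sym_matrices n"
  shows "step n A \<in> graphons"
proof -
  have "(\<lambda>(x, y). step n A (x, y) * (1 * 1)) \<in> borel_measurable unit_square"
    using integral_step(1)[OF assms(1), of "\<lambda>_. 1" "\<lambda>_. 1" A] by (simp add: borel_measurable_integrable)
  then have "step n A \<in> borel_measurable unit_square" by simp
  then show ?thesis
    using assms block_less[OF assms(1)]
    by (auto simp: graphons_def kernels_def step_def sym_matrices_def intro!: exI[of _ 1])
qed

lemma L1_norm_step:
  assumes n: "n > 0"
  shows "L1_norm (step n D) = (\<Sum>i<n. \<Sum>j<n. \<bar>D i j\<bar>) / n ^ 2"
proof -
  have "L1_norm (step n D) = (LINT (x, y)|unit_square. step n (\<lambda>i j. \<bar>D i j\<bar>) (x, y) * (1 * 1))"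
    by (auto simp: L1_norm_def step_def intro!: arg_cong[where f = "integral\<^sup>L unit_square"])
  also have "\<dots> = (\<Sum>i<n. \<Sum>j<n. \<bar>D i j\<bar> * ((LINT x|unit_interval. indicator (block n -` {i} \<inter> {0..1}) x * 1) *
         (LINT y|unit_interval. indicator (block n -` {j} \<inter> {0..1}) y * 1)))"
    by (rule integral_step(2)[OF n]) auto
  also have "\<dots> = (\<Sum>i<n. \<Sum>j<n. \<bar>D i j\<bar> / n ^ 2)"
    using block_preimage_measure[OF n] by (intro sum.cong refl) (auto simp: power2_eq_square)
  finally show ?thesis by (simp add: sum_divide_distrib)
qed

section \<open>Approximation in the \<open>L1_norm\<close> by continuous graphons and by step
  graphons\<close>

lemma L1_norm_triangle:
  assumes "f \<in> bounded_kernels" "g \<in> bounded_kernels" "h \<in> bounded_kernels"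
  shows "L1_norm (\<lambda>p. f p - h p) \<le> L1_norm (\<lambda>p. f p - g p) + L1_norm (\<lambda>p. g p - h p)"
proof -
  have i: "integrable unit_square (\<lambda>p. \<bar>f p - g p\<bar>)" "integrable unit_square (\<lambda>p. \<bar>g p - h p\<bar>)"
      "integrable unit_square (\<lambda>p. \<bar>f p - h p\<bar>)"
    using assms by (intro integrable_abs bounded_kernels_integrable bounded_kernels_diff; simp)+
  have "L1_norm (\<lambda>p. f p - h p) \<le> (LINT p|unit_square. \<bar>f p - g p\<bar> + \<bar>g p - h p\<bar>)"
    unfolding L1_norm_def by (rule integral_mono) (use i in auto)
  then show ?thesis
    unfolding L1_norm_def using i by simp
qed

lemma L1_norm_commute: "L1_norm (\<lambda>p. f p - g p) = L1_norm (\<lambda>p. g p - f p)"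
  by (simp add: L1_norm_def abs_minus_commute)

lemma L1_norm_le:
  assumes "f \<in> bounded_kernels" "\<And>p. p \<in> {0..1} \<times> {0..1} \<Longrightarrow> \<bar>f p\<bar> \<le> c"
  shows "L1_norm f \<le> c"
proof -
  have "L1_norm f \<le> (LINT p|unit_square. c)"
    unfolding L1_norm_def using bounded_kernels_integrable[OF assms(1)] assms(2)
    by (intro integral_mono integrable_abs) auto
  also have "\<dots> = c" using unit_square.prob_space by simp
  finally show ?thesis .
qed

lemma graphons_measurable: "f \<in> graphons \<Longrightarrow> f \<in> borel_measurable unit_square"
  by (simp add: graphons_def kernels_def)

lemma negligible_swap: 
  assumes "negligible (N :: (real \<times> real) set)"
  shows "negligible (prod.swap ` N)"
proof -
  have "linear (prod.swap :: real \<times> real \<Rightarrow> _)"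
    by (rule linearI) auto
  then show ?thesis
    using assms by (intro negligible_differentiable_image_negligible linear_imp_differentiable_on) auto
qed

lemma continuous_graphons_dense:
  assumes f: "f \<in> graphons" and e: "e > 0"
  obtains c where "c \<in> graphons" "continuous_on ({0..1} \<times> {0..1}) c" "L1_norm (\<lambda>p. f p - c p) < e"
proof -
  have S: "{0..1::real} \<times> {0..1::real} \<in> sets lebesgue"
    by (rule sets_completionI_sets) (auto simp: closed_Times intro!: borel_closed)
  have "f \<in> borel_measurable unit_square"
    using f by (simp add: graphons_def kernels_def)
  then have "f measurable_on ({0..1} \<times> {0..1})"
    using measurable_on_iff_borel_measurable[OF S] by blast
  then obtain N g where N: "negligible N" and g: "\<And>n. continuous_on UNIV (g n)"
      "\<And>x. x \<notin> N \<Longrightarrow> (\<lambda>n. g n x) \<longlonglongrightarrow> (if x \<in> {0..1} \<times> {0..1} then f x else 0)"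
    unfolding measurable_on_def by blast
  \<comment> \<open>Averaging with the transpose and clipping to the unit interval turn
    \<open>g n\<close> into a continuous graphon. The limit is still \<open>f\<close>, which is
    symmetric with values in that interval, except on \<open>N\<close> and its mirror image.\<close>
  define c where "c n p = max 0 (min 1 ((g n p + g n (prod.swap p)) / 2))" for n p
  have cont: "continuous_on UNIV (c n)" for n
    unfolding c_def
    by (intro continuous_intros continuous_on_compose2[OF g(1)]) (auto simp: g prod.swap_def intro!: continuous_intros)
  have c: "c n \<in> graphons" for n
  proof -
    have "c n \<in> borel_measurable borel" using cont by (rule borel_measurable_continuous_onI)
    then have "c n \<in> borel_measurable lebesgue" by (intro measurable_completion) simp
    then have "c n \<in> borel_measurable unit_square" by (rule measurable_restrict_space1)
    moreover have "c n (x, y) = c n (y, x)" for x y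
      by (simp add: c_def add.commute)
    moreover have "0 \<le> c n p" "c n p \<le> 1" "\<bar>c n p\<bar> \<le> 1" for p
      by (auto simp: c_def)
    ultimately show ?thesis
      by (auto simp: graphons_def kernels_def intro!: exI[of _ 1])
  qed
  have lim: "(\<lambda>n. c n p) \<longlonglongrightarrow> f p" if "p \<in> {0..1} \<times> {0..1}" "p \<notin> N" "p \<notin> prod.swap ` N" for p
  proof -
    have sp: "prod.swap p \<notin> N" using that(3) by (metis imageI swap_swap)
    have "f (prod.swap p) = f p"
      using f that(1) by (cases p) (auto simp: graphons_def kernels_def)
    then have "(\<lambda>n. (g n p + g n (prod.swap p)) / 2) \<longlonglongrightarrow> (f p + f p) / 2"
      using g(2)[OF that(2)] g(2)[OF sp] that(1) by (intro tendsto_intros) auto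
    then have "(\<lambda>n. c n p) \<longlonglongrightarrow> max 0 (min 1 (f p))"
      unfolding c_def by (intro tendsto_intros) simp
    moreover have "f p \<in> {0..1}" using f that(1) unfolding graphons_def by blast
    ultimately show ?thesis by simp
  qed
  have "(\<lambda>n. L1_norm (\<lambda>p. f p - c n p)) \<longlonglongrightarrow> (LINT p|unit_square. 0)"
    unfolding L1_norm_def
  proof (rule integral_dominated_convergence[where w = "\<lambda>_. 1"])
    show "AE p in unit_square. (\<lambda>n. \<bar>f p - c n p\<bar>) \<longlonglongrightarrow> 0"
    proof -
      have "negligible (N \<union> prod.swap ` N)" using N negligible_swap by simp
      then have "AE p in lebesgue. p \<notin> N \<union> prod.swap ` N"
        unfolding negligible_iff_null_sets by (rule AE_not_in)
      then have "AE p in unit_square. p \<notin> N \<union> prod.swap ` N"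
        using S by (subst AE_restrict_space_iff) (auto elim: AE_mp)
      with AE_space show ?thesis
      proof eventually_elim
        case (elim p)
        then have "(\<lambda>n. \<bar>f p - c n p\<bar>) \<longlonglongrightarrow> \<bar>f p - f p\<bar>"
          by (intro tendsto_intros lim) auto
        then show ?case by simp
      qed
    qed
    show "AE p in unit_square. norm \<bar>f p - c n p\<bar> \<le> 1" for n
      using AE_space
    proof eventually_elim
      case (elim p)
      then have "f p \<in> {0..1}" "c n p \<in> {0..1}" using f c by (auto simp: graphons_def)
      then show ?case by (auto simp: abs_if)
    qed
  qed (use graphons_measurable[OF f] graphons_measurable[OF c] in simp_all)
  then have "\<forall>\<^sub>F n in sequentially. L1_norm (\<lambda>p. f p - c n p) < e"
    using e by (intro order_tendstoD) auto
  then obtain n where "L1_norm (\<lambda>p. f p - c n p) < e"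
    unfolding eventually_sequentially by blast
  with c cont that show ?thesis by (meson continuous_on_subset subset_UNIV)
qed

lemma block_close:
  assumes "n > 0" "x \<in> {0..1}"
  shows "\<bar>x - (real (block n x) + 1) / n\<bar> \<le> 1 / n"
proof (cases "x = 0")
  case False
  then have "real (block n x) / n < x \<and> x \<le> (real (block n x) + 1) / n"
    using assms block_eq_iff[of n x "block n x"] by auto
  then show ?thesis by (auto simp: abs_if add_divide_distrib)
qed (use assms in simp)

lemma step_graphons_dense:
  assumes f: "f \<in> graphons" and e: "e > 0"
  obtains n A where "n > 0" "A \<in> sym_matrices n" "L1_norm (\<lambda>p. f p - step n A p) < e"
proof -
  obtain c where c: "c \<in> graphons" "continuous_on ({0..1} \<times> {0..1}) c" "L1_norm (\<lambda>p. f p - c p) < e / 2"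
    using continuous_graphons_dense[OF f, of "e / 2"] e by auto
  have "uniformly_continuous_on ({0..1} \<times> {0..1}) c"
    by (rule compact_uniformly_continuous[OF c(2)]) (intro compact_Times compact_Icc)
  then obtain d where d: "d > 0" "\<And>p q. p \<in> {0..1} \<times> {0..1} \<Longrightarrow> q \<in> {0..1} \<times> {0..1} \<Longrightarrow> dist q p < d \<Longrightarrow> dist (c q) (c p) < e / 2"
    unfolding uniformly_continuous_on_def using e by (metis half_gt_zero)
  obtain n where n: "n > 0" "2 / real n < d"
    using d(1) real_arch_inverse[of "d / 2"] by (auto simp: field_simps)
  \<comment> \<open>Entries are the values at the upper corners of the blocks. Each coordinate is
    off by at most \<open>1 / n\<close>, hence the requirement \<open>2 / n < d\<close>.\<close>
  define A where "A i j = c ((real i + 1) / n, (real j + 1) / n)" for i j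
  have grid: "(real i + 1) / n \<in> {0..1}" if "i < n" for i
    using that by auto
  have A: "A \<in> sym_matrices n"
    using c(1) grid by (fastforce simp: sym_matrices_def A_def graphons_def kernels_def)
  have "L1_norm (\<lambda>p. c p - step n A p) \<le> e / 2"
  proof (rule L1_norm_le)
    show "(\<lambda>p. c p - step n A p) \<in> bounded_kernels"
      by (intro bounded_kernels_diff graphons_bounded c step_graphon n A)
    fix p :: "real \<times> real" assume p: "p \<in> {0..1} \<times> {0..1}"
    then obtain x y where xy: "p = (x, y)" "x \<in> {0..1}" "y \<in> {0..1}" by auto
    let ?q = "((real (block n x) + 1) / n, (real (block n y) + 1) / n)"
    have "dist p ?q \<le> dist x ((real (block n x) + 1) / n) + dist y ((real (block n y) + 1) / n)"
      unfolding xy dist_Pair_Pair by (rule sqrt_sum_squares_le_sum) auto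
    also have "\<dots> \<le> 2 / n"
      using block_close[OF n(1) xy(2)] block_close[OF n(1) xy(3)] by (simp add: dist_real_def)
    finally have "dist (c p) (c ?q) < e / 2"
      using n grid[OF block_less[OF n(1) xy(2)]] grid[OF block_less[OF n(1) xy(3)]] p
      by (intro d(2)) (auto simp: xy(1) dist_commute)
    then show "\<bar>c p - step n A p\<bar> \<le> e / 2"
      by (simp add: xy step_def A_def dist_real_def)
  qed
  then have "L1_norm (\<lambda>p. f p - step n A p) < e"
    using L1_norm_triangle[of f c "step n A"] c f A n by (simp add: graphons_bounded step_graphon)
  with n A that show ?thesis by blast
qed

section \<open>Tensor products\<close>

lemma graphonsI:
  assumes "f \<in> borel_measurable unit_square"
    and "\<And>x y. x \<in> {0..1} \<Longrightarrow> y \<in> {0..1} \<Longrightarrow> 0 \<le> f (x, y) \<and> f (x, y) \<le> 1"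
    and "\<And>x y. x \<in> {0..1} \<Longrightarrow> y \<in> {0..1} \<Longrightarrow> f (x, y) = f (y, x)"
  shows "f \<in> graphons"
  unfolding graphons_def kernels_def
proof (intro CollectI conjI ballI)
  show "\<exists>B. \<forall>p\<in>{0..1} \<times> {0..1}. \<bar>f p\<bar> \<le> B"
    using assms(2) by (intro exI[of _ 1]) auto
qed (use assms in auto)

lemma graphons_range: "f \<in> graphons \<Longrightarrow> p \<in> {0..1} \<times> {0..1} \<Longrightarrow> 0 \<le> f p \<and> f p \<le> 1"
  unfolding graphons_def by fastforce

lemma graphons_symmetric: "f \<in> graphons \<Longrightarrow> x \<in> {0..1} \<Longrightarrow> y \<in> {0..1} \<Longrightarrow> f (x, y) = f (y, x)"
  by (simp add: graphons_def kernels_def)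

text \<open>In a complete measure space, changing a map on a null set changes preimages by null sets
  only. That values stay in \<open>space N\<close> is a pointwise condition and has to be
  assumed.\<close>

lemma measure_preserving_completion_cong_AE:
  assumes T': "measure_preserving (completion M) (completion N) T'" and ae: "AE x in M. T x = T' x"
    and T: "T \<in> space M \<rightarrow> space N"
  shows "measure_preserving (completion M) (completion N) T"
proof -
  have m': "T' \<in> completion M \<rightarrow>\<^sub>M completion N" and d': "distr (completion M) (completion N) T' = completion N"
    using T' by (auto simp: measure_preserving_def)
  have eq: "AE x in completion M. x \<in> T' -` A \<inter> space (completion M) \<longleftrightarrow> x \<in> T -` A \<inter> space (completion M)" for A
    using AE_completion[OF ae] by eventually_elim auto
  have m: "T \<in> completion M \<rightarrow>\<^sub>M completion N"
  proof (rule measurableI)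
    fix A assume "A \<in> sets (completion N)"
    from measurable_sets[OF m' this] show "T -` A \<inter> space (completion M) \<in> sets (completion M)"
      by (rule completion.in_sets_AE[OF eq]) simp
  qed (use T in auto)
  have "distr (completion M) (completion N) T = completion N"
  proof (rule measure_eqI)
    fix A assume "A \<in> sets (distr (completion M) (completion N) T)"
    then have A: "A \<in> sets (completion N)" by simp
    have "emeasure (distr (completion M) (completion N) T) A = emeasure (completion M) (T -` A \<inter> space (completion M))"
      by (rule emeasure_distr[OF m A])
    also have "\<dots> = emeasure (completion M) (T' -` A \<inter> space (completion M))"
      using eq[of A] measurable_sets[OF m A] measurable_sets[OF m' A] by (intro emeasure_eq_AE) auto
    also have "\<dots> = emeasure (completion N) A"
      using emeasure_distr[OF m' A] d' by simp
    finally show "emeasure (distr (completion M) (completion N) T) A = emeasure (completion N) A" .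
  qed simp
  with m show ?thesis by (simp add: measure_preserving_def)
qed

text \<open>A Lebesgue measurable \<open>\<psi>\<close> gives no measurable map of the uncompleted
  product. A Borel version \<open>h\<close> does; it preserves the product measure, passes to the
  completion, and agrees with \<open>\<psi>\<close> in both coordinates almost everywhere.\<close>

lemma measure_preserving_unit_square_product:
  assumes "measure_preserving unit_interval unit_interval \<psi>"
  shows "measure_preserving unit_square unit_square (\<lambda>(x, y). (\<psi> x, \<psi> y))"
proof -
  have \<psi>: "\<psi> \<in> unit_interval \<rightarrow>\<^sub>M unit_interval" "distr unit_interval unit_interval \<psi> = unit_interval"
    using assms by (auto simp: measure_preserving_def)
  have range: "\<psi> x \<in> {0..1}" if "x \<in> {0..1}" for x
    using measurable_space[OF \<psi>(1), of x] that by simp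
  have "(\<lambda>x. x) \<in> unit_interval \<rightarrow>\<^sub>M borel"
    by (intro measurable_restrict_space1 measurable_completion) simp
  from measurable_compose[OF \<psi>(1) this] have "\<psi> \<in> borel_measurable (completion borel_unit)"
    by (simp add: unit_interval_eq_completion)
  then obtain g where g: "g \<in> borel_measurable borel_unit" "AE x in borel_unit. \<psi> x = g x"
    using completion_ex_borel_measurable_real by blast
  \<comment> \<open>The Borel version agrees with \<open>\<psi>\<close> only almost everywhere and
    may leave the unit interval elsewhere, hence the clipping.\<close>
  define h where "h x = max 0 (min 1 (g x))" for x
  have h: "h \<in> borel_unit \<rightarrow>\<^sub>M borel_unit"
    using g(1) unfolding h_def[abs_def] by (intro measurable_restrict_space2) auto
  have ae: "AE x in borel_unit. \<psi> x = h x"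
    using g(2) AE_space by eventually_elim (use range in \<open>fastforce simp: h_def\<close>)
  have "distr borel_unit borel_unit h = borel_unit"
  proof (rule measure_eqI)
    fix A assume "A \<in> sets (distr borel_unit borel_unit h)"
    then have A: "A \<in> sets borel_unit" by simp
    then have A': "A \<in> sets unit_interval" by (simp add: unit_interval_eq_completion)
    have m: "h -` A \<inter> space borel_unit \<in> sets borel_unit" by (rule measurable_sets[OF h A])
    have "emeasure (distr borel_unit borel_unit h) A = emeasure unit_interval (h -` A \<inter> space borel_unit)"
      using m by (simp add: emeasure_distr[OF h A] unit_interval_eq_completion)
    also have "\<dots> = emeasure unit_interval (\<psi> -` A \<inter> space unit_interval)"
    proof (rule emeasure_eq_AE)
      show "AE x in unit_interval. (x \<in> h -` A \<inter> space borel_unit) = (x \<in> \<psi> -` A \<inter> space unit_interval)"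
        using AE_completion[OF ae] unfolding unit_interval_eq_completion by eventually_elim simp
      show "\<psi> -` A \<inter> space unit_interval \<in> sets unit_interval" by (rule measurable_sets[OF \<psi>(1) A'])
    qed (use m in \<open>simp add: unit_interval_eq_completion\<close>)
    also have "\<dots> = emeasure unit_interval A"
      using emeasure_distr[OF \<psi>(1) A'] \<psi>(2) by simp
    also have "\<dots> = emeasure borel_unit A"
      using A by (simp add: unit_interval_eq_completion)
    finally show "emeasure (distr borel_unit borel_unit h) A = emeasure borel_unit A" .
  qed simp
  then have "borel_unit \<Otimes>\<^sub>M borel_unit = distr (borel_unit \<Otimes>\<^sub>M borel_unit) (borel_unit \<Otimes>\<^sub>M borel_unit) (\<lambda>(x, y). (h x, h y))"
    using pair_measure_distr[OF h h] by (simp add: unit.sigma_finite_measure_axioms)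
  moreover have "(\<lambda>(x, y). (h x, h y)) \<in> borel_unit \<Otimes>\<^sub>M borel_unit \<rightarrow>\<^sub>M borel_unit \<Otimes>\<^sub>M borel_unit"
    using h by measurable
  ultimately have "measure_preserving (borel_unit \<Otimes>\<^sub>M borel_unit) (borel_unit \<Otimes>\<^sub>M borel_unit) (\<lambda>(x, y). (h x, h y))"
    by (simp add: measure_preserving_def)
  then have mp: "measure_preserving unit_square unit_square (\<lambda>(x, y). (h x, h y))"
    unfolding unit_square_eq_completion by (rule measure_preserving_completion)
  have fst: "AE p in borel_unit \<Otimes>\<^sub>M borel_unit. \<psi> (fst p) = h (fst p)"
    by (rule AE_unit_pair_fst[OF ae])
  have snd: "AE p in borel_unit \<Otimes>\<^sub>M borel_unit. \<psi> (snd p) = h (snd p)"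
  proof -
    have "AE p in distr (borel_unit \<Otimes>\<^sub>M borel_unit) (borel_unit \<Otimes>\<^sub>M borel_unit) (\<lambda>(x, y). (y, x)). \<psi> (fst p) = h (fst p)"
      using fst unit_pair.distr_pair_swap by metis
    from AE_distrD[OF measurable_pair_swap' this] show ?thesis by (simp add: case_prod_unfold)
  qed
  show ?thesis
    unfolding unit_square_eq_completion
  proof (rule measure_preserving_completion_cong_AE[OF mp[unfolded unit_square_eq_completion]])
    show "AE p in borel_unit \<Otimes>\<^sub>M borel_unit. (case p of (x, y) \<Rightarrow> (\<psi> x, \<psi> y)) = (case p of (x, y) \<Rightarrow> (h x, h y))"
      using fst snd by eventually_elim (auto simp: case_prod_beta)
  qed (use range in \<open>auto simp: space_pair_measure\<close>)
qed

lemma measure_preserving_integral: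
  fixes h :: "_ \<Rightarrow> real"
  assumes "measure_preserving M N T" "h \<in> borel_measurable N"
  shows "(LINT x|M. h (T x)) = (LINT x|N. h x)"
  using assms integral_distr[of T M N h] by (simp add: measure_preserving_def)

text \<open>As a pointwise product of two pullbacks along measure-preserving maps, the tensor
  product inherits its measurability and \<open>L1_norm\<close> estimates from
  \<open>relabel\<close> and from products.\<close>

lemma tensor_relabel:
  "tensor \<phi> f g = (\<lambda>p. relabel f (fst \<circ> \<phi>) p * relabel g (snd \<circ> \<phi>) p)"
  by (auto simp: tensor_def relabel_def)

lemma relabel_comp: "relabel f \<psi> = f \<circ> (\<lambda>(x, y). (\<psi> x, \<psi> y))"
  by (auto simp: relabel_def)

lemma relabel_graphon:
  assumes "measure_preserving unit_interval unit_interval \<psi>" "f \<in> graphons"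
  shows "relabel f \<psi> \<in> graphons"
proof -
  have mp: "measure_preserving unit_square unit_square (\<lambda>(x, y). (\<psi> x, \<psi> y))"
    by (rule measure_preserving_unit_square_product[OF assms(1)])
  have range: "\<psi> x \<in> {0..1}" if "x \<in> {0..1}" for x
    using measurable_space[of \<psi> unit_interval unit_interval x] assms(1) that by (simp add: measure_preserving_def)
  have "relabel f \<psi> \<in> borel_measurable unit_square"
    unfolding relabel_comp using mp assms(2)
    by (intro measurable_comp[where N = unit_square]) (auto simp: measure_preserving_def graphons_def kernels_def)
  then show ?thesis
    using graphons_range[OF assms(2)] graphons_symmetric[OF assms(2)] range
    by (intro graphonsI) (auto simp: relabel_def)
qed

lemma L1_norm_relabel:
  assumes "measure_preserving unit_interval unit_interval \<psi>" "f \<in> graphons" "g \<in> graphons"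
  shows "L1_norm (\<lambda>p. relabel f \<psi> p - relabel g \<psi> p) = L1_norm (\<lambda>p. f p - g p)"
  using measure_preserving_integral[OF measure_preserving_unit_square_product[OF assms(1)], of "\<lambda>p. \<bar>f p - g p\<bar>"] assms(2,3)
  by (auto simp: L1_norm_def relabel_comp graphons_def kernels_def)

lemma mult_graphon:
  assumes "f \<in> graphons" "g \<in> graphons"
  shows "(\<lambda>p. f p * g p) \<in> graphons"
proof (rule graphonsI)
  fix x y :: real assume xy: "x \<in> {0..1}" "y \<in> {0..1}"
  then have "(x, y) \<in> {0..1} \<times> {0..1}" by simp
  from graphons_range[OF assms(1) this] graphons_range[OF assms(2) this]
  show "0 \<le> f (x, y) * g (x, y) \<and> f (x, y) * g (x, y) \<le> 1"
    by (auto intro: mult_le_one)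
  show "f (x, y) * g (x, y) = f (y, x) * g (y, x)"
    using graphons_symmetric[OF _ xy] assms by metis
qed (use assms[THEN graphons_measurable] in simp)

lemma L1_norm_mult:
  assumes "f \<in> graphons" "g \<in> graphons" "f' \<in> graphons" "g' \<in> graphons"
  shows "L1_norm (\<lambda>p. f p * g p - f' p * g' p) \<le> L1_norm (\<lambda>p. f p - f' p) + L1_norm (\<lambda>p. g p - g' p)"
proof -
  note b = bounded_kernels_diff[OF graphons_bounded graphons_bounded]
  have i: "integrable unit_square (\<lambda>p. \<bar>f p - f' p\<bar>)" "integrable unit_square (\<lambda>p. \<bar>g p - g' p\<bar>)"
      "integrable unit_square (\<lambda>p. \<bar>f p * g p - f' p * g' p\<bar>)"
    using assms by (intro integrable_abs bounded_kernels_integrable b mult_graphon; simp)+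
  have "L1_norm (\<lambda>p. f p * g p - f' p * g' p) \<le> (LINT p|unit_square. \<bar>f p - f' p\<bar> + \<bar>g p - g' p\<bar>)"
    unfolding L1_norm_def
  proof (rule integral_mono)
    fix p assume "p \<in> space unit_square"
    then have "f p \<in> {0..1}" "g p \<in> {0..1}" "f' p \<in> {0..1}" "g' p \<in> {0..1}"
      using assms by (auto simp: graphons_def)
    then have "\<bar>f p - f' p\<bar> * \<bar>g p\<bar> \<le> \<bar>f p - f' p\<bar>" "\<bar>f' p\<bar> * \<bar>g p - g' p\<bar> \<le> \<bar>g p - g' p\<bar>"
      by (auto intro: mult_left_le mult_left_le_one_le)
    moreover have "f p * g p - f' p * g' p = (f p - f' p) * g p + f' p * (g p - g' p)"
      by (simp add: algebra_simps)
    ultimately show "\<bar>f p * g p - f' p * g' p\<bar> \<le> \<bar>f p - f' p\<bar> + \<bar>g p - g' p\<bar>"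
      using abs_triangle_ineq[of "(f p - f' p) * g p" "f' p * (g p - g' p)"] by (simp add: abs_mult)
  qed (use i in auto)
  then show ?thesis
    unfolding L1_norm_def using i by simp
qed

lemma sum_PiE_Times:
  assumes "finite V"
  shows "(\<Sum>\<tau>\<in>V \<rightarrow>\<^sub>E K \<times> L. F (\<lambda>v\<in>V. fst (\<tau> v)) (\<lambda>v\<in>V. snd (\<tau> v))) = (\<Sum>\<rho>\<in>V \<rightarrow>\<^sub>E K. \<Sum>\<sigma>\<in>V \<rightarrow>\<^sub>E L. F \<rho> \<sigma>)"
  unfolding sum.cartesian_product
  by (rule sum.reindex_bij_witness[where i = "\<lambda>(\<rho>, \<sigma>). \<lambda>v\<in>V. (\<rho> v, \<sigma> v)" and j = "\<lambda>\<tau>. (\<lambda>v\<in>V. fst (\<tau> v), \<lambda>v\<in>V. snd (\<tau> v))"])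
     (auto simp: PiE_iff extensional_def fun_eq_iff mem_Times_iff)

context
  fixes \<phi> :: "real \<Rightarrow> real \<times> real"
  assumes \<phi>: "measure_preserving unit_interval unit_square \<phi>"
begin

lemma measure_preserving_fst_comp: "measure_preserving unit_interval unit_interval (fst \<circ> \<phi>)"
  and measure_preserving_snd_comp: "measure_preserving unit_interval unit_interval (snd \<circ> \<phi>)"
  using measure_preserving_compose[OF \<phi>] measure_preserving_fst measure_preserving_snd by blast+

lemma tensor_graphon: "f \<in> graphons \<Longrightarrow> g \<in> graphons \<Longrightarrow> tensor \<phi> f g \<in> graphons"
  unfolding tensor_relabel
  by (intro mult_graphon relabel_graphon measure_preserving_fst_comp measure_preserving_snd_comp)

lemma L1_norm_tensor:
  assumes "f \<in> graphons" "g \<in> graphons" "f' \<in> graphons" "g' \<in> graphons"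
  shows "L1_norm (\<lambda>p. tensor \<phi> f g p - tensor \<phi> f' g' p) \<le> L1_norm (\<lambda>p. f p - f' p) + L1_norm (\<lambda>p. g p - g' p)"
  unfolding tensor_relabel
  using L1_norm_mult[of "relabel f (fst \<circ> \<phi>)" "relabel g (snd \<circ> \<phi>)" "relabel f' (fst \<circ> \<phi>)" "relabel g' (snd \<circ> \<phi>)"] assms
  by (simp add: relabel_graphon measure_preserving_fst_comp measure_preserving_snd_comp L1_norm_relabel)

text \<open>Pulled back by \<open>\<phi>\<close>, the pairs of blocks partition the unit interval
  into sets of measure \<open>1 / (n * m)\<close>. A colouring by pairs is a pair of colourings, so
  the sum of \<open>hom_density_partition\<close> factors.\<close>

lemma hom_density_tensor_step:
  assumes H: "is_multigraph H" and n: "n > 0" and m: "m > 0"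
  shows "hom_density H (tensor \<phi> (step n A) (step m B)) = hom_density H (step n A) * hom_density H (step m B)"
proof -
  let ?\<kappa> = "\<lambda>x. (block n (fst (\<phi> x)), block m (snd (\<phi> x)))"
  let ?V = "verts H"
  have V: "finite ?V" using H by (simp add: is_multigraph_def)
  have \<phi>m: "\<phi> \<in> unit_interval \<rightarrow>\<^sub>M unit_square" "distr unit_interval unit_square \<phi> = unit_square"
    using \<phi> by (auto simp: measure_preserving_def)
  have range: "fst (\<phi> x) \<in> {0..1}" "snd (\<phi> x) \<in> {0..1}" if "x \<in> {0..1}" for x
    using measurable_space[OF \<phi>m(1), of x] that by (auto simp: mem_Times_iff)
  define R where "R i j = (block n -` {i} \<inter> {0..1}) \<times> (block m -` {j} \<inter> {0..1})" for i j
  have ind: "indicator (R i j) = (\<lambda>(x, y). indicator (block n -` {i} \<inter> {0..1}) x * indicator (block m -` {j} \<inter> {0..1}) y :: real)" for i j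
    by (auto simp: R_def indicator_def fun_eq_iff)
  have R: "R i j \<in> sets unit_square" "measure unit_square (R i j) = 1 / n * (1 / m)" if "i < n" "j < m" for i j
  proof -
    have "R i j \<subseteq> space unit_square" by (auto simp: R_def)
    moreover have "integrable unit_square (indicator (R i j) :: _ \<Rightarrow> real)"
      unfolding ind using block_preimage_measure[OF n that(1)] block_preimage_measure[OF m that(2)]
      by (intro integral_unit_square_mult(1)) auto
    ultimately show R: "R i j \<in> sets unit_square"
      by (metis borel_measurable_indicator_iff borel_measurable_integrable inf.orderE)
    have "measure unit_square (R i j) = (LINT p|unit_square. indicator (R i j) p)"
      using R sets.Int_space_eq2[OF R] by (simp del: space_unit_square)
    also have "\<dots> = 1 / n * (1 / m)"
      unfolding ind
      using block_preimage_measure[OF n that(1)] block_preimage_measure[OF m that(2)]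
      by (subst integral_unit_square_mult(2)) auto
    finally show "measure unit_square (R i j) = 1 / n * (1 / m)" .
  qed
  have pre: "?\<kappa> -` {(i, j)} \<inter> {0..1} = \<phi> -` R i j \<inter> space unit_interval" for i j
    using range by (auto simp: R_def mem_Times_iff)
  have meas: "?\<kappa> -` {k} \<inter> {0..1} \<in> sets unit_interval" "measure unit_interval (?\<kappa> -` {k} \<inter> {0..1}) = 1 / n * (1 / m)"
    if kn: "k \<in> {..<n} \<times> {..<m}" for k
  proof -
    obtain i j where k: "k = (i, j)" "i < n" "j < m" using kn by auto
    have "measure unit_square (R i j) = measure (distr unit_interval unit_square \<phi>) (R i j)"
      by (simp add: \<phi>m(2))
    also have "\<dots> = measure unit_interval (\<phi> -` R i j \<inter> space unit_interval)"
      by (rule measure_distr[OF \<phi>m(1) R(1)[OF k(2,3)]])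
    finally show "measure unit_interval (?\<kappa> -` {k} \<inter> {0..1}) = 1 / n * (1 / m)"
      using R(2)[OF k(2,3)] by (simp add: k pre)
    show "?\<kappa> -` {k} \<inter> {0..1} \<in> sets unit_interval"
      unfolding k pre by (rule measurable_sets[OF \<phi>m(1) R(1)[OF k(2,3)]])
  qed
  define a where "a \<rho> = (\<Prod>e\<in>edges H. A (\<rho> (src H e)) (\<rho> (tgt H e)))" for \<rho>
  define b where "b \<rho> = (\<Prod>e\<in>edges H. B (\<rho> (src H e)) (\<rho> (tgt H e)))" for \<rho>
  have "tensor \<phi> (step n A) (step m B) = (\<lambda>(x, y). (\<lambda>k l. A (fst k) (fst l) * B (snd k) (snd l)) (?\<kappa> x) (?\<kappa> y))"
    by (auto simp: tensor_def step_def)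
  then have "hom_density H (tensor \<phi> (step n A) (step m B)) =
    (\<Sum>\<tau>\<in>?V \<rightarrow>\<^sub>E {..<n} \<times> {..<m}. (\<Prod>e\<in>edges H. A (fst (\<tau> (src H e))) (fst (\<tau> (tgt H e))) * B (snd (\<tau> (src H e))) (snd (\<tau> (tgt H e)))) *
       (\<Prod>v\<in>?V. measure unit_interval (?\<kappa> -` {\<tau> v} \<inter> {0..1})))"
    using range block_less n m meas(1) by (simp only:) (subst hom_density_partition[OF H, where K = "{..<n} \<times> {..<m}"]; auto)
  also have "\<dots> = (\<Sum>\<tau>\<in>?V \<rightarrow>\<^sub>E {..<n} \<times> {..<m}. a (\<lambda>v\<in>?V. fst (\<tau> v)) * b (\<lambda>v\<in>?V. snd (\<tau> v)) / (n ^ card ?V * m ^ card ?V))"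
  proof (rule sum.cong[OF refl])
    fix \<tau> assume \<tau>: "\<tau> \<in> ?V \<rightarrow>\<^sub>E {..<n} \<times> {..<m}"
    have "(\<Prod>v\<in>?V. measure unit_interval (?\<kappa> -` {\<tau> v} \<inter> {0..1})) = (\<Prod>v\<in>?V. 1 / n * (1 / m))"
      using \<tau> by (intro prod.cong refl meas(2)) (auto simp: PiE_iff)
    also have "\<dots> = 1 / (n ^ card ?V * m ^ card ?V)"
      by (simp add: power_one_over power_mult_distrib)
    finally have 1: "(\<Prod>v\<in>?V. measure unit_interval (?\<kappa> -` {\<tau> v} \<inter> {0..1})) = 1 / (n ^ card ?V * m ^ card ?V)" .
    have "(\<Prod>e\<in>edges H. A (fst (\<tau> (src H e))) (fst (\<tau> (tgt H e))) * B (snd (\<tau> (src H e))) (snd (\<tau> (tgt H e)))) =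
      a (\<lambda>v\<in>?V. fst (\<tau> v)) * b (\<lambda>v\<in>?V. snd (\<tau> v))"
      using H by (simp add: prod.distrib a_def b_def is_multigraph_def)
    with 1 show "(\<Prod>e\<in>edges H. A (fst (\<tau> (src H e))) (fst (\<tau> (tgt H e))) * B (snd (\<tau> (src H e))) (snd (\<tau> (tgt H e)))) *
       (\<Prod>v\<in>?V. measure unit_interval (?\<kappa> -` {\<tau> v} \<inter> {0..1})) =
       a (\<lambda>v\<in>?V. fst (\<tau> v)) * b (\<lambda>v\<in>?V. snd (\<tau> v)) / (n ^ card ?V * m ^ card ?V)" by simp
  qed
  also have "\<dots> = (\<Sum>\<rho>\<in>?V \<rightarrow>\<^sub>E {..<n}. \<Sum>\<sigma>\<in>?V \<rightarrow>\<^sub>E {..<m}. a \<rho> * b \<sigma> / (n ^ card ?V * m ^ card ?V))"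
    by (rule sum_PiE_Times[OF V])
  also have "\<dots> = hom_density H (step n A) * hom_density H (step m B)"
    unfolding hom_density_step[OF H n] hom_density_step[OF H m] a_def[symmetric] b_def[symmetric]
    by (simp add: sum_product sum_divide_distrib)
  finally show ?thesis .
qed

lemma hom_density_range:
  assumes H: "is_multigraph H" and f: "f \<in> graphons"
  shows "hom_density H f \<in> {0..1}"
proof -
  interpret c: prob_space "completion (unit_cube (verts H))"
    by (rule prob_space.prob_space_completion[OF prob_space_unit_cube])
  have r: "(\<Prod>e\<in>edges H. f (x (src H e), x (tgt H e))) \<in> {0..1}" if "x \<in> space (unit_cube (verts H))" for x
  proof -
    have "f (x (src H e), x (tgt H e)) \<in> {0..1}" if "e \<in> edges H" for e
      using edge_in_unit_square[OF H that \<open>x \<in> _\<close>] f unfolding graphons_def by blast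
    then show ?thesis by (auto intro!: prod_nonneg prod_le_1)
  qed
  have "hom_density H f \<le> (LINT x|completion (unit_cube (verts H)). 1)"
    unfolding hom_density_def using r f
    by (intro integral_mono integrable_decorated[OF H, of "\<lambda>_. f"]) (auto intro: graphons_bounded)
  moreover have "0 \<le> hom_density H f"
    unfolding hom_density_def using r by (intro Bochner_Integration.integral_nonneg) auto
  ultimately show ?thesis using c.prob_space by simp
qed

text \<open>Both sides are continuous for the \<open>L1_norm\<close>, so the identity carries over
  from step graphons.\<close>

lemma hom_density_tensor:
  assumes H: "is_multigraph H" and f: "f \<in> graphons" and g: "g \<in> graphons"
  shows "hom_density H (tensor \<phi> f g) = hom_density H f * hom_density H g"
proof (rule ccontr)
  assume ne: "hom_density H (tensor \<phi> f g) \<noteq> hom_density H f * hom_density H g"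
  define d where "d = \<bar>hom_density H (tensor \<phi> f g) - hom_density H f * hom_density H g\<bar>"
  define k where "k = real (card (edges H)) + 1"
  have d: "d > 0" and k: "k > 0" using ne by (auto simp: d_def k_def)
  \<comment> \<open>The tensor product moves by at most \<open>2 * (d / (5 * k))\<close>, and the
    product of the densities by two errors of \<open>d / 5\<close>. Together this is
    \<open>4 * d / 5\<close>, less than the assumed gap \<open>d\<close>.\<close>
  obtain n A where A: "n > 0" "A \<in> sym_matrices n" "L1_norm (\<lambda>p. f p - step n A p) < d / (5 * k)"
    using step_graphons_dense[OF f, of "d / (5 * k)"] d k by auto
  obtain m B where B: "m > 0" "B \<in> sym_matrices m" "L1_norm (\<lambda>p. g p - step m B p) < d / (5 * k)"
    using step_graphons_dense[OF g, of "d / (5 * k)"] d k by auto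
  let ?f = "step n A" and ?g = "step m B"
  have fg': "?f \<in> graphons" "?g \<in> graphons" using A B by (auto intro: step_graphon)
  have L1: "\<bar>hom_density H u - hom_density H v\<bar> \<le> k * e"
    if "u \<in> graphons" "v \<in> graphons" "L1_norm (\<lambda>p. u p - v p) \<le> e" for u v e
  proof -
    have "\<bar>hom_density H u - hom_density H v\<bar> \<le> card (edges H) * L1_norm (\<lambda>p. u p - v p)"
      by (rule hom_density_L1[OF H that(1,2)])
    also have "\<dots> \<le> k * e"
      using that(3) L1_norm_nonneg[of "\<lambda>p. u p - v p"] by (intro mult_mono) (auto simp: k_def)
    finally show ?thesis .
  qed
  have 1: "\<bar>hom_density H f - hom_density H ?f\<bar> \<le> d / 5" "\<bar>hom_density H g - hom_density H ?g\<bar> \<le> d / 5"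
    using L1[OF f fg'(1), of "d / (5 * k)"] L1[OF g fg'(2), of "d / (5 * k)"] A B k by auto
  have "L1_norm (\<lambda>p. tensor \<phi> f g p - tensor \<phi> ?f ?g p) \<le> 2 * (d / (5 * k))"
    using L1_norm_tensor[OF f g fg'] A B by simp
  then have 2: "\<bar>hom_density H (tensor \<phi> f g) - hom_density H (tensor \<phi> ?f ?g)\<bar> \<le> 2 * d / 5"
    using L1[OF tensor_graphon[OF f g] tensor_graphon[OF fg']] k by fastforce
  have "hom_density H f * hom_density H g - hom_density H ?f * hom_density H ?g =
     (hom_density H f - hom_density H ?f) * hom_density H g + hom_density H ?f * (hom_density H g - hom_density H ?g)"
    by (simp add: algebra_simps)
  also have "\<bar>\<dots>\<bar> \<le> \<bar>hom_density H f - hom_density H ?f\<bar> * 1 + 1 * \<bar>hom_density H g - hom_density H ?g\<bar>"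
    using hom_density_range[OF H g] hom_density_range[OF H fg'(1)]
    by (intro order.trans[OF abs_triangle_ineq] add_mono; simp only: abs_mult; intro mult_mono) auto
  also have "\<dots> \<le> 2 * d / 5" using 1 by simp
  finally have "\<bar>hom_density H f * hom_density H g - hom_density H ?f * hom_density H ?g\<bar> \<le> 2 * d / 5" .
  then have "d \<le> 4 * d / 5"
    using 2 hom_density_tensor_step[OF H A(1) B(1), of A B] unfolding d_def by (simp add: abs_if split: if_splits)
  then show False using d by simp
qed

lemma tensor_power_Suc: "n > 0 \<Longrightarrow> tensor_power \<phi> f (Suc n) = tensor \<phi> (tensor_power \<phi> f n) f"
  by (cases n) (auto simp: tensor_power_def)

lemma tensor_power_graphon:
  assumes "f \<in> graphons" "n > 0"
  shows "tensor_power \<phi> f n \<in> graphons"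
  using assms(2)
proof (induction n rule: nat_induct_non_zero)
  case 1
  then show ?case using assms by (simp add: tensor_power_def)
next
  case (Suc n)
  then show ?case using assms by (simp add: tensor_power_Suc tensor_graphon)
qed

lemma hom_density_tensor_power:
  assumes "is_multigraph H" "f \<in> graphons" "n > 0"
  shows "hom_density H (tensor_power \<phi> f n) = hom_density H f ^ n"
  using assms(3)
proof (induction n rule: nat_induct_non_zero)
  case 1
  then show ?case using assms by (simp add: tensor_power_def)
next
  case (Suc n)
  then show ?case using assms by (simp add: tensor_power_Suc hom_density_tensor tensor_power_graphon)
qed

end

section \<open>Gateaux derivatives of densities\<close>

lemma graphons_convex:
  assumes "f \<in> graphons" "g \<in> graphons" "t \<in> {0..1}"
  shows "(\<lambda>p. (1 - t) * f p + t * g p) \<in> graphons"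
proof (rule graphonsI)
  fix x y :: real assume xy: "x \<in> {0..1}" "y \<in> {0..1}"
  then have "(x, y) \<in> {0..1} \<times> {0..1}" by simp
  note r = graphons_range[OF assms(1) this] graphons_range[OF assms(2) this]
  show "0 \<le> (1 - t) * f (x, y) + t * g (x, y) \<and> (1 - t) * f (x, y) + t * g (x, y) \<le> 1"
    using r assms(3) convex_bound_le[of "f (x, y)" 1 "g (x, y)" "1 - t" t] by simp
  show "(1 - t) * f (x, y) + t * g (x, y) = (1 - t) * f (y, x) + t * g (y, x)"
    using graphons_symmetric[OF _ xy] assms by metis
qed (use assms(1,2)[THEN graphons_measurable] in simp)

lemma zero_in_steps: "f \<in> graphons \<Longrightarrow> 0 \<in> steps f g"
  by (simp add: steps_def)

lemma steps_convex:
  assumes "a \<in> steps f g" "b \<in> steps f g" "t \<in> {0..1}"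
  shows "(1 - t) * a + t * b \<in> steps f g"
proof -
  have "(\<lambda>p. (1 - t) * (f p + a * g p) + t * (f p + b * g p)) \<in> graphons"
    using assms by (intro graphons_convex) (auto simp: steps_def)
  moreover have "(1 - t) * (f p + a * g p) + t * (f p + b * g p) = f p + ((1 - t) * a + t * b) * g p" for p
    by (simp add: algebra_simps)
  ultimately show ?thesis by (simp add: steps_def)
qed

lemma steps_scale:
  assumes "f \<in> graphons" "b \<in> steps f g" "b \<noteq> 0" "0 \<le> l / b" "l / b \<le> 1"
  shows "l \<in> steps f g"
  using steps_convex[OF zero_in_steps[OF assms(1)] assms(2), of "l / b"] assms by simp

lemma AdmE:
  assumes "g \<in> Adm f"
  obtains b where "b > 0" "b \<in> steps f g" "\<And>e. 0 < e \<Longrightarrow> e \<le> b \<Longrightarrow> e \<in> steps f g"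
proof -
  have "\<forall>\<^sub>F e in at_right 0. e \<in> steps f g"
    using assms by (simp add: Adm_def steps_def)
  then obtain b where "b > 0" "\<And>e. 0 < e \<Longrightarrow> e < b \<Longrightarrow> e \<in> steps f g"
    unfolding eventually_at_right_field by blast
  then show thesis by (intro that[of "b / 2"]) auto
qed

text \<open>\<open>gateaux\<close> is defined through \<open>Lim\<close>, which is determined by
  convergence only along a nontrivial filter; an admissible direction supplies a right neighbourhood
  of 0.\<close>

lemma at_within_steps_nontrivial:
  assumes "g \<in> Adm f"
  shows "at (0::real) within steps f g \<noteq> bot"
proof -
  obtain b where b: "b > 0" "\<And>e. 0 < e \<Longrightarrow> e \<le> b \<Longrightarrow> e \<in> steps f g"
    using AdmE[OF assms] by metis
  have "at (0::real) within {0<..<b} \<noteq> bot"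
    using b(1) by (simp add: at_within_eq_bot_iff trivial_limit_within islimpt_greaterThanLessThan1)
  moreover have "at (0::real) within {0<..<b} \<le> at 0 within steps f g"
    by (rule at_le) (use b(2) in auto)
  ultimately show ?thesis using bot.extremum_unique by fastforce
qed

text \<open>\<open>steps f g\<close> is convex and contains 0, so small multiples of any of its
  points belong to it. The doubled step leaves room for a second direction at a midpoint.\<close>

lemma eventually_double_step:
  assumes f: "f \<in> graphons" and g: "g \<in> Adm f"
  shows "\<forall>\<^sub>F l in at 0 within steps f g. l \<in> steps f g \<and> 2 * l \<in> steps f g"
proof -
  obtain b where b: "b > 0" "b \<in> steps f g" using AdmE[OF g] by metis
  \<comment> \<open>If some negative step is allowed, \<open>- c\<close> is one. Otherwise
    \<open>c\<close> is a dummy, and the case of negative \<open>l\<close> below cannot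
    occur.\<close>
  obtain c where c: "c > 0" "(\<exists>c>0. - c \<in> steps f g) \<Longrightarrow> - c \<in> steps f g"
    by (metis zero_less_one)
  have "2 * l \<in> steps f g" if l: "l \<in> steps f g" "\<bar>l\<bar> < min b c / 2" for l
  proof (cases "l \<ge> 0")
    case True
    show ?thesis
    proof (rule steps_scale[OF f b(2)])
      show "0 \<le> 2 * l / b" using True b(1) by (intro divide_nonneg_pos) auto
      show "2 * l / b \<le> 1" using l(2) b(1) by (subst divide_le_eq_1_pos) auto
    qed (use b(1) in simp)
  next
    case False
    then have "- c \<in> steps f g" using l by (intro c(2)) (auto intro!: exI[of _ "- l"])
    then show ?thesis
    proof (rule steps_scale[OF f])
      show "0 \<le> 2 * l / - c" using False c(1) by (intro divide_nonpos_neg) auto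
      show "2 * l / - c \<le> 1" using l(2) c(1) by (subst divide_le_eq_1_neg) auto
    qed (use c(1) in simp)
  qed
  then show ?thesis
    unfolding eventually_at using b(1) c(1) by (intro exI[of _ "min b c / 2"]) (auto simp: dist_real_def)
qed

text \<open>Convexity: \<open>f + l g + e g' = ((f + 2 l g) + (f + 2 e g')) / 2\<close>.\<close>

lemma eventually_Adm_step:
  assumes f: "f \<in> graphons" and g: "g \<in> Adm f" and g': "g' \<in> Adm f"
  shows "\<forall>\<^sub>F l in at 0 within steps f g. g' \<in> Adm (\<lambda>p. f p + l * g p)"
  using eventually_double_step[OF f g]
proof eventually_elim
  case (elim l)
  obtain b where b: "b > 0" "\<And>e. 0 < e \<Longrightarrow> e \<le> b \<Longrightarrow> e \<in> steps f g'"
    using AdmE[OF g'] by metis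
  have "(\<lambda>p. f p + l * g p + e * g' p) \<in> graphons" if "0 < e" "e < b / 2" for e
  proof -
    have "(\<lambda>p. (1 - 1 / 2) * (f p + (2 * l) * g p) + 1 / 2 * (f p + (2 * e) * g' p)) \<in> graphons"
      using elim b(2)[of "2 * e"] that by (intro graphons_convex) (auto simp: steps_def)
    moreover have "(1 - 1 / 2) * (f p + (2 * l) * g p) + 1 / 2 * (f p + (2 * e) * g' p) = f p + l * g p + e * g' p" for p
      by (simp add: field_simps)
    ultimately show ?thesis by simp
  qed
  then have "\<forall>\<^sub>F e in at_right 0. (\<lambda>p. f p + l * g p + e * g' p) \<in> graphons"
    unfolding eventually_at_right_field using b(1) by (intro exI[of _ "b / 2"]) auto
  then show ?case using g' by (simp add: Adm_def)
qed

text \<open>Degree less than \<open>k\<close>. Only one derivative is taken at a time, which avoids a formula for the iterated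
  derivatives of a density.\<close>

primrec polynomial_functional :: "nat \<Rightarrow> (kernel \<Rightarrow> real) \<Rightarrow> bool" where
  "polynomial_functional 0 P \<longleftrightarrow> (\<forall>f\<in>graphons. P f = 0)"
| "polynomial_functional (Suc k) P \<longleftrightarrow>
     (\<forall>g\<in>kernels. \<exists>Q. polynomial_functional k Q \<and>
        (\<forall>f\<in>graphons. ((\<lambda>l. (P (\<lambda>p. f p + l * g p) - P f) / l) \<longlongrightarrow> Q f) (at 0 within steps f g)))"

text \<open>A difference quotient of the next order evaluates the derivative at neighbouring
  graphons. The induction therefore carries one functional \<open>R\<close> that represents it
  wherever the directions are admissible, and small steps preserve admissibility. The remaining
  degree \<open>k\<close> varies, since each derivative lowers it by one.\<close>

lemma polynomial_functional_gateaux: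
  assumes "polynomial_functional (n + k) P" "\<And>i. i \<in> {1..n} \<Longrightarrow> g i \<in> kernels"
  shows "\<exists>R. polynomial_functional k R \<and> (\<forall>f\<in>graphons. (\<forall>i\<in>{1..n}. g i \<in> Adm f) \<longrightarrow>
    gateaux_exists P n f g \<and> gateaux P n f g = R f)"
  using assms
proof (induction n arbitrary: k)
  case 0
  then show ?case by auto
next
  case (Suc n)
  from Suc.IH[of "Suc k"] Suc.prems obtain R where R: "polynomial_functional (Suc k) R"
    "\<And>f. f \<in> graphons \<Longrightarrow> (\<forall>i\<in>{1..n}. g i \<in> Adm f) \<Longrightarrow> gateaux_exists P n f g \<and> gateaux P n f g = R f"
    by auto
  have "g (Suc n) \<in> kernels" using Suc.prems(2) by simp
  then obtain Q where Q: "polynomial_functional k Q"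
    "\<And>f. f \<in> graphons \<Longrightarrow> ((\<lambda>l. (R (\<lambda>p. f p + l * g (Suc n) p) - R f) / l) \<longlongrightarrow> Q f) (at 0 within steps f (g (Suc n)))"
    using R(1) by auto
  have "gateaux_exists P (Suc n) f g \<and> gateaux P (Suc n) f g = Q f"
    if f: "f \<in> graphons" and adm: "\<forall>i\<in>{1..Suc n}. g i \<in> Adm f" for f
  proof -
    have gf: "gateaux_exists P n f g" "gateaux P n f g = R f" using R(2)[OF f] adm by auto
    have g: "g (Suc n) \<in> Adm f" using adm by simp
    have "\<forall>\<^sub>F l in at 0 within steps f (g (Suc n)). \<forall>i\<in>{1..n}. g i \<in> Adm (\<lambda>p. f p + l * g (Suc n) p)"
      using adm by (intro eventually_ball_finite ballI eventually_Adm_step[OF f g]) auto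
    with eventually_double_step[OF f g]
    have ev: "\<forall>\<^sub>F l in at 0 within steps f (g (Suc n)).
        gateaux_exists P n (\<lambda>p. f p + l * g (Suc n) p) g \<and>
        gateaux P n (\<lambda>p. f p + l * g (Suc n) p) g = R (\<lambda>p. f p + l * g (Suc n) p)"
      by eventually_elim (use R(2) in \<open>simp add: steps_def\<close>)
    have lim: "((\<lambda>l. (gateaux P n (\<lambda>p. f p + l * g (Suc n) p) g - gateaux P n f g) / l) \<longlongrightarrow> Q f)
        (at 0 within steps f (g (Suc n)))"
      by (rule Lim_transform_eventually[OF Q(2)[OF f]]) (use ev in \<open>eventually_elim; simp add: gf\<close>)
    have "\<forall>\<^sub>F l in at 0 within steps f (g (Suc n)). gateaux_exists P n (\<lambda>p. f p + l * g (Suc n) p) g"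
      using ev by eventually_elim simp
    then show ?thesis
      using lim gf tendsto_Lim[OF at_within_steps_nontrivial[OF g] lim] by auto
  qed
  then show ?case using Q(1) by blast
qed

lemma polynomial_functional_cong:
  assumes "\<And>f. f \<in> graphons \<Longrightarrow> P f = P' f" "polynomial_functional k P"
  shows "polynomial_functional k P'"
proof (cases k)
  case (Suc n)
  show ?thesis unfolding Suc polynomial_functional.simps
  proof
    fix g assume "g \<in> kernels"
    then obtain Q where Q: "polynomial_functional n Q"
      "\<And>f. f \<in> graphons \<Longrightarrow> ((\<lambda>l. (P (\<lambda>p. f p + l * g p) - P f) / l) \<longlongrightarrow> Q f) (at 0 within steps f g)"
      using assms(2) Suc by auto
    have "((\<lambda>l. (P' (\<lambda>p. f p + l * g p) - P' f) / l) \<longlongrightarrow> Q f) (at 0 within steps f g)" if f: "f \<in> graphons" for f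
    proof (rule Lim_transform_eventually[OF Q(2)[OF f]])
      have "\<forall>\<^sub>F l in at 0 within steps f g. l \<in> steps f g" by (simp add: eventually_at_filter)
      then show "\<forall>\<^sub>F l in at 0 within steps f g.
          (P (\<lambda>p. f p + l * g p) - P f) / l = (P' (\<lambda>p. f p + l * g p) - P' f) / l"
        by eventually_elim (use assms(1) f in \<open>simp add: steps_def\<close>)
    qed
    with Q(1) show "\<exists>Q. polynomial_functional n Q \<and>
        (\<forall>f\<in>graphons. ((\<lambda>l. (P' (\<lambda>p. f p + l * g p) - P' f) / l) \<longlongrightarrow> Q f) (at 0 within steps f g))"
      by blast
  qed
qed (use assms in simp)

lemma polynomial_functional_zero: "polynomial_functional k (\<lambda>_. 0)"
  by (induction k) (auto intro!: exI[of _ "\<lambda>_. 0"])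

lemma polynomial_functional_add:
  assumes "polynomial_functional k P" "polynomial_functional k P'"
  shows "polynomial_functional k (\<lambda>f. P f + P' f)"
  using assms
proof (induction k arbitrary: P P')
  case (Suc k)
  show ?case unfolding polynomial_functional.simps
  proof
    fix g assume g: "g \<in> kernels"
    obtain Q where Q: "polynomial_functional k Q"
      "\<And>f. f \<in> graphons \<Longrightarrow> ((\<lambda>l. (P (\<lambda>p. f p + l * g p) - P f) / l) \<longlongrightarrow> Q f) (at 0 within steps f g)"
      using Suc.prems(1) g unfolding polynomial_functional.simps by blast
    obtain Q' where Q': "polynomial_functional k Q'"
      "\<And>f. f \<in> graphons \<Longrightarrow> ((\<lambda>l. (P' (\<lambda>p. f p + l * g p) - P' f) / l) \<longlongrightarrow> Q' f) (at 0 within steps f g)"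
      using Suc.prems(2) g unfolding polynomial_functional.simps by blast
    have "((\<lambda>l. (P (\<lambda>p. f p + l * g p) + P' (\<lambda>p. f p + l * g p) - (P f + P' f)) / l) \<longlongrightarrow> Q f + Q' f) (at 0 within steps f g)"
      if f: "f \<in> graphons" for f
      using tendsto_add[OF Q(2)[OF f] Q'(2)[OF f]] by (simp add: add_divide_distrib diff_divide_distrib algebra_simps)
    with Suc.IH[OF Q(1) Q'(1)] show "\<exists>R. polynomial_functional k R \<and> (\<forall>f\<in>graphons.
        ((\<lambda>l. (P (\<lambda>p. f p + l * g p) + P' (\<lambda>p. f p + l * g p) - (P f + P' f)) / l) \<longlongrightarrow> R f) (at 0 within steps f g))"
      by (intro exI[of _ "\<lambda>f. Q f + Q' f"]) auto
  qed
qed auto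

lemma polynomial_functional_sum:
  assumes "\<And>i. i \<in> I \<Longrightarrow> polynomial_functional k (P i)"
  shows "polynomial_functional k (\<lambda>f. \<Sum>i\<in>I. P i f)"
  using assms
  by (induction I rule: infinite_finite_induct) (auto intro: polynomial_functional_zero polynomial_functional_add)

text \<open>Expanding the product over the edges, \<open>X\<close> is the set of edges that
  contribute \<open>v\<close>, and its term carries \<open>l ^ card X\<close>. The singletons give
  the linear coefficient, a product rule.\<close>

lemma decorated_density_line:
  assumes H: "is_multigraph H"
    and u: "\<And>e. e \<in> edges H \<Longrightarrow> u e \<in> bounded_kernels" and v: "\<And>e. e \<in> edges H \<Longrightarrow> v e \<in> bounded_kernels"
  obtains q :: "real poly" where "degree q \<le> card (edges H)"
    "\<And>l. decorated_density H (\<lambda>e p. u e p + l * v e p) = poly q l"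
    "coeff q 1 = (\<Sum>e\<in>edges H. decorated_density H (u(e := v e)))"
proof -
  let ?E = "edges H"
  let ?M = "completion (unit_cube (verts H))"
  have fin: "finite ?E" using H by (simp add: is_multigraph_def)
  define w where "w X e = (if e \<in> X then v e else u e)" for X e
  define q where "q = (\<Sum>X\<in>Pow ?E. monom (decorated_density H (w X)) (card X))"
  have w: "w X e \<in> bounded_kernels" if "e \<in> ?E" for X e
    using u v that by (simp add: w_def)
  have "degree q \<le> card ?E"
    unfolding q_def using fin
    by (intro degree_sum_le) (auto intro: order.trans[OF degree_monom_le] card_mono)
  moreover have "decorated_density H (\<lambda>e p. u e p + l * v e p) = poly q l" for l
  proof -
    let ?f = "\<lambda>h x. h (x (src H e), x (tgt H e))"
    have "decorated_density H (\<lambda>e p. u e p + l * v e p) =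
        (LINT x|?M. (\<Sum>X\<in>Pow ?E. l ^ card X * (\<Prod>e\<in>?E. w X e (x (src H e), x (tgt H e)))))"
      unfolding decorated_density_def
    proof (rule Bochner_Integration.integral_cong[OF refl])
      fix x
      let ?u = "\<lambda>e. u e (x (src H e), x (tgt H e))" and ?v = "\<lambda>e. v e (x (src H e), x (tgt H e))"
      have "(\<Prod>e\<in>?E. ?u e + l * ?v e) = (\<Prod>e\<in>?E. l * ?v e + ?u e)" by (simp add: add.commute)
      also have "\<dots> = (\<Sum>X\<in>Pow ?E. (\<Prod>e\<in>X. l * ?v e) * (\<Prod>e\<in>?E - X. ?u e))"
        by (rule prod_add[OF fin])
      also have "\<dots> = (\<Sum>X\<in>Pow ?E. l ^ card X * (\<Prod>e\<in>?E. w X e (x (src H e), x (tgt H e))))"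
      proof (rule sum.cong[OF refl])
        fix X assume X: "X \<in> Pow ?E"
        then have "(\<Prod>e\<in>?E. w X e (x (src H e), x (tgt H e))) =
            (\<Prod>e\<in>?E - X. w X e (x (src H e), x (tgt H e))) * (\<Prod>e\<in>X. w X e (x (src H e), x (tgt H e)))"
          using fin by (intro prod.subset_diff) auto
        also have "\<dots> = (\<Prod>e\<in>?E - X. ?u e) * (\<Prod>e\<in>X. ?v e)"
          by (intro arg_cong2[where f = "(*)"] prod.cong) (auto simp: w_def)
        finally show "(\<Prod>e\<in>X. l * ?v e) * (\<Prod>e\<in>?E - X. ?u e) = l ^ card X * (\<Prod>e\<in>?E. w X e (x (src H e), x (tgt H e)))"
          by (simp add: prod.distrib)
      qed
      finally show "(\<Prod>e\<in>?E. ?u e + l * ?v e) = (\<Sum>X\<in>Pow ?E. l ^ card X * (\<Prod>e\<in>?E. w X e (x (src H e), x (tgt H e))))" .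
    qed
    also have "\<dots> = (\<Sum>X\<in>Pow ?E. (LINT x|?M. l ^ card X * (\<Prod>e\<in>?E. w X e (x (src H e), x (tgt H e)))))"
      by (intro Bochner_Integration.integral_sum integrable_mult_right integrable_decorated H w)
    also have "\<dots> = poly q l"
      by (simp add: q_def poly_sum poly_monom decorated_density_def mult.commute)
    finally show ?thesis .
  qed
  moreover have "coeff q 1 = (\<Sum>e\<in>?E. decorated_density H (u(e := v e)))"
  proof -
    have "coeff q 1 = (\<Sum>X\<in>Pow ?E. if card X = 1 then decorated_density H (w X) else 0)"
      by (auto simp: q_def coeff_sum intro!: sum.cong)
    also have "\<dots> = (\<Sum>X\<in>(\<lambda>e. {e}) ` ?E. if card X = 1 then decorated_density H (w X) else 0)"
      using fin by (intro sum.mono_neutral_right) (auto simp: card_1_singleton_iff image_iff)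
    also have "\<dots> = (\<Sum>e\<in>?E. decorated_density H (w {e}))"
      by (subst sum.reindex) auto
    also have "\<dots> = (\<Sum>e\<in>?E. decorated_density H (u(e := v e)))"
      by (intro sum.cong refl arg_cong[where f = "decorated_density H"]) (auto simp: w_def)
    finally show ?thesis .
  qed
  ultimately show thesis by (rule that)
qed

lemma bounded_kernels_zero: "(\<lambda>_. 0) \<in> bounded_kernels"
  by (auto simp: bounded_kernels_def)

lemma decorated_density_zero:
  assumes "is_multigraph H" "e \<in> edges H" "h e = (\<lambda>_. 0)"
  shows "decorated_density H h = 0"
proof -
  have "(\<Prod>e\<in>edges H. h e (x (src H e), x (tgt H e))) = 0" for x
    using assms by (intro prod_zero bexI[of _ e]) (auto simp: is_multigraph_def)
  then show ?thesis by (simp add: decorated_density_def)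
qed

text \<open>\<open>B\<close> is the set of edges that still carry the variable graphon. By the
  product rule a derivative in direction \<open>g\<close> is a sum of densities in which one edge of
  \<open>B\<close> carries \<open>g\<close> instead. So \<open>card B\<close> drops, and the fixed
  decoration \<open>h\<close> must be arbitrary in the induction.\<close>

lemma polynomial_functional_decorated:
  assumes H: "is_multigraph H" and B: "B \<subseteq> edges H" and h: "\<And>e. e \<in> edges H \<Longrightarrow> h e \<in> bounded_kernels"
  shows "polynomial_functional (Suc (card B)) (\<lambda>f. decorated_density H (\<lambda>e. if e \<in> B then f else h e))"
proof -
  have fin: "finite (edges H)" using H by (simp add: is_multigraph_def)
  show ?thesis using B h
  proof (induction "card B" arbitrary: B h)
    case 0
    then have "B = {}" using fin finite_subset by fastforce
    then show ?case by (auto intro!: exI[of _ "\<lambda>_. 0"])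
  next
    case (Suc n)
    have finB: "finite B" using Suc.prems fin finite_subset by blast
    show ?case unfolding polynomial_functional.simps(2)[of "card B"]
    proof
      fix g assume g: "g \<in> kernels"
      then have gb: "g \<in> bounded_kernels" using kernels_subset_bounded by blast
      define Q where "Q f = (\<Sum>e\<in>B. decorated_density H (\<lambda>e'. if e' \<in> B - {e} then f else (h(e := g)) e'))" for f
      have "polynomial_functional (card B) Q"
        unfolding Q_def
      proof (rule polynomial_functional_sum)
        fix e assume e: "e \<in> B"
        have "polynomial_functional (Suc (card (B - {e}))) (\<lambda>f. decorated_density H (\<lambda>e'. if e' \<in> B - {e} then f else (h(e := g)) e'))"
          using Suc.hyps(2) Suc.prems e finB gb by (intro Suc.hyps(1)) auto
        then show "polynomial_functional (card B) (\<lambda>f. decorated_density H (\<lambda>e'. if e' \<in> B - {e} then f else (h(e := g)) e'))"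
          using e finB Suc.hyps(2) by simp
      qed
      moreover have "((\<lambda>l. (decorated_density H (\<lambda>e. if e \<in> B then (\<lambda>p. f p + l * g p) else h e) -
          decorated_density H (\<lambda>e. if e \<in> B then f else h e)) / l) \<longlongrightarrow> Q f) (at 0 within steps f g)"
        if f: "f \<in> graphons" for f
      proof -
        define u where "u e = (if e \<in> B then f else h e)" for e
        \<comment> \<open>Edges outside \<open>B\<close> do not move. Their terms in the product
          rule contain the zero kernel and vanish.\<close>
        define v where "v e = (if e \<in> B then g else (\<lambda>_. 0))" for e
        have uv: "\<And>e. e \<in> edges H \<Longrightarrow> u e \<in> bounded_kernels" "\<And>e. e \<in> edges H \<Longrightarrow> v e \<in> bounded_kernels"
          using Suc.prems(2) graphons_bounded[OF f] gb bounded_kernels_zero by (auto simp: u_def v_def)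
        obtain q where "degree q \<le> card (edges H)"
          and q: "\<And>l. decorated_density H (\<lambda>e p. u e p + l * v e p) = poly q l"
          "coeff q 1 = (\<Sum>e\<in>edges H. decorated_density H (u(e := v e)))"
          by (rule decorated_density_line[OF H, of u v]) (use uv in blast)+
        have eq: "decorated_density H (\<lambda>e. if e \<in> B then (\<lambda>p. f p + l * g p) else h e) = poly q l" for l
          unfolding q(1)[symmetric] by (rule arg_cong[where f = "decorated_density H"]) (auto simp: u_def v_def)
        have "coeff q 1 = (\<Sum>e\<in>B. decorated_density H (u(e := v e)))"
          unfolding q(2) using fin Suc.prems(1)
          by (intro sum.mono_neutral_right) (auto intro!: decorated_density_zero[OF H] simp: v_def)
        also have "\<dots> = Q f"
          unfolding Q_def by (intro sum.cong refl arg_cong[where f = "decorated_density H"]) (auto simp: u_def v_def)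
        finally have Qf: "poly (pderiv q) 0 = Q f" by (simp add: poly_0_coeff_0 coeff_pderiv)
        have "DERIV (poly q) 0 :> Q f"
          using poly_DERIV[of q 0] Qf by simp
        then have "((\<lambda>l. (poly q l - poly q 0) / l) \<longlongrightarrow> Q f) (at 0)"
          by (simp add: DERIV_def)
        then have "((\<lambda>l. (poly q l - poly q 0) / l) \<longlongrightarrow> Q f) (at 0 within steps f g)"
          by (rule tendsto_within_subset) simp
        moreover have "decorated_density H (\<lambda>e. if e \<in> B then f else h e) = poly q 0"
          using eq[of 0] by (simp cong del: if_weak_cong)
        ultimately show ?thesis by (simp add: eq)
      qed
      ultimately show "\<exists>Q. polynomial_functional (card B) Q \<and> (\<forall>f\<in>graphons.
          ((\<lambda>l. (decorated_density H (\<lambda>e. if e \<in> B then (\<lambda>p. f p + l * g p) else h e) -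
          decorated_density H (\<lambda>e. if e \<in> B then f else h e)) / l) \<longlongrightarrow> Q f) (at 0 within steps f g))"
        by blast
    qed
  qed
qed

lemma hom_density_some_derivative_vanishes:
  assumes H: "is_multigraph H" and F: "\<And>f. f \<in> graphons \<Longrightarrow> F f = hom_density H f"
  shows "some_derivative_vanishes F"
proof -
  have 1: "polynomial_functional (Suc (card (edges H))) (\<lambda>f. decorated_density H (\<lambda>e. if e \<in> edges H then f else (\<lambda>_. 0)))"
    by (rule polynomial_functional_decorated[OF H]) (auto intro: bounded_kernels_zero)
  have 2: "decorated_density H (\<lambda>e. if e \<in> edges H then f else (\<lambda>_. 0)) = F f" if "f \<in> graphons" for f
    unfolding F[OF that] hom_density_def decorated_density_def by simp
  have pf: "polynomial_functional (Suc (card (edges H)) + 0) F"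
    using polynomial_functional_cong[OF 2 1] by simp
  show ?thesis
    unfolding some_derivative_vanishes_def
  proof (intro exI[of _ "Suc (card (edges H))"] conjI ballI allI impI)
    fix f g assume f: "f \<in> graphons" and adm: "\<forall>i\<in>{1..Suc (card (edges H))}. g i \<in> Adm f"
    have kern: "\<And>i. i \<in> {1..Suc (card (edges H))} \<Longrightarrow> g i \<in> kernels" using adm by (auto simp: Adm_def)
    obtain R where "\<forall>f\<in>graphons. R f = 0" "\<forall>f\<in>graphons. (\<forall>i\<in>{1..Suc (card (edges H))}. g i \<in> Adm f) \<longrightarrow>
        gateaux_exists F (Suc (card (edges H))) f g \<and> gateaux F (Suc (card (edges H))) f g = R f"
      using polynomial_functional_gateaux[OF pf, of g] kern unfolding polynomial_functional.simps(1) by blast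
    then show "gateaux_exists F (Suc (card (edges H))) f g" "gateaux F (Suc (card (edges H))) f g = 0"
      using f adm by (metis, metis)
  qed simp
qed

section \<open>The counting lemma for the cut norm\<close>

lemma set_integral_unit_square:
  assumes "h \<in> bounded_kernels" "S \<in> sets unit_interval" "T \<in> sets unit_interval"
  shows "(LINT p:S \<times> T|lebesgue. h p) = (LINT p|unit_square. h p * (indicator S (fst p) * indicator T (snd p)))"
proof -
  have "S \<subseteq> {0..1}" "T \<subseteq> {0..1}"
    using assms(2,3)[THEN sets.sets_into_space] by auto
  then have eq: "indicator (S \<times> T) p *\<^sub>R h p = indicator ({0..1} \<times> {0..1}) p *\<^sub>R (h p * (indicator S (fst p) * indicator T (snd p)))" for p
    by (cases p) (auto simp: indicator_def)
  have sq: "{0..1::real} \<times> {0..1::real} \<in> sets lebesgue"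
    by (rule sets_completionI_sets) (auto simp: closed_Times intro!: borel_closed)
  have "(LINT p:S \<times> T|lebesgue. h p) =
      (LINT p|lebesgue. indicator ({0..1} \<times> {0..1}) p *\<^sub>R (h p * (indicator S (fst p) * indicator T (snd p))))"
    unfolding set_lebesgue_integral_def using eq by (rule Bochner_Integration.integral_cong[OF refl])
  also have "\<dots> = (LINT p|unit_square. h p * (indicator S (fst p) * indicator T (snd p)))"
    by (rule integral_restrict_space[symmetric]) (use sq in simp)
  finally show ?thesis .
qed

lemma integrable_unit_square_mult:
  assumes h: "h \<in> bounded_kernels" and u: "u \<in> borel_measurable unit_interval" and v: "v \<in> borel_measurable unit_interval"
    and bu: "\<And>x. x \<in> {0..1} \<Longrightarrow> \<bar>u x\<bar> \<le> 1" and bv: "\<And>x. x \<in> {0..1} \<Longrightarrow> \<bar>v x\<bar> \<le> 1"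
  shows "(\<lambda>p. h p * (u (fst p) * v (snd p))) \<in> bounded_kernels"
    and "\<bar>LINT p|unit_square. h p * (u (fst p) * v (snd p))\<bar> \<le> L1_norm h"
proof -
  have le: "\<bar>h p * (u (fst p) * v (snd p))\<bar> \<le> \<bar>h p\<bar>" if "p \<in> {0..1} \<times> {0..1}" for p
  proof -
    have "\<bar>u (fst p) * v (snd p)\<bar> \<le> 1"
      using bu[of "fst p"] bv[of "snd p"] that by (auto simp: abs_mult intro: mult_le_one)
    then show ?thesis by (simp add: abs_mult mult_left_le)
  qed
  obtain B where "h \<in> borel_measurable unit_square" "\<And>p. p \<in> {0..1} \<times> {0..1} \<Longrightarrow> \<bar>h p\<bar> \<le> B"
    using h unfolding bounded_kernels_def by blast
  then show b: "(\<lambda>p. h p * (u (fst p) * v (snd p))) \<in> bounded_kernels"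
    unfolding bounded_kernels_def using measurable_unit_square_fst[OF u] measurable_unit_square_snd[OF v] le
    by (intro CollectI conjI exI[of _ B] ballI) (auto intro: order_trans[OF le])
  have "\<bar>LINT p|unit_square. h p * (u (fst p) * v (snd p))\<bar> \<le> (LINT p|unit_square. \<bar>h p * (u (fst p) * v (snd p))\<bar>)"
    by (rule integral_abs_bound)
  also have "\<dots> \<le> L1_norm h"
    unfolding L1_norm_def
    by (intro integral_mono integrable_abs bounded_kernels_integrable b h) (use le in auto)
  finally show "\<bar>LINT p|unit_square. h p * (u (fst p) * v (snd p))\<bar> \<le> L1_norm h" .
qed

text \<open>The cut norm is a supremum of reals, so a bound for the whole family has to come first.
  The \<open>L1_norm\<close> is one, since the weights are at most 1; both claims follow from
  it.\<close>

lemma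
  assumes h: "h \<in> bounded_kernels"
  shows cut_norm_le_L1: "cut_norm h \<le> L1_norm h"
    and cut_norm_upper: "S \<in> sets unit_interval \<Longrightarrow> T \<in> sets unit_interval \<Longrightarrow>
      \<bar>LINT p|unit_square. h p * (indicator S (fst p) * indicator T (snd p))\<bar> \<le> cut_norm h"
proof -
  let ?I = "\<lambda>(S, T). \<bar>LINT p:S \<times> T|lebesgue. h p\<bar>"
  have I: "?I (S, T) = \<bar>LINT p|unit_square. h p * (indicator S (fst p) * indicator T (snd p))\<bar>"
    if "S \<in> sets unit_interval" "T \<in> sets unit_interval" for S T
    using set_integral_unit_square[OF h that] by simp
  have le: "?I ST \<le> L1_norm h" if "ST \<in> sets unit_interval \<times> sets unit_interval" for ST
  proof -
    obtain S T where ST: "ST = (S, T)" "S \<in> sets unit_interval" "T \<in> sets unit_interval"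
      using \<open>ST \<in> _\<close> by blast
    show ?thesis
      unfolding ST(1) I[OF ST(2,3)] by (rule integrable_unit_square_mult(2)[OF h]) (use ST in \<open>auto simp: indicator_def\<close>)
  qed
  show "cut_norm h \<le> L1_norm h"
    unfolding cut_norm_def by (rule cSUP_least) (use le in auto)
  assume ST: "S \<in> sets unit_interval" "T \<in> sets unit_interval"
  have "?I (S, T) \<le> cut_norm h"
    unfolding cut_norm_def using ST le by (intro cSUP_upper) (auto intro!: bdd_aboveI2[where M = "L1_norm h"])
  then show "\<bar>LINT p|unit_square. h p * (indicator S (fst p) * indicator T (snd p))\<bar> \<le> cut_norm h"
    using I[OF ST] by simp
qed

lemma cut_norm_nonneg: "h \<in> bounded_kernels \<Longrightarrow> 0 \<le> cut_norm h"
  using cut_norm_upper[of h "{}" "{}"] by simp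

text \<open>\<open>K\<close> is the marginal obtained by integrating a Borel version of
  \<open>w\<close> over the second variable. One \<open>K\<close> serves all weights
  \<open>u\<close>, so the sign of \<open>K\<close> can later decide which weight is
  extremal.\<close>

lemma unit_square_conditional_expectation:
  assumes w: "w \<in> bounded_kernels"
  obtains K where "K \<in> borel_measurable unit_interval" "integrable unit_interval K"
    "\<And>u. u \<in> borel_measurable unit_interval \<Longrightarrow> (\<And>x. x \<in> {0..1} \<Longrightarrow> \<bar>u x\<bar> \<le> 1) \<Longrightarrow>
      (LINT p|unit_square. w p * u (fst p)) = (LINT x|unit_interval. K x * u x)"
proof -
  let ?P = "borel_unit \<Otimes>\<^sub>M borel_unit"
  obtain B where w_meas: "w \<in> borel_measurable unit_square" and B: "\<And>p. p \<in> {0..1} \<times> {0..1} \<Longrightarrow> \<bar>w p\<bar> \<le> B"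
    using w unfolding bounded_kernels_def by blast
  then obtain w' where w'[measurable]: "w' \<in> borel_measurable ?P" and ae: "AE p in ?P. w p = w' p"
    using completion_ex_borel_measurable_real[of w ?P] unfolding unit_square_eq_completion by blast
  have bw': "AE p in ?P. \<bar>w' p\<bar> \<le> B"
    using ae AE_space
  proof eventually_elim
    case (elim p)
    then show ?case using B[of p] by (auto simp: space_pair_measure)
  qed
  have int_w': "integrable ?P w'"
    by (rule unit_pair.integrable_const_bound[where B = B]) (use bw' in auto)
  define K where "K x = (LINT y|borel_unit. w' (x, y))" for x
  have K[measurable]: "K \<in> borel_measurable borel_unit"
    unfolding K_def by measurable
  have int_K: "integrable borel_unit K"
    using unit_pair.integrable_fst'[OF int_w'] by (simp add: K_def[abs_def])
  show thesis
  proof (rule that)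
    show "K \<in> borel_measurable unit_interval"
      unfolding unit_interval_eq_completion by (rule measurable_completion[OF K])
    show "integrable unit_interval K"
      unfolding unit_interval_eq_completion using int_K by (simp add: integrable_completion)
    fix u :: "real \<Rightarrow> real" assume u: "u \<in> borel_measurable unit_interval" and bu: "\<And>x. x \<in> {0..1} \<Longrightarrow> \<bar>u x\<bar> \<le> 1"
    obtain u' where u'[measurable]: "u' \<in> borel_measurable borel_unit" and aeu: "AE x in borel_unit. u x = u' x"
      using completion_ex_borel_measurable_real[of u borel_unit] u unfolding unit_interval_eq_completion by blast
    have aeu2: "AE p in ?P. u (fst p) = u' (fst p)" by (rule AE_unit_pair_fst[OF aeu])
    have bu': "AE p in ?P. \<bar>u' (fst p)\<bar> \<le> 1"
      using aeu2 AE_space by eventually_elim (use bu in \<open>force simp: space_pair_measure\<close>)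
    have int: "integrable ?P (\<lambda>p. w' p * u' (fst p))"
    proof (rule unit_pair.integrable_const_bound[where B = B])
      show "AE p in ?P. norm (w' p * u' (fst p)) \<le> B"
        using bw' bu'
      proof eventually_elim
        case (elim p)
        then have "\<bar>w' p\<bar> * \<bar>u' (fst p)\<bar> \<le> B * 1" by (intro mult_mono) auto
        then show ?case by (simp add: abs_mult)
      qed
    qed measurable
    have "(LINT p|unit_square. w p * u (fst p)) = (LINT p|unit_square. w' p * u' (fst p))"
    proof (rule integral_cong_AE)
      show "(\<lambda>p. w p * u (fst p)) \<in> borel_measurable unit_square"
        using w_meas measurable_unit_square_fst[OF u] by simp
      show "(\<lambda>p. w' p * u' (fst p)) \<in> borel_measurable unit_square"
        unfolding unit_square_eq_completion by (rule measurable_completion) measurable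
      show "AE p in unit_square. w p * u (fst p) = w' p * u' (fst p)"
        unfolding unit_square_eq_completion
        by (rule AE_completion) (use ae aeu2 in \<open>eventually_elim; simp\<close>)
    qed
    also have "\<dots> = (LINT p|?P. w' p * u' (fst p))"
      unfolding unit_square_eq_completion by (rule integral_completion) measurable
    also have "\<dots> = (LINT x|borel_unit. (LINT y|borel_unit. w' (x, y) * u' x))"
      using unit_pair.integral_fst'[OF int] by simp
    also have "\<dots> = (LINT x|borel_unit. K x * u' x)"
      by (simp add: K_def)
    also have "\<dots> = (LINT x|unit_interval. K x * u' x)"
      unfolding unit_interval_eq_completion by (rule integral_completion[symmetric]) measurable
    also have "\<dots> = (LINT x|unit_interval. K x * u x)"
    proof (rule integral_cong_AE)
      show "(\<lambda>x. K x * u' x) \<in> borel_measurable unit_interval"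
        unfolding unit_interval_eq_completion by (rule measurable_completion) measurable
      show "(\<lambda>x. K x * u x) \<in> borel_measurable unit_interval"
        using u measurable_completion[OF K] unfolding unit_interval_eq_completion by simp
      show "AE x in unit_interval. K x * u' x = K x * u x"
        unfolding unit_interval_eq_completion
        by (rule AE_completion) (use aeu in \<open>eventually_elim; simp\<close>)
    qed
    finally show "(LINT p|unit_square. w p * u (fst p)) = (LINT x|unit_interval. K x * u x)" .
  qed
qed

text \<open>A linear functional of a weight with values between 0 and 1 is extremal at an indicator function.\<close>

lemma weight_to_indicator_fst:
  assumes w: "w \<in> bounded_kernels" and u: "u \<in> borel_measurable unit_interval"
    and bu: "\<And>x. x \<in> {0..1} \<Longrightarrow> 0 \<le> u x \<and> u x \<le> 1"
  obtains S where "S \<in> sets unit_interval"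
    "\<bar>LINT p|unit_square. w p * u (fst p)\<bar> \<le> \<bar>LINT p|unit_square. w p * indicator S (fst p)\<bar>"
proof -
  obtain K where K: "K \<in> borel_measurable unit_interval" "integrable unit_interval K"
    "\<And>u. u \<in> borel_measurable unit_interval \<Longrightarrow> (\<And>x. x \<in> {0..1} \<Longrightarrow> \<bar>u x\<bar> \<le> 1) \<Longrightarrow>
      (LINT p|unit_square. w p * u (fst p)) = (LINT x|unit_interval. K x * u x)"
    by (rule unit_square_conditional_expectation[OF w]) blast
  \<comment> \<open>The maximum over all weights is attained at the indicator of \<open>S\<close>,
    the minimum at that of the complement \<open>T\<close>. The sign of the given integral decides
    which of them bounds its absolute value.\<close>
  define S where "S = {x \<in> space unit_interval. 0 \<le> K x}"
  define T where "T = space unit_interval - S"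
  have S: "S \<in> sets unit_interval" unfolding S_def using K(1) by measurable
  then have T: "T \<in> sets unit_interval" unfolding T_def by auto
  have bu': "\<bar>u x\<bar> \<le> 1" if "x \<in> {0..1}" for x using bu[OF that] by simp
  have int: "integrable unit_interval (\<lambda>x. K x * v x)"
    if "v \<in> borel_measurable unit_interval" "\<And>x. x \<in> {0..1} \<Longrightarrow> \<bar>v x\<bar> \<le> 1" for v
  proof (rule Bochner_Integration.integrable_bound[OF K(2)])
    show "AE x in unit_interval. norm (K x * v x) \<le> norm (K x)"
      by (rule AE_I2) (use that in \<open>auto simp: abs_mult mult_left_le\<close>)
  qed (use K(1) that in simp)
  have ind: "(indicator A :: real \<Rightarrow> real) \<in> borel_measurable unit_interval" "\<bar>indicator A x :: real\<bar> \<le> 1"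
    if "A \<in> sets unit_interval" for A x using that by (auto simp: indicator_def)
  have intu: "integrable unit_interval (\<lambda>x. K x * u x)" by (rule int[OF u]) (rule bu')
  have intS: "integrable unit_interval (\<lambda>x. K x * indicator S x)"
    by (rule int[OF ind(1)[OF S]]) (rule ind(2)[OF S])
  have intT: "integrable unit_interval (\<lambda>x. K x * indicator T x)"
    by (rule int[OF ind(1)[OF T]]) (rule ind(2)[OF T])
  have up: "(LINT x|unit_interval. K x * u x) \<le> (LINT x|unit_interval. K x * indicator S x)"
  proof (rule integral_mono[OF intu intS])
    fix x assume x: "x \<in> space unit_interval"
    show "K x * u x \<le> K x * indicator S x"
    proof (cases "0 \<le> K x")
      case True
      then have "K x * u x \<le> K x * 1" using x bu[of x] by (intro mult_left_mono) auto
      then show ?thesis using x True by (simp add: S_def)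
    next
      case False
      then have "K x * u x \<le> 0" using x bu[of x] by (intro mult_nonpos_nonneg) auto
      then show ?thesis using False by (simp add: S_def)
    qed
  qed
  have lo: "(LINT x|unit_interval. K x * indicator T x) \<le> (LINT x|unit_interval. K x * u x)"
  proof (rule integral_mono[OF intT intu])
    fix x assume x: "x \<in> space unit_interval"
    show "K x * indicator T x \<le> K x * u x"
    proof (cases "0 \<le> K x")
      case True
      then have "0 \<le> K x * u x" using x bu[of x] by (intro mult_nonneg_nonneg) auto
      then show ?thesis using True by (simp add: T_def S_def)
    next
      case False
      then have "K x * 1 \<le> K x * u x" using x bu[of x] by (intro mult_left_mono_neg) auto
      then show ?thesis using x False by (simp add: T_def S_def)
    qed
  qed
  have eq: "(LINT p|unit_square. w p * u (fst p)) = (LINT x|unit_interval. K x * u x)"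
    by (rule K(3)[OF u]) (rule bu')
  have eqS: "(LINT p|unit_square. w p * indicator S (fst p)) = (LINT x|unit_interval. K x * indicator S x)"
    by (rule K(3)[OF ind(1)[OF S]]) (rule ind(2)[OF S])
  have eqT: "(LINT p|unit_square. w p * indicator T (fst p)) = (LINT x|unit_interval. K x * indicator T x)"
    by (rule K(3)[OF ind(1)[OF T]]) (rule ind(2)[OF T])
  show thesis
  proof (cases "0 \<le> (LINT x|unit_interval. K x * u x)")
    case True
    then show ?thesis using up by (intro that[OF S]) (simp add: eq eqS)
  next
    case False
    then show ?thesis using lo by (intro that[OF T]) (simp add: eq eqT)
  qed
qed

text \<open>The integral is linear in each weight separately, so one weight at a time is replaced by
  an indicator. The second replacement is the first one after exchanging the coordinates.\<close>

lemma cut_norm_weights: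
  assumes h: "h \<in> bounded_kernels" and u: "u \<in> borel_measurable unit_interval" and v: "v \<in> borel_measurable unit_interval"
    and bu: "\<And>x. x \<in> {0..1} \<Longrightarrow> 0 \<le> u x \<and> u x \<le> 1" and bv: "\<And>x. x \<in> {0..1} \<Longrightarrow> 0 \<le> v x \<and> v x \<le> 1"
  shows "\<bar>LINT p|unit_square. h p * (u (fst p) * v (snd p))\<bar> \<le> cut_norm h"
proof -
  have bv': "\<bar>v x\<bar> \<le> 1" if "x \<in> {0..1}" for x using bv[OF that] by simp
  have one: "(\<lambda>_. 1) \<in> borel_measurable unit_interval" by simp
  have hv: "(\<lambda>p. h p * (1 * v (snd p))) \<in> bounded_kernels"
    by (rule integrable_unit_square_mult(1)[OF h one v]) (use bv' in auto)
  obtain S where S: "S \<in> sets unit_interval"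
    "\<bar>LINT p|unit_square. h p * (1 * v (snd p)) * u (fst p)\<bar> \<le> \<bar>LINT p|unit_square. h p * (1 * v (snd p)) * indicator S (fst p)\<bar>"
    by (rule weight_to_indicator_fst[OF hv u]) (use bu in blast)+
  have iS: "(indicator S :: real \<Rightarrow> real) \<in> borel_measurable unit_interval" using S by simp
  define w where "w = (\<lambda>p. h p * (indicator S (fst p) * 1))"
  have w: "w \<in> bounded_kernels" unfolding w_def
    by (rule integrable_unit_square_mult(1)[OF h iS one]) (auto simp: indicator_def)
  have swap_m: "prod.swap \<in> unit_square \<rightarrow>\<^sub>M unit_square" using measure_preserving_swap by (simp add: measure_preserving_def)
  have ws: "(\<lambda>p. w (prod.swap p)) \<in> bounded_kernels"
  proof -
    obtain B where "w \<in> borel_measurable unit_square" "\<And>p. p \<in> {0..1} \<times> {0..1} \<Longrightarrow> \<bar>w p\<bar> \<le> B"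
      using w unfolding bounded_kernels_def by blast
    then show ?thesis
      unfolding bounded_kernels_def
      by (intro CollectI conjI exI[of _ B] ballI measurable_compose[OF swap_m]) auto
  qed
  obtain T where T: "T \<in> sets unit_interval"
    "\<bar>LINT p|unit_square. w (prod.swap p) * v (fst p)\<bar> \<le> \<bar>LINT p|unit_square. w (prod.swap p) * indicator T (fst p)\<bar>"
    by (rule weight_to_indicator_fst[OF ws v]) (use bv in blast)+
  have sw: "(LINT p|unit_square. w (prod.swap p) * z (fst p)) = (LINT p|unit_square. w p * z (snd p))"
    if "z \<in> borel_measurable unit_interval" for z :: "real \<Rightarrow> real"
  proof -
    have "(\<lambda>p. w p * z (snd p)) \<in> borel_measurable unit_square"
      using w measurable_unit_square_snd[OF that] by (intro borel_measurable_times) (simp_all add: bounded_kernels_def)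
    from measure_preserving_integral[OF measure_preserving_swap this] show ?thesis by simp
  qed
  have "\<bar>LINT p|unit_square. h p * (u (fst p) * v (snd p))\<bar> \<le> \<bar>LINT p|unit_square. w p * v (snd p)\<bar>"
    using S(2) by (simp add: w_def mult_ac)
  also have "\<dots> \<le> \<bar>LINT p|unit_square. w p * indicator T (snd p)\<bar>"
    using T sw[OF v] sw[of "indicator T"] by simp
  also have "\<dots> \<le> cut_norm h"
    using cut_norm_upper[OF h S(1) T(1)] by (simp add: w_def mult_ac)
  finally show ?thesis .
qed

lemma borel_version:
  assumes h: "h \<in> bounded_kernels"
  obtains h' where "h' \<in> borel_measurable (borel_unit \<Otimes>\<^sub>M borel_unit)" "AE p in borel_unit \<Otimes>\<^sub>M borel_unit. h p = h' p"
  using h completion_ex_borel_measurable_real[of h "borel_unit \<Otimes>\<^sub>M borel_unit"]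
  unfolding bounded_kernels_def unit_square_eq_completion by blast

lemma AE_unit_cube_edge:
  assumes "is_multigraph H" "e \<in> edges H" "AE p in borel_unit \<Otimes>\<^sub>M borel_unit. P p"
  shows "AE x in unit_cube (verts H). P (x (src H e), x (tgt H e))"
proof -
  have "measure_preserving (unit_cube (verts H)) (borel_unit \<Otimes>\<^sub>M borel_unit) (\<lambda>x. (x (src H e), x (tgt H e)))"
    using assms by (intro measure_preserving_unit_cube_pair) (auto simp: is_multigraph_def)
  then have m: "(\<lambda>x. (x (src H e), x (tgt H e))) \<in> unit_cube (verts H) \<rightarrow>\<^sub>M borel_unit \<Otimes>\<^sub>M borel_unit"
    and d: "distr (unit_cube (verts H)) (borel_unit \<Otimes>\<^sub>M borel_unit) (\<lambda>x. (x (src H e), x (tgt H e))) = borel_unit \<Otimes>\<^sub>M borel_unit"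
    by (simp_all add: measure_preserving_def)
  show ?thesis
    by (rule AE_distrD[OF m]) (subst d, rule assms(3))
qed

text \<open>After fixing all other variables, the remaining factors of the integrand depend on at most one of the two
  endpoints of \<open>e\<close>, because no other edge joins them.\<close>

lemma decorated_density_cut_norm:
  assumes H: "is_multigraph H" and e: "e \<in> edges H"
    and simple: "\<And>e'. e' \<in> edges H \<Longrightarrow> e' \<noteq> e \<Longrightarrow> {src H e', tgt H e'} \<noteq> {src H e, tgt H e}"
    and D: "h e \<in> bounded_kernels"
    and h: "\<And>e'. e' \<in> edges H \<Longrightarrow> e' \<noteq> e \<Longrightarrow> h e' \<in> graphons"
  shows "\<bar>decorated_density H h\<bar> \<le> cut_norm (h e)"
proof -
  let ?P = "borel_unit \<Otimes>\<^sub>M borel_unit"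
  define s t V W E where "s = src H e" and "t = tgt H e" and "V = verts H" and "W = V - {s, t}" and "E = edges H"
  have st: "s \<in> V" "t \<in> V" "s \<noteq> t" and fin: "finite V" "finite E" and eE: "e \<in> E"
    using H e by (auto simp: is_multigraph_def s_def t_def V_def E_def)
  have ends: "src H e' \<in> V" "tgt H e' \<in> V" "src H e' \<noteq> tgt H e'" if "e' \<in> E" for e'
    using H that by (auto simp: is_multigraph_def V_def E_def)
  have hb: "h e' \<in> bounded_kernels" if "e' \<in> E" for e'
    using that D h graphons_bounded unfolding E_def by metis
  \<comment> \<open>Fubini needs Borel versions. On the edges other than \<open>e\<close> they are
    clipped so that their bounds hold at every point: all but two coordinates will be frozen at
    arbitrary values, where almost-everywhere bounds say nothing.\<close>
  have "\<exists>k. k \<in> borel_measurable ?P \<and> (AE p in ?P. h e' p = k p) \<and> (e' \<noteq> e \<longrightarrow> (\<forall>p. 0 \<le> k p \<and> k p \<le> 1))" if e': "e' \<in> E" for e'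
  proof -
    obtain k where k: "k \<in> borel_measurable ?P" "AE p in ?P. h e' p = k p"
      by (rule borel_version[OF hb[OF e']])
    show ?thesis
    proof (cases "e' = e")
      case False
      have "AE p in ?P. h e' p = max 0 (min 1 (k p))"
        using k(2) AE_space
      proof eventually_elim
        case (elim p)
        then have "0 \<le> h e' p \<and> h e' p \<le> 1"
          using graphons_range[OF h, of e' p] False \<open>e' \<in> E\<close> by (auto simp: E_def space_pair_measure)
        then show ?case using elim by simp
      qed
      moreover have "(\<lambda>p. max 0 (min 1 (k p))) \<in> borel_measurable ?P" using k(1) by measurable
      ultimately show ?thesis by (intro exI[of _ "\<lambda>p. max 0 (min 1 (k p))"]) auto
    qed (use k in blast)
  qed
  then have "\<forall>e'\<in>E. \<exists>k. k \<in> borel_measurable ?P \<and> (AE p in ?P. h e' p = k p) \<and> (e' \<noteq> e \<longrightarrow> (\<forall>p. 0 \<le> k p \<and> k p \<le> 1))"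
    by blast
  from bchoice[OF this] obtain k where k: "\<And>e'. e' \<in> E \<Longrightarrow> k e' \<in> borel_measurable ?P"
    "\<And>e'. e' \<in> E \<Longrightarrow> AE p in ?P. h e' p = k e' p"
    "\<And>e' p. e' \<in> E \<Longrightarrow> e' \<noteq> e \<Longrightarrow> 0 \<le> k e' p \<and> k e' p \<le> 1"
    by blast
  let ?f = "\<lambda>x. \<Prod>e'\<in>E. k e' (x (src H e'), x (tgt H e'))"
  have pm: "(\<lambda>x. (x (src H e'), x (tgt H e'))) \<in> unit_cube V \<rightarrow>\<^sub>M ?P" if "e' \<in> E" for e'
    using ends[OF that] by (intro measurable_Pair measurable_component_singleton)
  have f[measurable]: "?f \<in> borel_measurable (unit_cube V)"
    by (rule borel_measurable_prod, rule measurable_compose[OF pm k(1)])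
  have dm: "(\<lambda>x. \<Prod>e'\<in>E. h e' (x (src H e'), x (tgt H e'))) \<in> borel_measurable (completion (unit_cube V))"
    unfolding V_def E_def by (rule measurable_decorated[OF H]) (use hb in \<open>auto simp: bounded_kernels_def E_def\<close>)
  have ae: "AE x in unit_cube V. (\<Prod>e'\<in>E. h e' (x (src H e'), x (tgt H e'))) = ?f x"
  proof -
    have "AE x in unit_cube V. \<forall>e'\<in>E. h e' (x (src H e'), x (tgt H e')) = k e' (x (src H e'), x (tgt H e'))"
      using fin k(2) unfolding V_def E_def by (intro AE_finite_allI AE_unit_cube_edge[OF H]) auto
    then show ?thesis by eventually_elim (auto intro: prod.cong)
  qed
  have int_f: "integrable (unit_cube V) ?f"
  proof -
    have "integrable (completion (unit_cube V)) (\<lambda>x. \<Prod>e'\<in>E. h e' (x (src H e'), x (tgt H e')))"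
      unfolding V_def E_def by (rule integrable_decorated[OF H]) (use hb in \<open>simp add: E_def\<close>)
    then have "integrable (completion (unit_cube V)) ?f"
      using integrable_cong_AE_imp[OF _ measurable_completion[OF f]] AE_completion[OF ae] by (auto simp: eq_commute)
    then show ?thesis by (simp add: integrable_completion[OF f])
  qed
  have "decorated_density H h = (LINT x|completion (unit_cube V). (\<Prod>e'\<in>E. h e' (x (src H e'), x (tgt H e'))))"
    by (simp add: decorated_density_def V_def E_def)
  also have "\<dots> = (LINT x|completion (unit_cube V). ?f x)"
    by (rule integral_cong_AE[OF dm measurable_completion[OF f] AE_completion[OF ae]])
  also have "\<dots> = (LINT x|unit_cube V. ?f x)" by (rule integral_completion[OF f])
  also have "\<dots> = (LINT x|unit_cube W. (LINT y|unit_cube {s, t}. ?f (merge W {s, t} (x, y))))"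
  proof -
    have V: "V = W \<union> {s, t}" using st by (auto simp: W_def)
    have "integrable (unit_cube (W \<union> {s, t})) ?f" using int_f V by simp
    then show ?thesis
      by (subst V, intro unit_product.product_integral_fold) (auto simp: W_def fin)
  qed
  finally have eq: "decorated_density H h = (LINT x|unit_cube W. (LINT y|unit_cube {s, t}. ?f (merge W {s, t} (x, y))))" .
  have inner: "\<bar>LINT y|unit_cube {s, t}. ?f (merge W {s, t} (x, y))\<bar> \<le> cut_norm (h e)" if x: "x \<in> space (unit_cube W)" for x
  proof -
    \<comment> \<open>The other edges are sorted by whether they meet \<open>s\<close>,
      \<open>t\<close> or neither. \<open>Es\<close> and \<open>Et\<close> are disjoint exactly
      because no other edge joins \<open>s\<close> and \<open>t\<close>; the products over them are
      the weights \<open>u\<close> and \<open>v\<close>.\<close>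
    define Es Et Eo where "Es = {e' \<in> E - {e}. s \<in> {src H e', tgt H e'}}"
      and "Et = {e' \<in> E - {e}. t \<in> {src H e', tgt H e'}}"
      and "Eo = {e' \<in> E - {e}. s \<notin> {src H e', tgt H e'} \<and> t \<notin> {src H e', tgt H e'}}"
    have disj: "Es \<inter> Et = {}"
    proof -
      have "{src H e', tgt H e'} = {s, t}" if "e' \<in> Es \<inter> Et" for e'
        using that st by (auto simp: Es_def Et_def)
      then show ?thesis using simple by (fastforce simp: Es_def Et_def E_def s_def t_def)
    qed
    have E_split: "E = insert e (Es \<union> Et \<union> Eo)" using eE by (auto simp: Es_def Et_def Eo_def)
    have fins: "finite Es" "finite Et" "finite Eo" using fin by (auto simp: Es_def Et_def Eo_def)
    define u where "u a = (\<Prod>e'\<in>Es. k e' ((x(s := a)) (src H e'), (x(s := a)) (tgt H e')))" for a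
    define v where "v a = (\<Prod>e'\<in>Et. k e' ((x(t := a)) (src H e'), (x(t := a)) (tgt H e')))" for a
    define c where "c = (\<Prod>e'\<in>Eo. k e' (x (src H e'), x (tgt H e')))"
    have xW: "x w \<in> {0..1}" if "w \<in> W" for w using x that by (auto simp: space_PiM PiE_iff)
    have kr: "0 \<le> k e' p \<and> k e' p \<le> 1" if "e' \<in> Es \<union> Et \<union> Eo" for e' p
      using that by (intro k(3)) (auto simp: Es_def Et_def Eo_def)
    have ru: "0 \<le> u a \<and> u a \<le> 1" and rv: "0 \<le> v a \<and> v a \<le> 1" for a
      unfolding u_def v_def using kr by (auto intro!: prod_nonneg prod_le_1)
    have rc: "0 \<le> c \<and> c \<le> 1"
      unfolding c_def using kr by (auto intro!: prod_nonneg prod_le_1)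
    have meas: "(\<lambda>a. k e' ((x(r := a)) (src H e'), (x(r := a)) (tgt H e'))) \<in> borel_measurable borel_unit"
      if e': "e' \<in> E" and r: "r \<in> {src H e', tgt H e'}" and o: "\<And>w. w \<in> {src H e', tgt H e'} \<Longrightarrow> w \<noteq> r \<Longrightarrow> w \<in> W" for e' r
    proof (cases "src H e' = r")
      case True
      then have "x (tgt H e') \<in> {0..1}" using ends(3)[OF e'] by (intro xW o) auto
      then have "(\<lambda>a. (a, x (tgt H e'))) \<in> borel_unit \<rightarrow>\<^sub>M ?P" by simp
      from measurable_compose[OF this k(1)[OF e']] show ?thesis
        using True ends(3)[OF e'] by simp
    next
      case False
      then have rt: "r = tgt H e'" using r by simp
      then have "x (src H e') \<in> {0..1}" using ends(3)[OF e'] by (intro xW o) auto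
      then have "(\<lambda>a. (x (src H e'), a)) \<in> borel_unit \<rightarrow>\<^sub>M ?P" by simp
      from measurable_compose[OF this k(1)[OF e']] show ?thesis
        using rt ends(3)[OF e'] by simp
    qed
    have inW: "w \<in> W" if "w \<in> V" "w \<noteq> s" "w \<noteq> t" for w using that by (simp add: W_def)
    have u: "u \<in> borel_measurable borel_unit"
      unfolding u_def[abs_def]
    proof (intro borel_measurable_prod meas)
      fix e' w assume "e' \<in> Es" "w \<in> {src H e', tgt H e'}" "w \<noteq> s"
      then show "w \<in> W" using disj ends by (intro inW) (auto simp: Es_def Et_def)
    qed (auto simp: Es_def)
    have v: "v \<in> borel_measurable borel_unit"
      unfolding v_def[abs_def]
    proof (intro borel_measurable_prod meas)
      fix e' w assume "e' \<in> Et" "w \<in> {src H e', tgt H e'}" "w \<noteq> t"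
      then show "w \<in> W" using disj ends by (intro inW) (auto simp: Es_def Et_def)
    qed (auto simp: Et_def)
    have fac: "?f (merge W {s, t} (x, y)) = c * (k e (y s, y t) * (u (y s) * v (y t)))" if "y \<in> space (unit_cube {s, t})" for y
    proof -
      let ?m = "merge W {s, t} (x, y)"
      have m: "?m s = y s" "?m t = y t" "\<And>w. w \<in> W \<Longrightarrow> ?m w = x w" by (auto simp: merge_def W_def)
      have Es: "k e' (?m (src H e'), ?m (tgt H e')) = k e' ((x(s := y s)) (src H e'), (x(s := y s)) (tgt H e'))" if "e' \<in> Es" for e'
      proof -
        have "?m w = (x(s := y s)) w" if "w \<in> {src H e', tgt H e'}" for w
        proof (cases "w = s")
          case False
          then have "w \<in> W" using \<open>e' \<in> Es\<close> that disj ends[of e'] by (intro inW) (auto simp: Es_def Et_def)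
          with False show ?thesis using m by simp
        qed (use m in simp)
        then show ?thesis by simp
      qed
      have Et: "k e' (?m (src H e'), ?m (tgt H e')) = k e' ((x(t := y t)) (src H e'), (x(t := y t)) (tgt H e'))" if "e' \<in> Et" for e'
      proof -
        have "?m w = (x(t := y t)) w" if "w \<in> {src H e', tgt H e'}" for w
        proof (cases "w = t")
          case False
          then have "w \<in> W" using \<open>e' \<in> Et\<close> that disj ends[of e'] by (intro inW) (auto simp: Es_def Et_def)
          with False show ?thesis using m by simp
        qed (use m in simp)
        then show ?thesis by simp
      qed
      have Eo: "k e' (?m (src H e'), ?m (tgt H e')) = k e' (x (src H e'), x (tgt H e'))" if "e' \<in> Eo" for e'
        using that ends[of e'] m by (auto simp: Eo_def inW)
      have "?f ?m = k e (?m s, ?m t) * (\<Prod>e'\<in>Es \<union> Et \<union> Eo. k e' (?m (src H e'), ?m (tgt H e')))"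
        unfolding E_split using fins by (subst prod.insert) (auto simp: Es_def Et_def Eo_def s_def t_def)
      also have "(\<Prod>e'\<in>Es \<union> Et \<union> Eo. k e' (?m (src H e'), ?m (tgt H e'))) =
          (\<Prod>e'\<in>Es. k e' (?m (src H e'), ?m (tgt H e'))) * (\<Prod>e'\<in>Et. k e' (?m (src H e'), ?m (tgt H e'))) *
          (\<Prod>e'\<in>Eo. k e' (?m (src H e'), ?m (tgt H e')))"
      proof -
        have "(Es \<union> Et) \<inter> Eo = {}" by (auto simp: Es_def Et_def Eo_def)
        then show ?thesis using fins disj by (simp add: prod.union_disjoint)
      qed
      also have "\<dots> = u (y s) * v (y t) * c"
        unfolding u_def v_def c_def using Es Et Eo by simp
      finally show ?thesis using m by (simp add: mult_ac)
    qed
    let ?g = "\<lambda>p. k e p * (u (fst p) * v (snd p))"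
    have g[measurable]: "?g \<in> borel_measurable ?P" using k(1)[OF eE] u v by measurable
    have u': "u \<in> borel_measurable unit_interval" and v': "v \<in> borel_measurable unit_interval"
      using u v unfolding unit_interval_eq_completion by (auto intro: measurable_completion)
    have mp: "measure_preserving (unit_cube {s, t}) ?P (\<lambda>y. (y s, y t))"
      using st by (intro measure_preserving_unit_cube_pair) auto
    have "(LINT y|unit_cube {s, t}. ?f (merge W {s, t} (x, y))) = (LINT y|unit_cube {s, t}. c * ?g (y s, y t))"
      by (rule Bochner_Integration.integral_cong) (use fac in auto)
    also have "\<dots> = c * (LINT p|?P. ?g p)"
      using measure_preserving_integral[OF mp g] by simp
    also have "(LINT p|?P. ?g p) = (LINT p|unit_square. ?g p)"
      unfolding unit_square_eq_completion by (rule integral_completion[OF g, symmetric])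
    also have "\<dots> = (LINT p|unit_square. h e p * (u (fst p) * v (snd p)))"
    proof (rule integral_cong_AE)
      show "?g \<in> borel_measurable unit_square"
        unfolding unit_square_eq_completion by (rule measurable_completion[OF g])
      show "(\<lambda>p. h e p * (u (fst p) * v (snd p))) \<in> borel_measurable unit_square"
        using D measurable_unit_square_fst[OF u'] measurable_unit_square_snd[OF v']
        by (intro borel_measurable_times) (simp_all add: bounded_kernels_def)
      show "AE p in unit_square. ?g p = h e p * (u (fst p) * v (snd p))"
        unfolding unit_square_eq_completion by (rule AE_completion) (use k(2)[OF eE] in \<open>eventually_elim; simp\<close>)
    qed
    finally have "\<bar>LINT y|unit_cube {s, t}. ?f (merge W {s, t} (x, y))\<bar> = c * \<bar>LINT p|unit_square. h e p * (u (fst p) * v (snd p))\<bar>"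
      using rc by (simp add: abs_mult)
    also have "\<dots> \<le> 1 * cut_norm (h e)"
      using rc cut_norm_weights[OF D u' v'] ru rv by (intro mult_mono) auto
    finally show ?thesis by simp
  qed
  interpret W: prob_space "unit_cube W" by (rule prob_space_unit_cube)
  have "\<bar>decorated_density H h\<bar> \<le> (LINT x|unit_cube W. \<bar>LINT y|unit_cube {s, t}. ?f (merge W {s, t} (x, y))\<bar>)"
    unfolding eq by (rule integral_abs_bound)
  also have "\<dots> \<le> cut_norm (h e)"
  \<comment> \<open>Without integrability the integral is 0 by convention, and the cut norm is
    nonnegative.\<close>
  proof (cases "integrable (unit_cube W) (\<lambda>x. \<bar>LINT y|unit_cube {s, t}. ?f (merge W {s, t} (x, y))\<bar>)")
    case True
    then have "(LINT x|unit_cube W. \<bar>LINT y|unit_cube {s, t}. ?f (merge W {s, t} (x, y))\<bar>) \<le> (LINT x|unit_cube W. cut_norm (h e))"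
      by (rule integral_mono) (use inner in auto)
    then show ?thesis using W.prob_space by simp
  qed (simp add: not_integrable_integral_eq cut_norm_nonneg D)
  finally show ?thesis .
qed

text \<open>\<open>g\<close> is exchanged for \<open>f\<close> one edge at a time. By multilinearity
  each exchange changes the density by a decorated density with \<open>f - g\<close> on that edge
  and graphons on the others.\<close>

lemma hom_density_cut_norm:
  assumes H: "H \<in> simple_graphs" and f: "f \<in> graphons" and g: "g \<in> graphons"
  shows "\<bar>hom_density H f - hom_density H g\<bar> \<le> card (edges H) * cut_norm (\<lambda>p. f p - g p)"
proof -
  have mg: "is_multigraph H" and inj: "inj_on (\<lambda>e. {src H e, tgt H e}) (edges H)"
    using H by (auto simp: simple_graphs_def multigraphs_def no_multiple_edges_def)
  then have fin: "finite (edges H)" by (simp add: is_multigraph_def)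
  define T where "T X = decorated_density H (\<lambda>e. if e \<in> X then f else g)" for X
  have bd: "(\<lambda>p. f p - g p) \<in> bounded_kernels" by (intro bounded_kernels_diff graphons_bounded f g)
  have "\<bar>T X - T {}\<bar> \<le> card X * cut_norm (\<lambda>p. f p - g p)" if "X \<subseteq> edges H" for X
    using finite_subset[OF that fin] that
  proof (induction X rule: finite_induct)
    case (insert e X)
    let ?h = "(\<lambda>e'. if e' \<in> X then f else g)(e := \<lambda>p. f p - g p)"
    have e: "e \<in> edges H" using insert by simp
    have "T (insert e X) - T X = decorated_density H ?h"
    proof -
      have b: "(if P then f else g) \<in> bounded_kernels" for P using f g graphons_bounded by simp
      have "T (insert e X) - T X = (LINT x|completion (unit_cube (verts H)).
          (\<Prod>e'\<in>edges H. (if e' \<in> insert e X then f else g) (x (src H e'), x (tgt H e'))) -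
          (\<Prod>e'\<in>edges H. (if e' \<in> X then f else g) (x (src H e'), x (tgt H e'))))"
        unfolding T_def decorated_density_def
        by (rule Bochner_Integration.integral_diff[symmetric]; rule integrable_decorated[OF mg b])
      also have "\<dots> = decorated_density H ?h"
        unfolding decorated_density_def
      proof (rule Bochner_Integration.integral_cong[OF refl])
        fix x
        have "(\<Prod>e'\<in>edges H. k e' (x (src H e'), x (tgt H e'))) =
            k e (x (src H e), x (tgt H e)) * (\<Prod>e'\<in>edges H - {e}. k e' (x (src H e'), x (tgt H e')))" for k :: "nat \<Rightarrow> kernel"
          by (rule prod.remove[OF fin e])
        note * = this[of "\<lambda>e'. if e' \<in> insert e X then f else g"] this[of "\<lambda>e'. if e' \<in> X then f else g"] this[of ?h]
        have "(\<Prod>e'\<in>edges H - {e}. (if e' \<in> insert e X then f else g) (x (src H e'), x (tgt H e'))) =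
            (\<Prod>e'\<in>edges H - {e}. (if e' \<in> X then f else g) (x (src H e'), x (tgt H e')))"
            "(\<Prod>e'\<in>edges H - {e}. ?h e' (x (src H e'), x (tgt H e'))) =
            (\<Prod>e'\<in>edges H - {e}. (if e' \<in> X then f else g) (x (src H e'), x (tgt H e')))"
          by (auto intro!: prod.cong)
        with * insert.hyps(2) show "(\<Prod>e'\<in>edges H. (if e' \<in> insert e X then f else g) (x (src H e'), x (tgt H e'))) -
            (\<Prod>e'\<in>edges H. (if e' \<in> X then f else g) (x (src H e'), x (tgt H e'))) =
            (\<Prod>e'\<in>edges H. ?h e' (x (src H e'), x (tgt H e')))"
          by (simp add: left_diff_distrib)
      qed
      finally show ?thesis .
    qed
    moreover have "\<bar>decorated_density H ?h\<bar> \<le> cut_norm (?h e)"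
    proof (rule decorated_density_cut_norm[OF mg e])
      show "{src H e', tgt H e'} \<noteq> {src H e, tgt H e}" if "e' \<in> edges H" "e' \<noteq> e" for e'
        using inj_onD[OF inj, of e' e] that e by auto
    qed (use bd f g in auto)
    ultimately have "\<bar>T (insert e X) - T X\<bar> \<le> cut_norm (\<lambda>p. f p - g p)" by simp
    moreover have "\<bar>T X - T {}\<bar> \<le> card X * cut_norm (\<lambda>p. f p - g p)" using insert by simp
    ultimately have "\<bar>T (insert e X) - T {}\<bar> \<le> (1 + card X) * cut_norm (\<lambda>p. f p - g p)"
      by (simp add: distrib_right)
    then show ?case using insert.hyps by simp
  qed simp
  from this[of "edges H"] show ?thesis
    unfolding T_def hom_density_def decorated_density_def by simp
qed

section \<open>Polynomials, linear combinations and colourings\<close>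

lemma lagrange_interpolation:
  fixes A :: "real set"
  assumes A: "finite A"
  obtains W :: "real \<Rightarrow> real poly" where
    "\<And>p x. degree p < card A \<Longrightarrow> poly p x = (\<Sum>a\<in>A. poly p a * poly (W a) x)"
proof
  \<comment> \<open>The Lagrange basis of the nodes. It does not depend on \<open>p\<close>, so a
    whole family of polynomials can be interpolated with the same weights.\<close>
  define W where "W a = (\<Prod>b\<in>A - {a}. smult (1 / (a - b)) [:- b, 1:])" for a
  fix p :: "real poly" and x assume p: "degree p < card A"
  define q where "q = (\<Sum>a\<in>A. smult (poly p a) (W a))"
  have W: "poly (W a) c = (if c = a then 1 else 0)" if "a \<in> A" "c \<in> A" for a c
  proof (cases "c = a")
    case False
    then have "poly (smult (1 / (a - c)) [:- c, 1:]) c = 0" by simp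
    then show ?thesis unfolding W_def poly_prod using A that False
      by (auto intro!: prod_zero bexI[of _ c])
  next
    case True
    have "poly (smult (1 / (a - b)) [:- b, 1:]) a = 1" if "b \<in> A - {a}" for b
      using that by (simp add: diff_divide_distrib[symmetric])
    then show ?thesis using True by (simp add: W_def poly_prod prod.neutral)
  qed
  have "degree (W a) < card A" if "a \<in> A" for a
  proof -
    have "degree (W a) \<le> (\<Sum>b\<in>A - {a}. degree (smult (1 / (a - b)) [:- b, 1:]))"
      unfolding W_def
      using degree_prod_sum_le[of "A - {a}" "\<lambda>b. smult (1 / (a - b)) [:- b, 1:]"] A by (simp add: comp_def)
    also have "\<dots> \<le> (\<Sum>b\<in>A - {a}. 1)"
      by (intro sum_mono order.trans[OF degree_smult_le]) auto
    also have "\<dots> = card A - 1" using A that by simp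
    also have "\<dots> < card A"
    proof -
      have "card A > 0" using A that by (auto simp: card_gt_0_iff)
      then show ?thesis by simp
    qed
    finally show ?thesis .
  qed
  then have "degree q < card A"
    unfolding q_def using p
    by (intro degree_sum_less) (auto intro: le_less_trans[OF degree_smult_le])
  moreover have "poly p c = poly q c" if "c \<in> A" for c
  proof -
    have "poly q c = (\<Sum>a\<in>A. if c = a then poly p a else 0)"
      unfolding q_def using that by (auto simp: poly_sum W intro!: sum.cong)
    then show ?thesis using A that by simp
  qed
  ultimately have "p = q" using p by (intro poly_eqI_degree[of A]) auto
  moreover have "poly q x = (\<Sum>a\<in>A. poly p a * poly (W a) x)"
    by (simp add: q_def poly_sum)
  ultimately show "poly p x = (\<Sum>a\<in>A. poly p a * poly (W a) x)" by simp
qed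

text \<open>Multivariate polynomials with variables indexed by \<open>'e\<close>, as lists of coefficients and monomials.\<close>

definition eval_mono :: "'e list \<Rightarrow> ('e \<Rightarrow> real) \<Rightarrow> real" where
  "eval_mono xs A = prod_list (map A xs)"

definition eval_mpoly :: "(real \<times> 'e list) list \<Rightarrow> ('e \<Rightarrow> real) \<Rightarrow> real" where
  "eval_mpoly L A = (\<Sum>(c, xs)\<leftarrow>L. c * eval_mono xs A)"

definition poly_fun :: "'e set \<Rightarrow> (('e \<Rightarrow> real) \<Rightarrow> real) \<Rightarrow> bool" where
  "poly_fun X g \<longleftrightarrow> (\<exists>L. (\<forall>(c, xs)\<in>set L. set xs \<subseteq> X) \<and> g = eval_mpoly L)"

lemma eval_mpoly_simps [simp]:
  "eval_mpoly [] A = 0"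
  "eval_mpoly ((c, xs) # L) A = c * eval_mono xs A + eval_mpoly L A"
  "eval_mpoly (L @ L') A = eval_mpoly L A + eval_mpoly L' A"
  by (auto simp: eval_mpoly_def)

lemma poly_fun_const: "poly_fun X (\<lambda>_. c)"
  unfolding poly_fun_def by (intro exI[of _ "[(c, [])]"]) (auto simp: eval_mono_def fun_eq_iff)

lemma poly_fun_var: "e \<in> X \<Longrightarrow> poly_fun X (\<lambda>A. A e)"
  unfolding poly_fun_def by (intro exI[of _ "[(1, [e])]"]) (auto simp: eval_mono_def fun_eq_iff)

lemma poly_fun_add:
  assumes "poly_fun X g" "poly_fun X h"
  shows "poly_fun X (\<lambda>A. g A + h A)"
proof -
  obtain L L' where "\<forall>(c, xs)\<in>set L. set xs \<subseteq> X" "g = eval_mpoly L"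
    "\<forall>(c, xs)\<in>set L'. set xs \<subseteq> X" "h = eval_mpoly L'"
    using assms unfolding poly_fun_def by blast
  then show ?thesis unfolding poly_fun_def by (intro exI[of _ "L @ L'"]) (auto simp: fun_eq_iff)
qed

lemma poly_fun_mult:
  assumes "poly_fun X g" "poly_fun X h"
  shows "poly_fun X (\<lambda>A. g A * h A)"
proof -
  obtain L L' where L: "\<forall>(c, xs)\<in>set L. set xs \<subseteq> X" "g = eval_mpoly L"
    and L': "\<forall>(c, xs)\<in>set L'. set xs \<subseteq> X" "h = eval_mpoly L'"
    using assms unfolding poly_fun_def by blast
  have 1: "eval_mpoly (map (\<lambda>(d, ys). (c * d, xs @ ys)) L') A = c * eval_mono xs A * eval_mpoly L' A" for c xs A
    by (induction L') (auto simp: eval_mono_def algebra_simps)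
  have "\<exists>M. (\<forall>(c, xs)\<in>set M. set xs \<subseteq> X) \<and> (\<forall>A. eval_mpoly M A = eval_mpoly L A * eval_mpoly L' A)"
    using L(1)
  proof (induction L)
    case Nil
    then show ?case by (intro exI[of _ "[]"]) auto
  next
    case (Cons x L)
    then obtain M where M: "\<forall>(c, xs)\<in>set M. set xs \<subseteq> X" "\<And>A. eval_mpoly M A = eval_mpoly L A * eval_mpoly L' A"
      by auto
    obtain c xs where x: "x = (c, xs)" by (cases x)
    show ?case
    proof (intro exI[of _ "map (\<lambda>(d, ys). (c * d, xs @ ys)) L' @ M"] conjI allI)
      show "\<forall>(c, xs)\<in>set (map (\<lambda>(d, ys). (c * d, xs @ ys)) L' @ M). set xs \<subseteq> X"
        using Cons.prems M(1) L'(1) by (simp add: x case_prod_unfold ball_Un)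
      show "eval_mpoly (map (\<lambda>(d, ys). (c * d, xs @ ys)) L' @ M) A = eval_mpoly (x # L) A * eval_mpoly L' A" for A
        by (simp add: x 1 M(2) distrib_right)
    qed
  qed
  then obtain M where "\<forall>(c, xs)\<in>set M. set xs \<subseteq> X" "\<And>A. eval_mpoly M A = eval_mpoly L A * eval_mpoly L' A"
    by blast
  then show ?thesis unfolding poly_fun_def L(2) L'(2) by (intro exI[of _ M]) (simp add: fun_eq_iff)
qed

lemma poly_fun_sum:
  assumes "finite I" "\<And>i. i \<in> I \<Longrightarrow> poly_fun X (g i)"
  shows "poly_fun X (\<lambda>A. \<Sum>i\<in>I. g i A)"
  using assms by (induction I rule: finite_induct) (auto intro: poly_fun_const poly_fun_add)

lemma poly_fun_poly:
  assumes "e \<in> X"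
  shows "poly_fun X (\<lambda>A. poly p (A e))"
proof (induction p)
  case 0
  then show ?case by (simp add: poly_fun_const)
next
  case (pCons a p)
  then show ?case using assms by (auto intro!: poly_fun_add poly_fun_mult poly_fun_const poly_fun_var)
qed

lemma poly_fun_mono: "poly_fun X g \<Longrightarrow> X \<subseteq> Y \<Longrightarrow> poly_fun Y g"
  unfolding poly_fun_def by (auto simp: case_prod_unfold)

definition cube :: "'e set \<Rightarrow> ('e \<Rightarrow> real) set" where
  "cube E = {A. \<forall>e\<in>E. 0 \<le> A e \<and> A e \<le> 1}"

text \<open>Interpolation in the single coordinates gives a polynomial; the terms of higher degree
  cancel on each ray from the origin.\<close>

lemma polynomial_of_segments:
  fixes h :: "('e \<Rightarrow> real) \<Rightarrow> real"
  assumes E: "finite E" and N: "N > 0"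
    and line: "\<And>A B. A \<in> cube E \<Longrightarrow> B \<in> cube E \<Longrightarrow>
      \<exists>p. degree p < N \<and> (\<forall>l\<in>{0..1}. h (\<lambda>e. A e + l * (B e - A e)) = poly p l)"
    and local: "\<And>A B. (\<And>e. e \<in> E \<Longrightarrow> A e = B e) \<Longrightarrow> h A = h B"
  obtains L where "\<And>c xs. (c, xs) \<in> set L \<Longrightarrow> set xs \<subseteq> E \<and> length xs < N"
    "\<And>A. A \<in> cube E \<Longrightarrow> h A = eval_mpoly L A"
proof -
  obtain nodes :: "real set" where nodes: "finite nodes" "card nodes = N" "nodes \<subseteq> {0..1}"
    using infinite_arbitrarily_large[of "{0..1::real}" N] infinite_Icc[of 0 "1::real"] by auto
  obtain W :: "real \<Rightarrow> real poly" where W: "\<And>p x. degree p < N \<Longrightarrow> poly p x = (\<Sum>a\<in>nodes. poly p a * poly (W a) x)"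
    using lagrange_interpolation[OF nodes(1)] nodes(2) by metis
  \<comment> \<open>Coordinates outside \<open>E'\<close> are frozen at \<open>A0\<close>. This
    point stays arbitrary, because adding \<open>e\<close> to \<open>E'\<close> uses the claim with
    \<open>e\<close> frozen at each of the \<open>N\<close> nodes.\<close>
  have "\<exists>g. poly_fun E' g \<and> (\<forall>A\<in>cube E. h (\<lambda>e. if e \<in> E' then A e else A0 e) = g A)"
    if "E' \<subseteq> E" "A0 \<in> cube E" for E' A0
    using finite_subset[OF that(1) E] that
  proof (induction E' arbitrary: A0 rule: finite_induct)
    case empty
    then show ?case by (intro exI[of _ "\<lambda>_. h A0"]) (simp add: poly_fun_const)
  next
    case (insert e E')
    have "\<exists>g. poly_fun E' g \<and> (\<forall>A\<in>cube E. h (\<lambda>e'. if e' \<in> E' then A e' else (A0(e := t)) e') = g A)" if "t \<in> nodes" for t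
      using insert.prems nodes(3) that by (intro insert.IH) (auto simp: cube_def)
    then have "\<forall>t\<in>nodes. \<exists>g. poly_fun E' g \<and> (\<forall>A\<in>cube E. h (\<lambda>e'. if e' \<in> E' then A e' else (A0(e := t)) e') = g A)"
      by blast
    from bchoice[OF this] obtain g where g: "\<And>t. t \<in> nodes \<Longrightarrow> poly_fun E' (g t)"
      "\<And>t A. t \<in> nodes \<Longrightarrow> A \<in> cube E \<Longrightarrow> h (\<lambda>e'. if e' \<in> E' then A e' else (A0(e := t)) e') = g t A"
      by blast
    let ?g = "\<lambda>A. \<Sum>t\<in>nodes. g t A * poly (W t) (A e)"
    have "poly_fun (insert e E') ?g"
      using nodes(1) g(1) by (intro poly_fun_sum poly_fun_mult poly_fun_poly poly_fun_mono[where Y = "insert e E'" and X = E']) auto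
    moreover have "h (\<lambda>e'. if e' \<in> insert e E' then A e' else A0 e') = ?g A" if A: "A \<in> cube E" for A
    proof -
      define C where "C t = (\<lambda>e'. if e' \<in> E' then A e' else (A0(e := t)) e')" for t
      have C: "C t \<in> cube E" if "t \<in> {0..1}" for t
        using that A insert.prems by (auto simp: C_def cube_def)
      obtain p where p: "degree p < N" "\<And>l. l \<in> {0..1} \<Longrightarrow> h (\<lambda>e'. C 0 e' + l * (C 1 e' - C 0 e')) = poly p l"
        using line[OF C C, of 0 1] by auto
      have "(\<lambda>e'. C 0 e' + l * (C 1 e' - C 0 e')) = C l" for l
        using insert.hyps by (auto simp: C_def fun_eq_iff)
      then have hC: "h (C l) = poly p l" if "l \<in> {0..1}" for l
        using p(2)[OF that] by simp
      have "A e \<in> {0..1}" using A insert.prems by (auto simp: cube_def)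
      moreover have "(\<lambda>e'. if e' \<in> insert e E' then A e' else A0 e') = C (A e)"
        using insert.hyps by (auto simp: C_def fun_eq_iff)
      ultimately have "h (\<lambda>e'. if e' \<in> insert e E' then A e' else A0 e') = poly p (A e)"
        using hC by simp
      also have "\<dots> = (\<Sum>t\<in>nodes. poly p t * poly (W t) (A e))"
        by (rule W[OF p(1)])
      also have "\<dots> = ?g A"
      proof (rule sum.cong[OF refl])
        fix t assume t: "t \<in> nodes"
        then have "poly p t = h (C t)" using hC nodes(3) by auto
        also have "\<dots> = g t A" using g(2)[OF t A] by (simp add: C_def)
        finally show "poly p t * poly (W t) (A e) = g t A * poly (W t) (A e)" by simp
      qed
      finally show ?thesis .
    qed
    ultimately show ?case by blast
  qed
  from this[of E "\<lambda>_. 0"] obtain L where L: "\<forall>(c, xs)\<in>set L. set xs \<subseteq> E"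
    "\<And>A. A \<in> cube E \<Longrightarrow> h (\<lambda>e. if e \<in> E then A e else 0) = eval_mpoly L A"
    by (auto simp: poly_fun_def cube_def)
  have L2: "h A = eval_mpoly L A" if "A \<in> cube E" for A
    using L(2)[OF that] local[of A "\<lambda>e. if e \<in> E then A e else 0"] by simp
  define L' where "L' = filter (\<lambda>(c, xs). length xs < N) L"
  have "h A = eval_mpoly L' A" if A: "A \<in> cube E" for A
  proof -
    \<comment> \<open>\<open>q M\<close> sorts the monomials by length; it is the restriction to the
      ray through \<open>A\<close>. Interpolation bounds the degree in each variable only, but this
      restriction has degree less than \<open>N\<close>, so truncation does not change it.\<close>
    define q where "q M = (\<Sum>(c, xs)\<leftarrow>M. monom (c * eval_mono xs A) (length xs))" for M
    have q: "poly (q M) l = eval_mpoly M (\<lambda>e. l * A e)" for M l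
    proof (induction M)
      case (Cons x M)
      have "eval_mono xs (\<lambda>e. l * A e) = l ^ length xs * eval_mono xs A" for xs
        by (induction xs) (auto simp: eval_mono_def)
      then show ?case using Cons by (cases x) (simp add: q_def poly_monom)
    qed (simp add: q_def)
    obtain p where p: "degree p < N" "\<And>l. l \<in> {0..1} \<Longrightarrow> h (\<lambda>e. 0 + l * (A e - 0)) = poly p l"
      using line[of "\<lambda>_. 0" A] A by (auto simp: cube_def)
    have "poly p l = poly (q L) l" if l: "l \<in> {0..1}" for l
    proof -
      have "(\<lambda>e. l * A e) \<in> cube E" using A l by (auto simp: cube_def mult_le_one)
      then show ?thesis using p(2)[OF l] L2[of "\<lambda>e. l * A e"] q by simp
    qed
    then have "poly (p - q L) l = 0" if "l \<in> {0..1}" for l using that by simp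
    then have "{0..1} \<subseteq> {l. poly (p - q L) l = 0}" by blast
    then have "infinite {l. poly (p - q L) l = 0}"
      by (rule infinite_super) (rule infinite_Icc, simp)
    then have "p = q L" using poly_roots_finite[of "p - q L"] by auto
    have coeff_q: "coeff (q M) k = (\<Sum>(c, xs)\<leftarrow>M. if length xs = k then c * eval_mono xs A else 0)" for M k
      by (induction M) (auto simp: q_def)
    have "degree (q L') < N"
    proof -
      have "coeff (q L') k = 0" if "k \<ge> N" for k
        unfolding coeff_q L'_def using that by (induction L) auto
      then show ?thesis using N by (metis degree_0 leading_coeff_0_iff not_le)
    qed
    moreover have "coeff (q L') k = coeff (q L) k" if "k < N" for k
      unfolding coeff_q L'_def using that by (induction L) auto
    ultimately have "q L' = q L"
      using p(1) \<open>p = q L\<close> by (intro poly_eqI) (metis coeff_eq_0 le_less_trans not_le)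
    have "h A = poly (q L) 1" using q[of L 1] L2[OF A] by simp
    also have "\<dots> = eval_mpoly L' A" using q[of L' 1] \<open>q L' = q L\<close> by simp
    finally show ?thesis .
  qed
  moreover have "set xs \<subseteq> E \<and> length xs < N" if "(c, xs) \<in> set L'" for c xs
    using that L(1) by (auto simp: L'_def)
  ultimately show thesis by (intro that[of L']) auto
qed

section \<open>Spans of finitely many functions\<close>

definition lin_comb :: "'i set \<Rightarrow> ('i \<Rightarrow> 'x \<Rightarrow> real) \<Rightarrow> 'x set \<Rightarrow> ('x \<Rightarrow> real) \<Rightarrow> bool" where
  "lin_comb I q X G \<longleftrightarrow> (\<exists>c. \<forall>x\<in>X. G x = (\<Sum>i\<in>I. c i * q i x))"

lemma lin_comb_zero: "lin_comb I q X (\<lambda>_. 0)"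
  unfolding lin_comb_def by (intro exI[of _ "\<lambda>_. 0"]) simp

lemma lin_comb_add_scaled:
  assumes "finite I" "i \<in> I" "lin_comb I q X G" "\<And>x. x \<in> X \<Longrightarrow> g x = q i x"
  shows "lin_comb I q X (\<lambda>x. a * g x + G x)"
proof -
  obtain c where c: "\<And>x. x \<in> X \<Longrightarrow> G x = (\<Sum>i\<in>I. c i * q i x)"
    using assms(3) unfolding lin_comb_def by blast
  have "a * g x + G x = (\<Sum>j\<in>I. (c(i := c i + a)) j * q j x)" if "x \<in> X" for x
    using assms(1,2) c[OF that] assms(4)[OF that]
    by (simp add: sum.remove[of I i] algebra_simps)
  then show ?thesis unfolding lin_comb_def by blast
qed

text \<open>If the \<open>q i\<close> are linearly dependent, the coefficients of \<open>G n\<close>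
  may diverge although \<open>G n\<close> converges. So they are not followed directly: one function
  is eliminated by evaluation at a point where it is nonzero, and the rest is induction.\<close>

lemma lin_comb_limit:
  assumes "finite I" "\<And>n. lin_comb I q X (G n)" "\<And>x. x \<in> X \<Longrightarrow> (\<lambda>n. G n x) \<longlonglongrightarrow> L x"
  shows "lin_comb I q X L"
  using assms
proof (induction I arbitrary: q G L rule: finite_induct)
  case empty
  have "L x = 0" if "x \<in> X" for x
  proof -
    have "G n x = 0" for n using empty(1) that by (simp add: lin_comb_def)
    then show ?thesis using empty(2)[OF that] by (simp add: LIMSEQ_const_iff)
  qed
  then show ?case by (simp add: lin_comb_def)
next
  case (insert j I)
  have "\<forall>n. \<exists>c. \<forall>x\<in>X. G n x = c j * q j x + (\<Sum>i\<in>I. c i * q i x)"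
    using insert.prems(1) insert.hyps by (simp add: lin_comb_def)
  from choice[OF this] obtain c where c: "\<And>n x. x \<in> X \<Longrightarrow> G n x = c n j * q j x + (\<Sum>i\<in>I. c n i * q i x)"
    by blast
  show ?case
  proof (cases "\<forall>x\<in>X. q j x = 0")
    case True
    then have "lin_comb I q X (G n)" for n
      unfolding lin_comb_def using c by (intro exI[of _ "c n"]) simp
    from insert.IH[OF this insert.prems(2)] obtain d where "\<forall>x\<in>X. L x = (\<Sum>i\<in>I. d i * q i x)"
      unfolding lin_comb_def by blast
    then show ?thesis unfolding lin_comb_def using True insert.hyps by (intro exI[of _ d]) simp
  next
    case False
    then obtain x0 where x0: "x0 \<in> X" "q j x0 \<noteq> 0" by blast
    \<comment> \<open>The reduced functions \<open>q' i\<close> vanish at \<open>x0\<close>. The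
      multiple of \<open>q j\<close> to be removed is then determined by the value at
      \<open>x0\<close>, which converges.\<close>
    define r where "r i = q i x0 / q j x0" for i
    define q' where "q' i x = q i x - r i * q j x" for i x
    have "lin_comb I q' X (\<lambda>x. G n x - G n x0 / q j x0 * q j x)" for n
      unfolding lin_comb_def
    proof (intro exI[of _ "c n"] ballI)
      fix x assume x: "x \<in> X"
      have "G n x0 / q j x0 = c n j + (\<Sum>i\<in>I. c n i * r i)"
        using x0 by (simp add: c[OF x0(1)] r_def add_divide_distrib sum_divide_distrib)
      then show "G n x - G n x0 / q j x0 * q j x = (\<Sum>i\<in>I. c n i * q' i x)"
        by (simp add: c[OF x] q'_def algebra_simps sum_subtractf sum_distrib_left)
    qed
    moreover have "(\<lambda>n. G n x - G n x0 / q j x0 * q j x) \<longlonglongrightarrow> L x - L x0 / q j x0 * q j x" if "x \<in> X" for x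
      using insert.prems(2)[OF that] insert.prems(2)[OF x0(1)] x0(2) by (intro tendsto_intros) auto
    ultimately obtain d where d: "\<And>x. x \<in> X \<Longrightarrow> L x - L x0 / q j x0 * q j x = (\<Sum>i\<in>I. d i * q' i x)"
      using insert.IH[of q' "\<lambda>n x. G n x - G n x0 / q j x0 * q j x" "\<lambda>x. L x - L x0 / q j x0 * q j x"]
      unfolding lin_comb_def by blast
    define d' where "d' = d(j := L x0 / q j x0 - (\<Sum>i\<in>I. d i * r i))"
    have "L x = (\<Sum>i\<in>insert j I. d' i * q i x)" if x: "x \<in> X" for x
    proof -
      have "(\<Sum>i\<in>I. d' i * q i x) = (\<Sum>i\<in>I. d i * q i x)"
        using insert.hyps by (intro sum.cong) (auto simp: d'_def)
      moreover have "L x = L x0 / q j x0 * q j x + (\<Sum>i\<in>I. d i * q i x) - (\<Sum>i\<in>I. d i * r i) * q j x"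
        using d[OF x] by (simp add: q'_def algebra_simps sum_subtractf sum_distrib_left)
      ultimately show ?thesis
        using insert.hyps by (simp add: d'_def algebra_simps)
    qed
    then show ?thesis unfolding lin_comb_def by blast
  qed
qed

section \<open>Sums over colourings and rearrangement of colours\<close>

lemma sum_PiE_insert:
  assumes "s \<notin> S"
  shows "(\<Sum>\<tau>\<in>insert s S \<rightarrow>\<^sub>E K. f \<tau>) = (\<Sum>b\<in>K. \<Sum>\<tau>\<in>S \<rightarrow>\<^sub>E K. f (\<tau>(s := b)))"
proof -
  have "(\<Sum>\<tau>\<in>insert s S \<rightarrow>\<^sub>E K. f \<tau>) = (\<Sum>(b, \<tau>)\<in>K \<times> (S \<rightarrow>\<^sub>E K). f (\<tau>(s := b)))"
    unfolding PiE_insert_eq using assms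
    by (subst sum.reindex) (auto intro!: inj_combinator sum.cong)
  then show ?thesis by (simp add: sum.cartesian_product)
qed

lemma sum_PiE_restrict:
  fixes c :: "('a \<Rightarrow> 'k) \<Rightarrow> real"
  assumes "finite S" "V \<subseteq> S" "finite K"
  shows "(\<Sum>\<tau>\<in>S \<rightarrow>\<^sub>E K. c (restrict \<tau> V)) = card K ^ (card S - card V) * (\<Sum>\<rho>\<in>V \<rightarrow>\<^sub>E K. c \<rho>)"
proof -
  have "(\<Sum>\<tau>\<in>(V \<union> D) \<rightarrow>\<^sub>E K. c (restrict \<tau> V)) = card K ^ card D * (\<Sum>\<rho>\<in>V \<rightarrow>\<^sub>E K. c \<rho>)"
    if "finite D" "D \<inter> V = {}" for D
    using that
  proof (induction D rule: finite_induct)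
    case empty
    then show ?case by (auto intro!: sum.cong simp: PiE_restrict)
  next
    case (insert s D)
    have "restrict (\<tau>(s := b)) V = restrict \<tau> V" for \<tau> :: "'a \<Rightarrow> 'k" and b
      using insert.prems by auto
    then have "(\<Sum>\<tau>\<in>(V \<union> insert s D) \<rightarrow>\<^sub>E K. c (restrict \<tau> V)) = (\<Sum>b\<in>K. \<Sum>\<tau>\<in>(V \<union> D) \<rightarrow>\<^sub>E K. c (restrict \<tau> V))"
      using insert.hyps insert.prems by (simp only: Un_insert_right) (subst sum_PiE_insert, auto)
    also have "\<dots> = card K * (card K ^ card D * (\<Sum>\<rho>\<in>V \<rightarrow>\<^sub>E K. c \<rho>))"
      using insert by (subst insert.IH) auto
    finally show ?case
      by (simp only: card_insert_disjoint[OF insert.hyps] power_Suc mult.assoc of_nat_mult)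
  qed
  from this[of "S - V"] show ?thesis
    using assms by (simp only: Un_Diff_cancel Un_absorb1 card_Diff_subset[OF finite_subset[OF assms(2,1)] assms(2)]) auto
qed

text \<open>This bounds the variance of the size of a colour class under a uniformly random
  colouring, without normalisation. The centred indicators \<open>y\<close> sum to zero over the
  colours, so the mixed terms vanish when a block is added, and each block contributes at most 1 to
  the mean.\<close>

lemma sum_PiE_card_deviation:
  fixes m :: nat
  assumes m: "m > 0" and a: "a < m"
  shows "(\<Sum>\<tau>\<in>{..<n} \<rightarrow>\<^sub>E {..<m}. (real (card {i \<in> {..<n}. \<tau> i = a}) - n / m)\<^sup>2) \<le> n * real m ^ n"
proof -
  define y where "y b = (if b = a then 1 else 0) - 1 / real m" for b
  have y0: "(\<Sum>b<m. y b) = 0"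
    using m a by (simp add: y_def sum_subtractf)
  have y2: "(\<Sum>b<m. (y b)\<^sup>2) \<le> m"
  proof -
    have "(y b)\<^sup>2 \<le> 1" for b
    proof -
      have "\<bar>y b\<bar> \<le> 1" using m by (auto simp: y_def)
      then show ?thesis by (simp add: abs_square_le_1)
    qed
    then have "(\<Sum>b<m. (y b)\<^sup>2) \<le> (\<Sum>b<m. 1)" by (intro sum_mono) auto
    then show ?thesis by simp
  qed
  have "(\<Sum>\<tau>\<in>{..<n} \<rightarrow>\<^sub>E {..<m}. (\<Sum>i<n. y (\<tau> i))\<^sup>2) \<le> n * real m ^ n"
  proof (induction n)
    case (Suc n)
    let ?X = "\<lambda>\<tau>. \<Sum>i<n. y (\<tau> i)" and ?P = "{..<n} \<rightarrow>\<^sub>E {..<m}"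
    have "(\<Sum>\<tau>\<in>{..<Suc n} \<rightarrow>\<^sub>E {..<m}. (\<Sum>i<Suc n. y (\<tau> i))\<^sup>2) =
        (\<Sum>b<m. \<Sum>\<tau>\<in>?P. (\<Sum>i<Suc n. y ((\<tau>(n := b)) i))\<^sup>2)"
      unfolding lessThan_Suc by (subst sum_PiE_insert) auto
    also have "\<dots> = (\<Sum>b<m. \<Sum>\<tau>\<in>?P. (?X \<tau>)\<^sup>2 + 2 * y b * ?X \<tau> + (y b)\<^sup>2)"
      by (intro sum.cong refl) (simp add: power2_eq_square algebra_simps)
    also have "\<dots> = (\<Sum>b<m. (\<Sum>\<tau>\<in>?P. (?X \<tau>)\<^sup>2) + 2 * y b * (\<Sum>\<tau>\<in>?P. ?X \<tau>) + card ?P * (y b)\<^sup>2)"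
      by (intro sum.cong refl) (simp only: sum.distrib sum_distrib_left sum_constant of_nat_id)
    also have "\<dots> = m * (\<Sum>\<tau>\<in>?P. (?X \<tau>)\<^sup>2) + 2 * (\<Sum>b<m. y b) * (\<Sum>\<tau>\<in>?P. ?X \<tau>) + card ?P * (\<Sum>b<m. (y b)\<^sup>2)"
      by (simp only: sum.distrib sum_distrib_left[symmetric] sum_distrib_right[symmetric] sum_constant card_lessThan)
    also have "\<dots> \<le> m * (n * real m ^ n) + m ^ n * m"
      using Suc.IH y2 y0 m by (intro add_mono mult_mono) (auto simp: card_PiE mult_left_mono)
    finally show ?case by (simp add: algebra_simps)
  qed simp
  moreover have "real (card {i \<in> {..<n}. \<tau> i = a}) - n / m = (\<Sum>i<n. y (\<tau> i))" for \<tau>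
  proof -
    have "(\<Sum>i<n. if \<tau> i = a then 1 else 0 :: real) = card {i \<in> {..<n}. \<tau> i = a}"
      by (simp add: sum.If_cases Int_def)
    then show ?thesis by (simp add: y_def sum_subtractf)
  qed
  ultimately show ?thesis by simp
qed

text \<open>In each colour as many positions as possible are matched, namely the smaller of the two
  class sizes; the remaining positions are matched arbitrarily. Those of colour \<open>a\<close>
  under \<open>\<rho>\<close> number at most the difference of the class sizes.\<close>

lemma permutation_matching_colours:
  fixes n m :: nat
  assumes \<tau>: "\<And>i. i < n \<Longrightarrow> \<tau> i < m" and \<rho>: "\<And>i. i < n \<Longrightarrow> \<rho> i < m"
  obtains \<sigma> where "\<sigma> permutes {..<n}"
    "real (card {i \<in> {..<n}. \<tau> (\<sigma> i) \<noteq> \<rho> i}) \<le>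
      (\<Sum>a<m. \<bar>real (card {i \<in> {..<n}. \<tau> i = a}) - real (card {i \<in> {..<n}. \<rho> i = a})\<bar>)"
proof -
  define t where "t a = {i \<in> {..<n}. \<tau> i = a}" for a
  define r where "r a = {i \<in> {..<n}. \<rho> i = a}" for a
  define k where "k a = min (card (t a)) (card (r a))" for a
  have 1: "\<exists>T. T \<subseteq> t a \<and> card T = k a" for a
    using obtain_subset_with_card_n[of "k a" "t a"] unfolding k_def by (metis min.cobounded1)
  have 2: "\<exists>R. R \<subseteq> r a \<and> card R = k a" for a
    using obtain_subset_with_card_n[of "k a" "r a"] unfolding k_def by (metis min.cobounded2)
  from choice[of "\<lambda>a T. T \<subseteq> t a \<and> card T = k a"] choice[of "\<lambda>a R. R \<subseteq> r a \<and> card R = k a"] 1 2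
  obtain T R where T: "\<And>a. T a \<subseteq> t a" "\<And>a. card (T a) = k a" and R: "\<And>a. R a \<subseteq> r a" "\<And>a. card (R a) = k a"
    by blast
  have fin: "finite (T a)" "finite (R a)" for a
  proof -
    have "finite (t a)" unfolding t_def by (rule finite_subset[of _ "{..<n}"]) auto
    moreover have "finite (r a)" unfolding r_def by (rule finite_subset[of _ "{..<n}"]) auto
    ultimately show "finite (T a)" "finite (R a)" using finite_subset[OF T(1)] finite_subset[OF R(1)] by auto
  qed
  have "\<exists>g. bij_betw g (R a) (T a)" for a
    using finite_same_card_bij[of "R a" "T a"] fin T R by metis
  then obtain g where g: "\<And>a. bij_betw (g a) (R a) (T a)" by metis
  have mem: "\<And>i. i \<in> T a \<Longrightarrow> i < n \<and> \<tau> i = a" "\<And>i. i \<in> R a \<Longrightarrow> i < n \<and> \<rho> i = a" for a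
    using T(1)[of a] R(1)[of a] by (auto simp: t_def r_def)
  define RR TT where "RR = (\<Union>a<m. R a)" and "TT = (\<Union>a<m. T a)"
  have sub: "RR \<subseteq> {..<n}" "TT \<subseteq> {..<n}"
    using mem by (auto simp: RR_def TT_def)
  have disj: "R a \<inter> R b = {}" "T a \<inter> T b = {}" if "a \<noteq> b" for a b
    using mem that by blast+
  have RR_iff: "i \<in> R (\<rho> i) \<and> \<rho> i < m" if "i \<in> RR" for i
    using that mem by (auto simp: RR_def)
  have gRR: "bij_betw (\<lambda>i. g (\<rho> i) i) RR TT"
  proof -
    have "bij_betw (\<lambda>i. g (\<rho> i) i) (R a) (T a)" for a
    proof -
      have "g (\<rho> i) i = g a i" if "i \<in> R a" for i using mem(2)[OF that] by simp
      then show ?thesis using g[of a] by (subst bij_betw_cong) auto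
    qed
    then show ?thesis unfolding RR_def TT_def
      by (intro bij_betw_UNION_disjoint) (auto simp: disjoint_family_on_def disj)
  qed
  have cards: "card RR = (\<Sum>a<m. k a)"
    unfolding RR_def using R(2) fin disj by (subst card_UN_disjoint) auto
  have "card ({..<n} - RR) = card ({..<n} - TT)"
    using bij_betw_same_card[OF gRR] sub by (simp add: card_Diff_subset finite_subset)
  then obtain h where h: "bij_betw h ({..<n} - RR) ({..<n} - TT)"
    using finite_same_card_bij[of "{..<n} - RR" "{..<n} - TT"] by auto
  define \<sigma> where "\<sigma> i = (if i \<in> RR then g (\<rho> i) i else if i < n then h i else i)" for i
  have "bij_betw \<sigma> (RR \<union> ({..<n} - RR)) (TT \<union> ({..<n} - TT))"
  proof (rule bij_betw_combine)
    show "bij_betw \<sigma> RR TT" using gRR by (subst bij_betw_cong[where g = "\<lambda>i. g (\<rho> i) i"]) (auto simp: \<sigma>_def)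
    show "bij_betw \<sigma> ({..<n} - RR) ({..<n} - TT)" using h by (subst bij_betw_cong[where g = h]) (auto simp: \<sigma>_def)
  qed auto
  then have "bij_betw \<sigma> {..<n} {..<n}" using sub by (simp add: Un_absorb1)
  then have perm: "\<sigma> permutes {..<n}"
    by (rule bij_imp_permutes) (use sub in \<open>auto simp: \<sigma>_def\<close>)
  have good: "\<tau> (\<sigma> i) = \<rho> i" if "i \<in> RR" for i
  proof -
    have "g (\<rho> i) i \<in> T (\<rho> i)" using g[of "\<rho> i"] RR_iff[OF that] by (auto simp: bij_betw_def)
    then show ?thesis using mem(1) that by (auto simp: \<sigma>_def)
  qed
  have n: "n = (\<Sum>a<m. card (r a))"
  proof -
    have "{..<n} = (\<Union>a<m. r a)" using \<rho> by (auto simp: r_def)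
    then have "card {..<n} = card (\<Union>a<m. r a)" by simp
    also have "\<dots> = (\<Sum>a<m. card (r a))" by (subst card_UN_disjoint) (auto simp: r_def)
    finally show ?thesis by simp
  qed
  have "{i \<in> {..<n}. \<tau> (\<sigma> i) \<noteq> \<rho> i} \<subseteq> {..<n} - RR" using good by auto
  then have "card {i \<in> {..<n}. \<tau> (\<sigma> i) \<noteq> \<rho> i} \<le> card ({..<n} - RR)" by (intro card_mono) auto
  also have "\<dots> = n - (\<Sum>a<m. k a)"
    using sub cards by (simp add: card_Diff_subset finite_subset)
  finally have "real (card {i \<in> {..<n}. \<tau> (\<sigma> i) \<noteq> \<rho> i}) \<le> real n - (\<Sum>a<m. real (k a))"
    using n by (subst (asm) of_nat_le_iff[where 'a = real, symmetric]) (auto simp: of_nat_diff sum_mono k_def)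
  also have "\<dots> = (\<Sum>a<m. real (card (r a)) - real (k a))"
    by (subst n) (simp add: sum_subtractf)
  also have "\<dots> \<le> (\<Sum>a<m. \<bar>real (card (t a)) - real (card (r a))\<bar>)"
    by (intro sum_mono) (auto simp: k_def)
  finally show thesis using perm by (intro that[of \<sigma>]) (auto simp: t_def r_def)
qed

section \<open>Permutations of blocks and monomials in step graphons\<close>

lemma measure_preserving_cong:
  assumes "measure_preserving M N T" "\<And>x. x \<in> space M \<Longrightarrow> T' x = T x"
  shows "measure_preserving M N T'"
proof -
  have "T' \<in> M \<rightarrow>\<^sub>M N \<longleftrightarrow> T \<in> M \<rightarrow>\<^sub>M N" by (rule measurable_cong) (rule assms(2))
  moreover have "distr M N T' = distr M N T" by (rule distr_cong) (use assms(2) in auto)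
  ultimately show ?thesis using assms(1) by (simp add: measure_preserving_def)
qed

text \<open>Block \<open>i\<close> is translated onto block \<open>\<sigma> i\<close>. The point 0
  is in block 0 by convention only: if \<open>\<sigma> 0 > 0\<close>, its translate would be the
  right endpoint of another block and injectivity would fail. So it is fixed.\<close>

definition block_shift :: "nat \<Rightarrow> (nat \<Rightarrow> nat) \<Rightarrow> real \<Rightarrow> real" where
  "block_shift n \<sigma> x = (if x = 0 then 0 else x + (real (\<sigma> (block n x)) - real (block n x)) / n)"

context
  fixes n :: nat and \<sigma> :: "nat \<Rightarrow> nat"
  assumes n: "n > 0" and \<sigma>: "\<sigma> permutes {..<n}"
begin

lemma block_shift_pos:
  assumes "x \<in> {0<..1}"
  shows "block_shift n \<sigma> x \<in> {0<..1}" "block n (block_shift n \<sigma> x) = \<sigma> (block n x)"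
proof -
  define i where "i = block n x"
  have i: "real i / n < x" "x \<le> (real i + 1) / n" "i < n"
    using block_eq_iff[OF n assms, of i] block_less[OF n, of x] assms by (auto simp: i_def)
  have \<sigma>i: "\<sigma> i < n" using permutes_in_image[OF \<sigma>, of i] i(3) by simp
  let ?y = "block_shift n \<sigma> x"
  have y: "?y = x - real i / n + real (\<sigma> i) / n"
    using assms by (simp add: block_shift_def i_def diff_divide_distrib)
  have 1: "real (\<sigma> i) / n < ?y" "?y \<le> (real (\<sigma> i) + 1) / n"
    using i unfolding y by (auto simp: add_divide_distrib)
  have "(real (\<sigma> i) + 1) / n \<le> 1" using \<sigma>i by simp
  moreover have "0 \<le> real (\<sigma> i) / n" by simp
  ultimately show *: "?y \<in> {0<..1}" using 1 unfolding greaterThanAtMost_iff by linarith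
  show "block n ?y = \<sigma> (block n x)"
    using block_eq_iff[OF n *, of "\<sigma> i"] 1 by (simp add: i_def)
qed

lemma block_shift_range: "x \<in> {0..1} \<Longrightarrow> block_shift n \<sigma> x \<in> {0..1}"
  using block_shift_pos(1)[of x] by (cases "x = 0") (auto simp: block_shift_def)

lemma block_shift_measurable: "block_shift n \<sigma> \<in> borel_unit \<rightarrow>\<^sub>M borel_unit"
proof (rule measurable_restrict_space2)
  have b: "block n \<in> borel \<rightarrow>\<^sub>M count_space UNIV"
    unfolding block_def[abs_def] by measurable
  have "(\<lambda>x. real (\<sigma> (block n x)) - real (block n x)) \<in> borel_measurable borel"
    by (rule measurable_compose[OF b]) simp
  then have "block_shift n \<sigma> \<in> borel_measurable borel"
    unfolding block_shift_def[abs_def] by measurable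
  then show "block_shift n \<sigma> \<in> borel_unit \<rightarrow>\<^sub>M lborel"
    by (intro measurable_restrict_space1) simp
qed (use block_shift_range in auto)

text \<open>Up to the null set \<open>{0}\<close> the interval is a disjoint union of half-open
  pieces \<open>J i\<close>. On each piece the map is a translation onto
  \<open>J (\<sigma> i)\<close>, and the sum over the pieces is invariant under the
  permutation.\<close>

lemma block_shift_measure_preserving_borel: "measure_preserving borel_unit borel_unit (block_shift n \<sigma>)"
proof -
  define J where "J i = {real i / n<..(real i + 1) / n}" for i :: nat
  have J_block: "x \<in> J i \<longleftrightarrow> x \<in> {0<..1} \<and> block n x = i" if "i < n" for x i
  proof
    assume x: "x \<in> J i"
    have "(real i + 1) / n \<le> 1" using that by simp
    moreover have "0 \<le> real i / n" by simp
    ultimately have "x \<in> {0<..1}" using x unfolding J_def greaterThanAtMost_iff by linarith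
    then show "x \<in> {0<..1} \<and> block n x = i" using x block_eq_iff[OF n, of x i] by (auto simp: J_def)
  next
    assume "x \<in> {0<..1} \<and> block n x = i"
    then show "x \<in> J i" using block_eq_iff[OF n, of x i] by (auto simp: J_def)
  qed
  have split: "emeasure lborel A = (\<Sum>i<n. emeasure lborel (A \<inter> J i))" if A: "A \<in> sets borel" "A \<subseteq> {0..1}" for A
  proof -
    have "emeasure lborel A = emeasure lborel (A - {0})"
      using A(1) by (intro emeasure_eq_AE) (auto intro!: AE_I[where N = "{0}"])
    also have "A - {0} = (\<Union>i<n. A \<inter> J i)"
    proof -
      have "x \<in> J (block n x)" if "x \<in> A - {0}" for x
        using that A(2) J_block[of "block n x" x] block_less[OF n, of x] by (auto simp: less_le)
      moreover have "block n x < n" if "x \<in> A" for x using block_less[OF n] that A(2) by blast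
      ultimately show ?thesis using J_block by fastforce
    qed
    also have "emeasure lborel (\<Union>i<n. A \<inter> J i) = (\<Sum>i<n. emeasure lborel (A \<inter> J i))"
    proof (rule sum_emeasure[symmetric])
      show "disjoint_family_on (\<lambda>i. A \<inter> J i) {..<n}"
        unfolding disjoint_family_on_def using J_block by auto
    qed (use A in \<open>auto simp: J_def\<close>)
    finally show ?thesis .
  qed
  have "distr borel_unit borel_unit (block_shift n \<sigma>) = borel_unit"
  proof (rule measure_eqI)
    fix A assume "A \<in> sets (distr borel_unit borel_unit (block_shift n \<sigma>))"
    then have A: "A \<in> sets borel_unit" by simp
    then have A': "A \<in> sets borel" "A \<subseteq> {0..1}" by (auto simp: sets_restrict_space_iff)
    let ?B = "block_shift n \<sigma> -` A \<inter> {0..1}"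
    have "?B \<in> sets borel_unit" using measurable_sets[OF block_shift_measurable A] by simp
    then have B: "?B \<in> sets borel" "?B \<subseteq> {0..1}" by (auto simp: sets_restrict_space_iff)
    have piece: "emeasure lborel (?B \<inter> J i) = emeasure lborel (A \<inter> J (\<sigma> i))" if i: "i < n" for i
    proof -
      define c where "c = (real (\<sigma> i) - real i) / n"
      have \<sigma>i: "\<sigma> i < n" using permutes_in_image[OF \<sigma>, of i] i by simp
      have "?B \<inter> J i = (\<lambda>x. c + x) -` (A \<inter> J (\<sigma> i)) \<inter> space lborel"
      proof (rule set_eqI)
        fix x
        have shift: "c + x \<in> J (\<sigma> i) \<longleftrightarrow> x \<in> J i"
          unfolding J_def c_def by (auto simp: diff_divide_distrib add_divide_distrib)
        have "block_shift n \<sigma> x = c + x" if "x \<in> J i"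
          using that J_block[OF i, of x] by (simp add: block_shift_def c_def)
        moreover have "x \<in> {0..1}" if "x \<in> J i" using that J_block[OF i, of x] by simp
        ultimately show "x \<in> ?B \<inter> J i \<longleftrightarrow> x \<in> (\<lambda>x. c + x) -` (A \<inter> J (\<sigma> i)) \<inter> space lborel"
          using shift by auto
      qed
      moreover have "A \<inter> J (\<sigma> i) \<in> sets borel" using A' by (auto simp: J_def)
      ultimately show ?thesis
        using emeasure_distr[of "(+) c" lborel borel "A \<inter> J (\<sigma> i)"] lborel_distr_plus[of c] by simp
    qed
    have "emeasure (distr borel_unit borel_unit (block_shift n \<sigma>)) A = emeasure lborel ?B"
      using B by (subst emeasure_distr[OF block_shift_measurable A]) (simp add: emeasure_restrict_space)
    also have "\<dots> = (\<Sum>i<n. emeasure lborel (A \<inter> J (\<sigma> i)))"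
      unfolding split[OF B] by (intro sum.cong refl piece) simp
    also have "\<dots> = (\<Sum>i<n. emeasure lborel (A \<inter> J i))"
      by (rule sum.permute[OF \<sigma>, symmetric, unfolded comp_def])
    also have "\<dots> = emeasure borel_unit A"
      using A' by (simp add: split[OF A', symmetric] emeasure_restrict_space)
    finally show "emeasure (distr borel_unit borel_unit (block_shift n \<sigma>)) A = emeasure borel_unit A" .
  qed simp
  then show ?thesis using block_shift_measurable by (simp add: measure_preserving_def)
qed

lemma block_shift_measure_preserving: "measure_preserving unit_interval unit_interval (block_shift n \<sigma>)"
  unfolding unit_interval_eq_completion
  by (rule measure_preserving_completion[OF block_shift_measure_preserving_borel])

end

lemma block_shift_inverse:
  assumes n: "n > 0" and \<sigma>: "\<sigma> permutes {..<n}" and x: "x \<in> {0..1}"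
  shows "block_shift n (inv \<sigma>) (block_shift n \<sigma> x) = x"
proof (cases "x = 0")
  case False
  then have x': "x \<in> {0<..1}" using x by auto
  have "inv \<sigma> (\<sigma> (block n x)) = block n x" by (rule permutes_inverses(2)[OF \<sigma>])
  then show ?thesis
    using block_shift_pos[OF n \<sigma> x'] False
    by (simp add: block_shift_def[of n "inv \<sigma>"]) (simp add: block_shift_def diff_divide_distrib)
qed (simp add: block_shift_def)

lemma block_shift_relabelings:
  assumes n: "n > 0" and \<sigma>: "\<sigma> permutes {..<n}"
  shows "block_shift n \<sigma> \<in> relabelings"
proof -
  have \<sigma>': "inv \<sigma> permutes {..<n}" by (rule permutes_inv[OF \<sigma>])
  have inv: "block_shift n \<sigma> (block_shift n (inv \<sigma>) x) = x" if "x \<in> {0..1}" for x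
    using block_shift_inverse[OF n \<sigma>' that] permutes_inv_inv[OF \<sigma>] by simp
  have bij: "bij_betw (block_shift n \<sigma>) {0..1} {0..1}"
    by (rule bij_betw_byWitness[where f' = "block_shift n (inv \<sigma>)"])
       (use inv block_shift_inverse[OF n \<sigma>] block_shift_range[OF n \<sigma>] block_shift_range[OF n \<sigma>'] in auto)
  have "the_inv_into {0..1} (block_shift n \<sigma>) x = block_shift n (inv \<sigma>) x" if "x \<in> {0..1}" for x
    by (rule the_inv_into_f_eq) (use bij inv that block_shift_range[OF n \<sigma>'] in \<open>auto simp: bij_betw_def\<close>)
  then have "measure_preserving unit_interval unit_interval (the_inv_into {0..1} (block_shift n \<sigma>))"
    by (intro measure_preserving_cong[OF block_shift_measure_preserving[OF n \<sigma>']]) simp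
  then show ?thesis
    using bij block_shift_measure_preserving[OF n \<sigma>] by (simp add: relabelings_def)
qed

text \<open>\<open>cut_distance\<close> is an infimum of nonnegative numbers, so one relabelling at
  distance zero decides it. The \<open>L1_norm\<close> dominates the cut norm and ignores null
  sets.\<close>

lemma weakly_equivalentI:
  assumes f: "f \<in> graphons" and g: "g \<in> graphons" and \<psi>: "\<psi> \<in> relabelings"
    and L1: "L1_norm (\<lambda>p. f p - relabel g \<psi> p) = 0"
  shows "weakly_equivalent f g"
proof -
  have b: "(\<lambda>p. f p - relabel g \<psi> p) \<in> bounded_kernels" if "\<psi> \<in> relabelings" for \<psi>
    using that by (intro bounded_kernels_diff graphons_bounded f relabel_graphon g) (simp add: relabelings_def)
  have "cut_distance f g \<le> cut_norm (\<lambda>p. f p - relabel g \<psi> p)"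
    unfolding cut_distance_def using \<psi> cut_norm_nonneg[OF b]
    by (intro cINF_lower) (auto intro!: bdd_belowI2[where m = 0])
  also have "\<dots> \<le> 0" using cut_norm_le_L1[OF b[OF \<psi>]] L1 by simp
  finally have "cut_distance f g \<le> 0" .
  moreover have "0 \<le> cut_distance f g"
    unfolding cut_distance_def using \<psi> cut_norm_nonneg[OF b] by (intro cINF_greatest) auto
  ultimately show ?thesis by (simp add: weakly_equivalent_def)
qed

text \<open>The sides of the square on which a coordinate is 0 form a null set. On them
  \<open>block_shift\<close> need not carry blocks to blocks.\<close>

lemma L1_norm_null:
  assumes h: "h \<in> bounded_kernels" and h1: "\<And>p. p \<in> {0..1} \<times> {0..1} \<Longrightarrow> \<bar>h p\<bar> \<le> 1"
    and h0: "\<And>x y. x \<in> {0<..1} \<Longrightarrow> y \<in> {0<..1} \<Longrightarrow> h (x, y) = 0"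
  shows "L1_norm h = 0"
proof -
  have z: "(indicator {0} :: real \<Rightarrow> real) \<in> borel_measurable unit_interval"
    by (intro measurable_restrict_space1 measurable_completion) simp
  have z0: "(LINT x|unit_interval. indicator {0::real} x) = (0::real)"
  proof -
    have "(LINT x|unit_interval. indicator {0::real} x) = (LINT x|borel_unit. indicator {0::real} x :: real)"
      unfolding unit_interval_eq_completion by (intro integral_completion measurable_restrict_space1) simp
    also have "\<dots> = 0"
      by (subst integral_restrict_space) (auto simp: indicator_def intro!: integral_eq_zero_AE AE_I[where N = "{0}"])
    finally show ?thesis .
  qed
  have one: "(\<lambda>_. 1 :: real) \<in> borel_measurable unit_interval" by simp
  note I = integral_unit_square_mult[OF z one] integral_unit_square_mult[OF one z]
  have i: "integrable unit_square (\<lambda>(x, y). indicator {0} x * 1 :: real)" "integrable unit_square (\<lambda>(x, y). 1 * indicator {0} y :: real)"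
    by (rule I; simp add: indicator_def)+
  have "L1_norm h \<le> (LINT p|unit_square. (case p of (x, y) \<Rightarrow> indicator {0} x * 1) + (case p of (x, y) \<Rightarrow> 1 * indicator {0} y))"
    unfolding L1_norm_def
  proof (rule integral_mono[OF _ Bochner_Integration.integrable_add[OF i]])
    fix p assume p: "p \<in> space unit_square"
    from p show "\<bar>h p\<bar> \<le> (case p of (x, y) \<Rightarrow> indicator {0} x * 1) + (case p of (x, y) \<Rightarrow> 1 * indicator {0} y)"
      using h1[of p] h0[of "fst p" "snd p"] by (cases p) (auto simp: indicator_def less_le)
  next
    show "integrable unit_square (\<lambda>p. \<bar>h p\<bar>)" by (intro integrable_abs bounded_kernels_integrable h)
  qed
  also have "\<dots> = 0"
  proof -
    have "(LINT (x, y)|unit_square. indicator {0::real} x * (1::real)) = (LINT x|unit_interval. indicator {0} x) * (LINT y|unit_interval. 1)"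
      by (rule I(2)) (auto simp: indicator_def)
    then have "(LINT (x, y)|unit_square. indicator {0::real} x * 1) = (0::real)" unfolding z0 by simp
    moreover have "(LINT (x, y)|unit_square. (1::real) * indicator {0::real} y) = (LINT x|unit_interval. 1) * (LINT y|unit_interval. indicator {0} y)"
      by (rule I(4)) (auto simp: indicator_def)
    then have "(LINT (x, y)|unit_square. 1 * indicator {0::real} y) = (0::real)" unfolding z0 by simp
    ultimately show ?thesis using Bochner_Integration.integral_add[OF i] by simp
  qed
  finally show ?thesis using L1_norm_nonneg[of h] by simp
qed

lemma weakly_equivalent_step_permute:
  assumes n: "n > 0" and \<sigma>: "\<sigma> permutes {..<n}" and B: "B \<in> sym_matrices n"
  shows "weakly_equivalent (step n (\<lambda>i j. B (\<sigma> i) (\<sigma> j))) (step n B)"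
proof (rule weakly_equivalentI[OF _ _ block_shift_relabelings[OF n \<sigma>]])
  have B': "(\<lambda>i j. B (\<sigma> i) (\<sigma> j)) \<in> sym_matrices n"
    using B permutes_in_image[OF \<sigma>] by (simp add: sym_matrices_def)
  show f: "step n (\<lambda>i j. B (\<sigma> i) (\<sigma> j)) \<in> graphons" and g: "step n B \<in> graphons"
    using B B' by (auto intro: step_graphon n)
  have r: "relabel (step n B) (block_shift n \<sigma>) \<in> graphons"
    by (rule relabel_graphon[OF block_shift_measure_preserving[OF n \<sigma>] g])
  show "L1_norm (\<lambda>p. step n (\<lambda>i j. B (\<sigma> i) (\<sigma> j)) p - relabel (step n B) (block_shift n \<sigma>) p) = 0"
  proof (rule L1_norm_null)
    fix p :: "real \<times> real" assume "p \<in> {0..1} \<times> {0..1}"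
    from graphons_range[OF f this] graphons_range[OF r this]
    show "\<bar>step n (\<lambda>i j. B (\<sigma> i) (\<sigma> j)) p - relabel (step n B) (block_shift n \<sigma>) p\<bar> \<le> 1"
      by (auto simp: abs_if)
  next
    fix x y :: real assume "x \<in> {0<..1}" "y \<in> {0<..1}"
    then show "step n (\<lambda>i j. B (\<sigma> i) (\<sigma> j)) (x, y) - relabel (step n B) (block_shift n \<sigma>) (x, y) = 0"
      using block_shift_pos(2)[OF n \<sigma>] by (simp add: step_def relabel_def)
  qed (intro bounded_kernels_diff graphons_bounded f r)
qed

section \<open>Monomials in the matrix entries and their graphs\<close>

definition endpoints :: "(nat \<times> nat) list \<Rightarrow> nat set" where
  "endpoints xs = fst ` set xs \<union> snd ` set xs"

text \<open>The edges are the positions in the list, so a pair that occurs repeatedly gives parallel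
  edges.\<close>

definition graph_of :: "(nat \<times> nat) list \<Rightarrow> multigraph" where
  "graph_of xs = \<lparr>verts = endpoints xs, edges = {..<length xs}, src = \<lambda>e. fst (xs ! e), tgt = \<lambda>e. snd (xs ! e)\<rparr>"

lemma graph_of_multigraph:
  assumes "\<And>i j. (i, j) \<in> set xs \<Longrightarrow> i \<noteq> j"
  shows "graph_of xs \<in> multigraphs"
proof -
  have "fst (xs ! e) \<noteq> snd (xs ! e)" if "e < length xs" for e
    using assms[of "fst (xs ! e)" "snd (xs ! e)"] that by simp
  then have "is_multigraph (graph_of xs)"
    by (auto simp: is_multigraph_def graph_of_def endpoints_def)
  moreover have "no_isolated_vertices (graph_of xs)"
    unfolding no_isolated_vertices_def
  proof
    fix v assume "v \<in> verts (graph_of xs)"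
    then obtain p where "p \<in> set xs" "v = fst p \<or> v = snd p"
      by (auto simp: graph_of_def endpoints_def)
    moreover then obtain e where "e < length xs" "xs ! e = p" by (auto simp: in_set_conv_nth)
    ultimately show "\<exists>e\<in>edges (graph_of xs). v \<in> {src (graph_of xs) e, tgt (graph_of xs) e}"
      by (intro bexI[of _ e]) (auto simp: graph_of_def)
  qed
  ultimately show ?thesis by (simp add: multigraphs_def)
qed

definition mono_at :: "(nat \<times> nat) list \<Rightarrow> (nat \<Rightarrow> nat \<Rightarrow> real) \<Rightarrow> (nat \<Rightarrow> nat) \<Rightarrow> real" where
  "mono_at xs A \<tau> = eval_mono xs (\<lambda>(i, j). A (\<tau> i) (\<tau> j))"

text \<open>The argument is the pair of block number and matrix, which makes the averages functions
  on \<open>step_data\<close>, as \<open>lin_comb\<close> expects.\<close>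

definition mono_average :: "nat \<Rightarrow> (nat \<times> nat) list \<Rightarrow> nat \<times> (nat \<Rightarrow> nat \<Rightarrow> real) \<Rightarrow> real" where
  "mono_average n xs = (\<lambda>(m, A). (\<Sum>\<tau>\<in>{..<n} \<rightarrow>\<^sub>E {..<m}. mono_at xs A \<tau>) / real m ^ n)"

lemma in_endpoints: "(i, j) \<in> set xs \<Longrightarrow> i \<in> endpoints xs" "(i, j) \<in> set xs \<Longrightarrow> j \<in> endpoints xs"
  by (force simp: endpoints_def)+

lemma mono_at_restrict: "mono_at xs A (restrict \<tau> (endpoints xs)) = mono_at xs A \<tau>"
proof -
  have "map (\<lambda>(i, j). A (restrict \<tau> (endpoints xs) i) (restrict \<tau> (endpoints xs) j)) xs = map (\<lambda>(i, j). A (\<tau> i) (\<tau> j)) xs"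
    by (rule map_cong[OF refl]) (auto dest: in_endpoints)
  then show ?thesis unfolding mono_at_def eval_mono_def by (rule arg_cong)
qed

lemma finite_endpoints [simp]: "finite (endpoints xs)"
  by (simp add: endpoints_def)

text \<open>Positions that do not occur in the monomial are coloured freely and cancel against the
  normalisation. In particular the average does not depend on \<open>n\<close>.\<close>

lemma mono_average_eq:
  assumes m: "m > 0" and sub: "endpoints xs \<subseteq> {..<n}"
  shows "mono_average n xs (m, A) =
    (\<Sum>\<tau>\<in>endpoints xs \<rightarrow>\<^sub>E {..<m}. mono_at xs A \<tau>) / real m ^ card (endpoints xs)"
proof -
  have "card (endpoints xs) \<le> n" using card_mono[OF _ sub] by simp
  then have pow: "real m ^ n = real m ^ (n - card (endpoints xs)) * real m ^ card (endpoints xs)"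
    by (simp flip: power_add)
  have "(\<Sum>\<tau>\<in>{..<n} \<rightarrow>\<^sub>E {..<m}. mono_at xs A \<tau>) =
      (\<Sum>\<tau>\<in>{..<n} \<rightarrow>\<^sub>E {..<m}. mono_at xs A (restrict \<tau> (endpoints xs)))"
    by (simp only: mono_at_restrict)
  also have "\<dots> = real (card {..<m}) ^ (card {..<n} - card (endpoints xs)) * (\<Sum>\<tau>\<in>endpoints xs \<rightarrow>\<^sub>E {..<m}. mono_at xs A \<tau>)"
    using sum_PiE_restrict[of "{..<n}" "endpoints xs" "{..<m}" "mono_at xs A"] sub by simp
  finally show ?thesis using m by (simp add: mono_average_def pow)
qed

text \<open>Only colourings of the endpoints matter, and \<open>b\<close> transports these
  bijectively: the average is an invariant of the graph up to isomorphism.\<close>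

lemma mono_average_rename:
  assumes m: "m > 0" and sub: "endpoints xs \<subseteq> {..<n}" and b: "inj_on b (endpoints xs)"
    and sub': "b ` endpoints xs \<subseteq> {..<k}"
  shows "mono_average k (map (map_prod b b) xs) (m, A) = mono_average n xs (m, A)"
proof -
  let ?V = "endpoints xs" and ?ys = "map (map_prod b b) xs"
  have V': "endpoints ?ys = b ` ?V" by (auto simp: endpoints_def image_image image_Un)
  have "(\<Sum>\<tau>\<in>b ` ?V \<rightarrow>\<^sub>E {..<m}. mono_at ?ys A \<tau>) = (\<Sum>\<tau>\<in>?V \<rightarrow>\<^sub>E {..<m}. mono_at xs A \<tau>)"
  proof (rule sum.reindex_bij_witness[where i = "\<lambda>\<rho>. \<lambda>w\<in>b ` ?V. \<rho> (inv_into ?V b w)" and j = "\<lambda>\<rho>. \<lambda>v\<in>?V. \<rho> (b v)"])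
    fix \<rho> assume "\<rho> \<in> b ` ?V \<rightarrow>\<^sub>E {..<m}"
    then show "(\<lambda>w\<in>b ` ?V. (\<lambda>v\<in>?V. \<rho> (b v)) (inv_into ?V b w)) = \<rho>"
      using b by (auto simp: fun_eq_iff PiE_iff extensional_def f_inv_into_f inv_into_into)
    show "mono_at xs A (\<lambda>v\<in>?V. \<rho> (b v)) = mono_at ?ys A \<rho>"
      by (subst mono_at_restrict) (simp add: mono_at_def eval_mono_def comp_def case_prod_unfold)
  next
    fix \<rho> assume "\<rho> \<in> ?V \<rightarrow>\<^sub>E {..<m}"
    then show "(\<lambda>v\<in>?V. (\<lambda>w\<in>b ` ?V. \<rho> (inv_into ?V b w)) (b v)) = \<rho>"
      using b by (auto simp: fun_eq_iff PiE_iff extensional_def)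
    then show "(\<lambda>w\<in>b ` ?V. \<rho> (inv_into ?V b w)) \<in> b ` ?V \<rightarrow>\<^sub>E {..<m}"
      using \<open>\<rho> \<in> _\<close> by (auto simp: PiE_iff inv_into_into)
  qed (auto simp: PiE_iff)
  moreover have "card (b ` ?V) = card ?V" by (rule card_image[OF b])
  ultimately show ?thesis
    using mono_average_eq[OF m sub] mono_average_eq[OF m, of ?ys k] sub' V' by simp
qed

lemma hom_density_graph_of:
  assumes m: "m > 0" and xs: "\<And>i j. (i, j) \<in> set xs \<Longrightarrow> i \<noteq> j" and sub: "endpoints xs \<subseteq> {..<n}"
  shows "hom_density (graph_of xs) (step m A) = mono_average n xs (m, A)"
proof -
  have H: "is_multigraph (graph_of xs)" using graph_of_multigraph[OF xs] by (simp add: multigraphs_def)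
  have "mono_at xs A \<tau> = (\<Prod>e<length xs. A (\<tau> (fst (xs ! e))) (\<tau> (snd (xs ! e))))" for \<tau>
    by (simp add: mono_at_def eval_mono_def prod.list_conv_set_nth case_prod_unfold atLeast0LessThan)
  then show ?thesis
    unfolding hom_density_step[OF H m] mono_average_eq[OF m sub] by (simp add: graph_of_def)
qed

lemma card_endpoints: "card (endpoints xs) \<le> 2 * length xs"
proof -
  have "card (endpoints xs) \<le> card (fst ` set xs) + card (snd ` set xs)"
    unfolding endpoints_def by (rule card_Un_le)
  also have "\<dots> \<le> card (set xs) + card (set xs)" by (intro add_mono card_image_le) auto
  also have "\<dots> \<le> 2 * length xs" using card_length[of xs] by simp
  finally show ?thesis .
qed

text \<open>A graph without isolated vertices has at most twice as many vertices as edges. So this finite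
  set represents all graphs with at most \<open>N\<close> edges.\<close>

definition small_graphs :: "nat \<Rightarrow> (nat \<times> nat) list set" where
  "small_graphs N = {xs. set xs \<subseteq> {(i, j). i < 2 * N \<and> j < 2 * N \<and> i \<noteq> j} \<and> length xs \<le> N}"

lemma finite_small_graphs: "finite (small_graphs N)"
proof -
  have "finite {(i, j). i < 2 * N \<and> j < 2 * N \<and> i \<noteq> j}"
    by (rule finite_subset[of _ "{..<2 * N} \<times> {..<2 * N}"]) auto
  then show ?thesis unfolding small_graphs_def by (rule finite_lists_length_le)
qed

lemma small_graphs_endpoints:
  assumes "xs \<in> small_graphs N"
  shows "endpoints xs \<subseteq> {..<2 * N}" "\<And>i j. (i, j) \<in> set xs \<Longrightarrow> i \<noteq> j"
  using assms by (auto simp: small_graphs_def endpoints_def)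

text \<open>The endpoints, at most \<open>2 * N\<close> in number, are renumbered by an initial
  segment. Monomials on arbitrarily many blocks are thus represented in one finite set that does not
  depend on \<open>n\<close>.\<close>

lemma small_graphs_rename:
  assumes "length xs \<le> N" "\<And>i j. (i, j) \<in> set xs \<Longrightarrow> i \<noteq> j" "endpoints xs \<subseteq> {..<n}"
  obtains ys where "ys \<in> small_graphs N" "\<And>m A. m > 0 \<Longrightarrow> mono_average n xs (m, A) = mono_average (2 * N) ys (m, A)"
proof -
  obtain b where b: "bij_betw b (endpoints xs) {0..<card (endpoints xs)}"
    using ex_bij_betw_finite_nat[OF finite_endpoints] by blast
  then have inj: "inj_on b (endpoints xs)" and im: "b ` endpoints xs \<subseteq> {..<2 * N}"
    using card_endpoints[of xs] assms(1) by (auto simp: bij_betw_def)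
  have "b i < 2 * N \<and> b j < 2 * N \<and> b i \<noteq> b j" if "(i, j) \<in> set xs" for i j
  proof -
    have "i \<in> endpoints xs" "j \<in> endpoints xs" using that by (auto dest: in_endpoints)
    then show ?thesis using im inj assms(2)[OF that] by (auto dest: inj_onD)
  qed
  then have "map (map_prod b b) xs \<in> small_graphs N"
    using assms(1) by (auto simp: small_graphs_def)
  then show thesis
    by (rule that) (rule mono_average_rename[OF _ assms(3) inj im, symmetric])
qed

section \<open>Functionals with a vanishing derivative are combinations of densities\<close>

lemma gateaux_exists_le: "gateaux_exists F n f g \<Longrightarrow> k \<le> n \<Longrightarrow> gateaux_exists F k f g"
  by (induction n) (auto simp: le_Suc_eq)

lemma kernels_diff:
  assumes "f \<in> graphons" "g \<in> graphons"
  shows "(\<lambda>p. g p - f p) \<in> kernels"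
proof -
  have "\<bar>g p - f p\<bar> \<le> 1" if "p \<in> {0..1} \<times> {0..1}" for p
    using graphons_range[OF assms(1) that] graphons_range[OF assms(2) that] by auto
  then show ?thesis
    using assms[THEN graphons_measurable] graphons_symmetric[OF assms(1)] graphons_symmetric[OF assms(2)]
    by (auto simp: kernels_def intro!: exI[of _ 1])
qed

locale polynomial_class_function =
  fixes F :: "kernel \<Rightarrow> real" and N :: nat
  assumes class_function: "class_function F"
    and N_pos: "N > 0"
    and derivative: "\<And>f g. f \<in> graphons \<Longrightarrow> (\<And>i. i \<in> {1..N} \<Longrightarrow> g i \<in> Adm f) \<Longrightarrow>
      gateaux_exists F N f g \<and> gateaux F N f g = 0"
    and L1_continuous: "\<And>f e. f \<in> graphons \<Longrightarrow> e > 0 \<Longrightarrow>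
      \<exists>r>0. \<forall>g\<in>graphons. L1_norm (\<lambda>p. g p - f p) < r \<longrightarrow> \<bar>F g - F f\<bar> < e"
begin

text \<open>Inside the segment both signs of a small step are allowed, so the Gateaux derivatives
  with all directions equal to \<open>g\<close> are the ordinary derivatives of
  \<open>F (\<phi> l)\<close> in \<open>l\<close>, and the Taylor remainder of order
  \<open>N\<close> vanishes. The two endpoints follow from continuity.\<close>

lemma segment_polynomial:
  assumes f: "f \<in> graphons" and g: "g \<in> kernels" and fg: "(\<lambda>p. f p + g p) \<in> graphons"
  shows "\<exists>p. degree p < N \<and> (\<forall>l\<in>{0..1}. F (\<lambda>q. f q + l * g q) = poly p l)"
proof -
  define \<phi> where "\<phi> l = (\<lambda>p. f p + l * g p)" for l
  define D where "D k l = gateaux F k (\<phi> l) (\<lambda>_. g)" for k l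
  have one: "1 \<in> steps f g" using fg by (simp add: steps_def)
  have \<phi>: "\<phi> l \<in> graphons" if "l \<in> {0..1}" for l
    using steps_scale[OF f one, of l] that by (simp add: steps_def \<phi>_def)
  have \<phi>_add: "(\<lambda>p. \<phi> l p + h * g p) = \<phi> (l + h)" for l h
    by (auto simp: \<phi>_def algebra_simps)
  have adm: "g \<in> Adm (\<phi> l)" if "0 \<le> l" "l < 1" for l
  proof -
    have "\<forall>\<^sub>F e in at_right 0. (\<lambda>p. \<phi> l p + e * g p) \<in> graphons"
      unfolding eventually_at_right_field \<phi>_add using that by (intro exI[of _ "1 - l"]) (auto intro!: \<phi>)
    then show ?thesis using g by (simp add: Adm_def)
  qed
  have deriv: "DERIV (D k) l :> D (Suc k) l" if l: "0 < l" "l < 1" and k: "k < N" for k l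
  proof -
    have "gateaux_exists F N (\<phi> l) (\<lambda>_. g)"
      using derivative[OF \<phi>, of l "\<lambda>_. g"] adm[of l] l by auto
    then have "gateaux_exists F (Suc k) (\<phi> l) (\<lambda>_. g)"
      by (rule gateaux_exists_le) (use k in simp)
    then obtain d where d: "((\<lambda>h. (D k (l + h) - D k l) / h) \<longlongrightarrow> d) (at 0 within steps (\<phi> l) g)"
      by (auto simp: \<phi>_add D_def)
    have at: "at 0 within steps (\<phi> l) g = at 0"
    proof (rule at_within_interior)
      have "{- min l (1 - l)<..<min l (1 - l)} \<subseteq> steps (\<phi> l) g"
        unfolding steps_def \<phi>_add by (auto intro!: \<phi>)
      then show "0 \<in> interior (steps (\<phi> l) g)"
        by (rule interiorI[rotated 2]) (use l in auto)
    qed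
    have "D (Suc k) l = d"
      using tendsto_Lim[OF _ d] by (simp add: D_def \<phi>_add at)
    then show ?thesis using d by (simp add: DERIV_def at)
  qed
  have D_N: "D N l = 0" if "0 < l" "l < 1" for l
    using derivative[OF \<phi>, of l "\<lambda>_. g"] adm[of l] that by (auto simp: D_def)
  \<comment> \<open>The expansion is about the midpoint, since at an endpoint of the segment only
    one-sided steps may be available.\<close>
  define p where "p = (\<Sum>k<N. smult (D k (1 / 2) / fact k) ([:- 1 / 2, 1:] ^ k))"
  have "degree p < N"
    unfolding p_def
  proof (rule degree_sum_less)
    fix k assume "k \<in> {..<N}"
    have "degree ([:- 1 / 2, 1::real:] ^ k) \<le> degree [:- 1 / 2, 1::real:] * k" by (rule degree_power_le)
    then have "degree ([:- 1 / 2, 1::real:] ^ k) \<le> k" by simp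
    then show "degree (smult (D k (1 / 2) / fact k) ([:- 1 / 2, 1:] ^ k)) < N"
      using \<open>k \<in> {..<N}\<close> by (auto intro: le_less_trans[OF order.trans[OF degree_smult_le]])
  qed (use N_pos in simp)
  have poly_p: "poly p l = (\<Sum>k<N. D k (1 / 2) / fact k * (l - 1 / 2) ^ k)" for l
    by (simp add: p_def poly_sum poly_power)
  have interior: "F (\<phi> l) - poly p l = 0" if l: "l \<in> {0<..<1}" for l
  proof (cases "l = 1 / 2")
    case True
    have "poly p l = (\<Sum>k\<in>{0}. D k (1 / 2) / fact k * (l - 1 / 2) ^ k)"
      unfolding poly_p True using N_pos by (intro sum.mono_neutral_right) auto
    then show ?thesis by (simp add: D_def True)
  next
    case False
    have "\<exists>t. (if l < 1 / 2 then l < t \<and> t < 1 / 2 else 1 / 2 < t \<and> t < l) \<and>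
        D 0 l = (\<Sum>k<N. D k (1 / 2) / fact k * (l - 1 / 2) ^ k) + D N t / fact N * (l - 1 / 2) ^ N"
      by (rule Taylor[where a = "min l (1 / 2)" and b = "max l (1 / 2)"])
         (use N_pos False l in \<open>auto intro!: deriv\<close>)
    then obtain t where t: "if l < 1 / 2 then l < t \<and> t < 1 / 2 else 1 / 2 < t \<and> t < l"
      and eq: "D 0 l = (\<Sum>k<N. D k (1 / 2) / fact k * (l - 1 / 2) ^ k) + D N t / fact N * (l - 1 / 2) ^ N"
      by blast
    have "0 < t" "t < 1" using t l by (auto split: if_splits)
    then show ?thesis using eq D_N[of t] by (simp add: D_def poly_p)
  qed
  have "continuous_on {0..1} (\<lambda>l. F (\<phi> l))"
    unfolding continuous_on_iff
  proof (intro ballI allI impI)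
    fix l e :: real assume l: "l \<in> {0..1}" and e: "e > 0"
    obtain r where r: "r > 0" "\<And>h. h \<in> graphons \<Longrightarrow> L1_norm (\<lambda>p. h p - \<phi> l p) < r \<Longrightarrow> \<bar>F h - F (\<phi> l)\<bar> < e"
      using L1_continuous[OF \<phi>[OF l] e] by blast
    have L1: "L1_norm (\<lambda>p. \<phi> l' p - \<phi> l p) = \<bar>l' - l\<bar> * L1_norm g" for l'
    proof -
      have "\<phi> l' p - \<phi> l p = (l' - l) * g p" for p by (simp add: \<phi>_def left_diff_distrib)
      then show ?thesis by (simp add: L1_norm_def abs_mult)
    qed
    show "\<exists>d>0. \<forall>l'\<in>{0..1}. dist l' l < d \<longrightarrow> dist (F (\<phi> l')) (F (\<phi> l)) < e"
    proof (intro exI[of _ "r / (L1_norm g + 1)"] conjI ballI impI)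
      show "0 < r / (L1_norm g + 1)" using r(1) L1_norm_nonneg[of g] by (intro divide_pos_pos) auto
      fix l' assume l': "l' \<in> {0..1}" "dist l' l < r / (L1_norm g + 1)"
      have "\<bar>l' - l\<bar> * L1_norm g \<le> \<bar>l' - l\<bar> * (L1_norm g + 1)" by (intro mult_left_mono) auto
      also have "\<dots> < r" using l'(2) L1_norm_nonneg[of g] by (simp add: dist_real_def pos_less_divide_eq)
      finally show "dist (F (\<phi> l')) (F (\<phi> l)) < e"
        using r(2)[OF \<phi>[OF l'(1)]] by (simp add: L1 dist_real_def)
    qed
  qed
  then have cont: "continuous_on (closure {0<..<1}) (\<lambda>l. F (\<phi> l) - poly p l)"
    by (intro continuous_intros) simp
  have "F (\<phi> l) - poly p l = 0" if "l \<in> {0..1}" for l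
    using continuous_constant_on_closure[OF cont interior, of l] that by simp
  with \<open>degree p < N\<close> show ?thesis by (intro exI[of _ p]) (auto simp: \<phi>_def)
qed

text \<open>Continuity bounds \<open>F\<close> near the zero graphon \<open>z\<close>. On the ray
  from \<open>z\<close> through \<open>f\<close> it is a polynomial of degree less than
  \<open>N\<close>, hence determined by its values at nodes below \<open>r\<close>, where that bound
  applies. Interpolation extrapolates to \<open>l = 1\<close> with weights that do not depend on
  \<open>f\<close>.\<close>

lemma bounded: "\<exists>B. \<forall>f\<in>graphons. \<bar>F f\<bar> \<le> B"
proof -
  define z :: kernel where "z = (\<lambda>_. 0)"
  have z: "z \<in> graphons" unfolding z_def by (rule const_graphon) simp
  obtain r where r: "r > 0" "\<And>h. h \<in> graphons \<Longrightarrow> L1_norm (\<lambda>p. h p - z p) < r \<Longrightarrow> \<bar>F h - F z\<bar> < 1"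
    using L1_continuous[OF z, of 1] by auto
  obtain T where T: "finite T" "card T = N" "T \<subseteq> {0<..<min r 1}"
    using infinite_arbitrarily_large[of "{0<..<min r 1}" N] infinite_Ioo[of 0 "min r 1"] r(1) by auto
  obtain W :: "real \<Rightarrow> real poly" where W: "\<And>p x. degree p < N \<Longrightarrow> poly p x = (\<Sum>a\<in>T. poly p a * poly (W a) x)"
    using lagrange_interpolation[OF T(1)] T(2) by metis
  have "\<bar>F f\<bar> \<le> (\<Sum>a\<in>T. (\<bar>F z\<bar> + 1) * \<bar>poly (W a) 1\<bar>)" if f: "f \<in> graphons" for f
  proof -
    have "(\<lambda>p. z p + f p) \<in> graphons" using f by (simp add: z_def)
    then obtain p where p: "degree p < N" "\<And>l. l \<in> {0..1} \<Longrightarrow> F (\<lambda>q. z q + l * f q) = poly p l"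
      using segment_polynomial[OF z, of f] f graphons_subset_kernels by blast
    have "\<bar>poly p a\<bar> \<le> \<bar>F z\<bar> + 1" if a: "a \<in> T" for a
    proof -
      have a': "0 < a" "a < r" "a < 1" using a T(3) by auto
      have g: "(\<lambda>q. z q + a * f q) \<in> graphons"
        using graphons_convex[OF z f, of a] a' by (simp add: z_def)
      have "L1_norm (\<lambda>p. (z p + a * f p) - z p) \<le> a"
      proof (rule L1_norm_le)
        fix q :: "real \<times> real" assume "q \<in> {0..1} \<times> {0..1}"
        then have "\<bar>f q\<bar> \<le> 1" by (rule graphons_abs_le_1[OF f])
        then show "\<bar>z q + a * f q - z q\<bar> \<le> a" using a' by (simp add: abs_mult mult_left_le)
      qed (intro bounded_kernels_diff graphons_bounded g z)
      then have "\<bar>F (\<lambda>q. z q + a * f q) - F z\<bar> < 1" using r(2)[OF g] a' by simp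
      then show ?thesis using p(2)[of a] a' by auto
    qed
    then have "\<bar>\<Sum>a\<in>T. poly p a * poly (W a) 1\<bar> \<le> (\<Sum>a\<in>T. (\<bar>F z\<bar> + 1) * \<bar>poly (W a) 1\<bar>)"
      by (intro order.trans[OF sum_abs] sum_mono) (auto simp: abs_mult intro!: mult_right_mono)
    moreover have "F f = poly p 1" using p(2)[of 1] by (simp add: z_def)
    ultimately show ?thesis using W[OF p(1), of 1] by simp
  qed
  then show ?thesis by blast
qed

end

section \<open>Step graphons with randomly coloured blocks\<close>

definition matrix_of :: "nat \<Rightarrow> (nat \<times> nat \<Rightarrow> real) \<Rightarrow> nat \<Rightarrow> nat \<Rightarrow> real" where
  "matrix_of n A i j = (if i < j \<and> j < n then A (i, j) else if j < i \<and> i < n then A (j, i) else 0)"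

definition pairs :: "nat \<Rightarrow> (nat \<times> nat) set" where
  "pairs n = {(i, j). i < j \<and> j < n}"

lemma finite_pairs: "finite (pairs n)"
  by (rule finite_subset[of _ "{..<n} \<times> {..<n}"]) (auto simp: pairs_def)

lemma matrix_of_sym: "A \<in> cube (pairs n) \<Longrightarrow> matrix_of n A \<in> sym_matrices n"
  by (auto simp: sym_matrices_def matrix_of_def cube_def pairs_def)

text \<open>Only entries above the diagonal are variables, so the coordinates are independent.
  \<open>matrix_of\<close> is linear in them and turns segments in the cube into segments of
  graphons.\<close>

lemma (in polynomial_class_function) step_polynomial:
  assumes n: "n > 0"
  obtains L where "\<And>c xs. (c, xs) \<in> set L \<Longrightarrow> set xs \<subseteq> pairs n \<and> length xs < N"
    "\<And>A. A \<in> cube (pairs n) \<Longrightarrow> F (step n (matrix_of n A)) = eval_mpoly L A"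
proof (rule polynomial_of_segments[OF finite_pairs N_pos])
  fix A B :: "nat \<times> nat \<Rightarrow> real" assume AB: "A \<in> cube (pairs n)" "B \<in> cube (pairs n)"
  let ?a = "step n (matrix_of n A)" and ?b = "step n (matrix_of n B)"
  have g: "?a \<in> graphons" "?b \<in> graphons" using AB by (auto intro: step_graphon n matrix_of_sym)
  obtain p where p: "degree p < N" "\<And>l. l \<in> {0..1} \<Longrightarrow> F (\<lambda>q. ?a q + l * (?b q - ?a q)) = poly p l"
    using segment_polynomial[OF g(1) kernels_diff[OF g]] g(2) by auto
  have "step n (matrix_of n (\<lambda>e. A e + l * (B e - A e))) = (\<lambda>q. ?a q + l * (?b q - ?a q))" for l
    by (auto simp: step_def matrix_of_def fun_eq_iff)
  with p show "\<exists>p. degree p < N \<and> (\<forall>l\<in>{0..1}. F (step n (matrix_of n (\<lambda>e. A e + l * (B e - A e)))) = poly p l)"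
    by auto
next
  fix A B :: "nat \<times> nat \<Rightarrow> real" assume "\<And>e. e \<in> pairs n \<Longrightarrow> A e = B e"
  then have "matrix_of n A = matrix_of n B"
    by (auto simp: matrix_of_def pairs_def fun_eq_iff)
  then show "F (step n (matrix_of n A)) = F (step n (matrix_of n B))" by simp
qed (use that in blast)

text \<open>The diagonal is set to zero, so that the averages of monomials over \<open>\<tau>\<close> are densities of loopless
  graphs; in the \<open>L\<^sup>1\<close> norm this costs at most \<open>1 / n\<close>.\<close>

definition sample :: "nat \<Rightarrow> (nat \<Rightarrow> nat \<Rightarrow> real) \<Rightarrow> (nat \<Rightarrow> nat) \<Rightarrow> kernel" where
  "sample n A \<tau> = step n (matrix_of n (\<lambda>(i, j). A (\<tau> i) (\<tau> j)))"

definition sample_average :: "(kernel \<Rightarrow> real) \<Rightarrow> nat \<Rightarrow> nat \<times> (nat \<Rightarrow> nat \<Rightarrow> real) \<Rightarrow> real" where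
  "sample_average F n = (\<lambda>(m, A). (\<Sum>\<tau>\<in>{..<n} \<rightarrow>\<^sub>E {..<m}. F (sample n A \<tau>)) / real m ^ n)"

definition step_data :: "(nat \<times> (nat \<Rightarrow> nat \<Rightarrow> real)) set" where
  "step_data = {(m, A). m > 0 \<and> A \<in> sym_matrices m}"

lemma sample_cube:
  assumes "A \<in> sym_matrices m" "\<And>i. i < n \<Longrightarrow> \<tau> i < m"
  shows "(\<lambda>(i, j). A (\<tau> i) (\<tau> j)) \<in> cube (pairs n)"
  using assms by (auto simp: cube_def pairs_def sym_matrices_def)

text \<open>The coefficients depend on \<open>n\<close>, but the spanning family does not: every
  monomial has length less than \<open>N\<close> and is averaged to a function indexed by
  \<open>small_graphs N\<close>. This uniformity is what survives the limit in
  \<open>n\<close>.\<close>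

lemma (in polynomial_class_function) sample_average_lin_comb:
  assumes n: "n > 0"
  shows "lin_comb (small_graphs N) (mono_average (2 * N)) step_data (sample_average F n)"
proof -
  obtain L where L: "\<And>c xs. (c, xs) \<in> set L \<Longrightarrow> set xs \<subseteq> pairs n \<and> length xs < N"
    "\<And>A. A \<in> cube (pairs n) \<Longrightarrow> F (step n (matrix_of n A)) = eval_mpoly L A"
    using step_polynomial[OF n] by blast
  have "lin_comb (small_graphs N) (mono_average (2 * N)) step_data (\<lambda>x. \<Sum>(c, xs)\<leftarrow>M. c * mono_average n xs x)"
    if "set M \<subseteq> set L" for M
    using that
  proof (induction M)
    case Nil
    then show ?case by (simp add: lin_comb_zero)
  next
    case (Cons y M)
    obtain c xs where y: "y = (c, xs)" by (cases y)
    have xs: "set xs \<subseteq> pairs n" "length xs \<le> N" using L(1)[of c xs] Cons.prems y by auto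
    obtain ys where ys: "ys \<in> small_graphs N" "\<And>m A. m > 0 \<Longrightarrow> mono_average n xs (m, A) = mono_average (2 * N) ys (m, A)"
      by (rule small_graphs_rename[OF xs(2), of n]) (use xs(1) in \<open>auto simp: pairs_def endpoints_def\<close>)
    have "lin_comb (small_graphs N) (mono_average (2 * N)) step_data
        (\<lambda>x. c * mono_average n xs x + (\<Sum>(c, xs)\<leftarrow>M. c * mono_average n xs x))"
      by (rule lin_comb_add_scaled[OF finite_small_graphs ys(1) Cons.IH])
         (use ys(2) Cons.prems in \<open>auto simp: step_data_def\<close>)
    then show ?case by (simp add: y)
  qed
  from this[of L] obtain d where d: "\<And>x. x \<in> step_data \<Longrightarrow>
      (\<Sum>(c, xs)\<leftarrow>L. c * mono_average n xs x) = (\<Sum>i\<in>small_graphs N. d i * mono_average (2 * N) i x)"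
    unfolding lin_comb_def by blast
  have "sample_average F n x = (\<Sum>(c, xs)\<leftarrow>L. c * mono_average n xs x)" if "x \<in> step_data" for x
  proof -
    obtain m A where x: "x = (m, A)" "m > 0" "A \<in> sym_matrices m"
      using \<open>x \<in> step_data\<close> by (auto simp: step_data_def)
    have "(\<Sum>\<tau>\<in>{..<n} \<rightarrow>\<^sub>E {..<m}. F (sample n A \<tau>)) =
        (\<Sum>\<tau>\<in>{..<n} \<rightarrow>\<^sub>E {..<m}. \<Sum>(c, xs)\<leftarrow>L. c * mono_at xs A \<tau>)"
    proof (rule sum.cong[OF refl])
      fix \<tau> assume "\<tau> \<in> {..<n} \<rightarrow>\<^sub>E {..<m}"
      then have "(\<lambda>(i, j). A (\<tau> i) (\<tau> j)) \<in> cube (pairs n)"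
        by (intro sample_cube[OF x(3)]) auto
      from L(2)[OF this] show "F (sample n A \<tau>) = (\<Sum>(c, xs)\<leftarrow>L. c * mono_at xs A \<tau>)"
        by (simp add: sample_def eval_mpoly_def mono_at_def)
    qed
    also have "\<dots> = (\<Sum>(c, xs)\<leftarrow>L. c * (\<Sum>\<tau>\<in>{..<n} \<rightarrow>\<^sub>E {..<m}. mono_at xs A \<tau>))"
      by (induction L) (auto simp: sum.distrib sum_distrib_left)
    finally have "sample_average F n x = (\<Sum>(c, xs)\<leftarrow>L. c * (\<Sum>\<tau>\<in>{..<n} \<rightarrow>\<^sub>E {..<m}. mono_at xs A \<tau>)) / real m ^ n"
      by (simp add: sample_average_def x)
    also have "\<dots> = (\<Sum>(c, xs)\<leftarrow>L. c * mono_average n xs x)"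
      by (induction L) (auto simp: mono_average_def x add_divide_distrib)
    finally show ?thesis .
  qed
  then show ?thesis unfolding lin_comb_def using d by (intro exI[of _ d]) simp
qed

lemma block_div:
  assumes m: "m > 0" and q: "q > 0" and x: "x \<in> {0..1}"
  shows "block m x = block (m * q) x div q"
proof (cases "x = 0")
  case False
  then have x': "x \<in> {0<..1}" using x by auto
  define i where "i = block (m * q) x"
  define a where "a = i div q"
  have i: "real i / real (m * q) < x" "x \<le> (real i + 1) / real (m * q)"
    using block_eq_iff[of "m * q" x i] m q x' by (auto simp: i_def)
  have "a * q \<le> i" "i + 1 \<le> (a + 1) * q"
    using q dividend_less_div_times[of q i] by (auto simp: a_def)
  then have "real a * real q \<le> real i" "real i + 1 \<le> (real a + 1) * real q"
    by (metis of_nat_le_iff of_nat_mult, metis of_nat_1 of_nat_add of_nat_le_iff of_nat_mult)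
  then have "real a / m \<le> real i / real (m * q)" "(real i + 1) / real (m * q) \<le> (real a + 1) / m"
    using m q by (auto simp: divide_simps mult_ac)
  then have "block m x = a" using block_eq_iff[OF m x', of a] i by linarith
  then show ?thesis by (simp add: a_def i_def)
qed simp

text \<open>On \<open>n\<close> blocks, \<open>step m A\<close> is the pattern of the balanced
  colouring \<open>i div q\<close>. After a permutation that matches \<open>\<tau>\<close> to it
  outside a set \<open>Z\<close>, the matrices differ only in rows and columns indexed by
  \<open>Z\<close> and on the diagonal: at most \<open>2 * n * card Z + n\<close> of the
  \<open>n ^ 2\<close> entries.\<close>

lemma sample_close:
  assumes A: "A \<in> sym_matrices m" and m: "m > 0" and q: "q > 0" and n: "n = m * q"
    and \<tau>: "\<And>i. i < n \<Longrightarrow> \<tau> i < m"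
  obtains \<sigma> where "\<sigma> permutes {..<n}"
    "L1_norm (\<lambda>p. step n (\<lambda>i j. matrix_of n (\<lambda>(i, j). A (\<tau> i) (\<tau> j)) (\<sigma> i) (\<sigma> j)) p - step m A p) \<le>
      (2 * (\<Sum>a<m. \<bar>real (card {i \<in> {..<n}. \<tau> i = a}) - n / m\<bar>) + 1) / n"
proof -
  have npos: "n > 0" using n m q by simp
  define \<rho> where "\<rho> i = i div q" for i
  have \<rho>: "\<rho> i < m" if "i < n" for i
    using that q by (simp add: \<rho>_def n less_mult_imp_div_less)
  have card_\<rho>: "card {i \<in> {..<n}. \<rho> i = a} = q" if "a < m" for a
  proof -
    have "{i \<in> {..<n}. \<rho> i = a} = {a * q..<(a + 1) * q}"
    proof (rule set_eqI)
      fix i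
      have "(a + 1) * q \<le> n" using that unfolding n by (intro mult_right_mono) auto
      moreover have "i div q = a \<longleftrightarrow> a * q \<le> i \<and> i < (a + 1) * q"
        using q by (metis Suc_eq_plus1 div_nat_eqI dividend_less_div_times mult.commute times_div_less_eq_dividend mult_Suc add.commute)
      ultimately show "i \<in> {i \<in> {..<n}. \<rho> i = a} \<longleftrightarrow> i \<in> {a * q..<(a + 1) * q}"
        by (auto simp: \<rho>_def)
    qed
    then show ?thesis by simp
  qed
  have q_eq: "real q = n / m" using n m by simp
  obtain \<sigma> where \<sigma>: "\<sigma> permutes {..<n}"
    and bad0: "real (card {i \<in> {..<n}. \<tau> (\<sigma> i) \<noteq> \<rho> i}) \<le>
      (\<Sum>a<m. \<bar>real (card {i \<in> {..<n}. \<tau> i = a}) - real (card {i \<in> {..<n}. \<rho> i = a})\<bar>)"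
    by (rule permutation_matching_colours[of n \<tau> m \<rho>]) (use \<tau> \<rho> in auto)
  define Z where "Z = {i \<in> {..<n}. \<tau> (\<sigma> i) \<noteq> \<rho> i}"
  have finZ: "finite Z" unfolding Z_def by (rule finite_subset[of _ "{..<n}"]) auto
  have bad: "real (card Z) \<le> (\<Sum>a<m. \<bar>real (card {i \<in> {..<n}. \<tau> i = a}) - n / m\<bar>)"
    using bad0 unfolding Z_def by (rule order.trans) (rule sum_mono, subst card_\<rho>, auto simp: q_eq)
  define D where "D i j = matrix_of n (\<lambda>(i, j). A (\<tau> i) (\<tau> j)) (\<sigma> i) (\<sigma> j) - A (\<rho> i) (\<rho> j)" for i j
  have \<sigma>n: "\<sigma> i < n" if "i < n" for i using permutes_in_image[OF \<sigma>, of i] that by simp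
  have Ar: "0 \<le> A a b \<and> A a b \<le> 1" "A a b = A b a" if "a < m" "b < m" for a b
    using A that by (auto simp: sym_matrices_def)
  have M: "matrix_of n (\<lambda>(i, j). A (\<tau> i) (\<tau> j)) \<in> sym_matrices n"
    by (rule matrix_of_sym[OF sample_cube[OF A \<tau>]])
  have D1: "\<bar>D i j\<bar> \<le> 1" if "i < n" "j < n" for i j
  proof -
    have "0 \<le> matrix_of n (\<lambda>(i, j). A (\<tau> i) (\<tau> j)) (\<sigma> i) (\<sigma> j) \<and> matrix_of n (\<lambda>(i, j). A (\<tau> i) (\<tau> j)) (\<sigma> i) (\<sigma> j) \<le> 1"
      using M \<sigma>n that by (simp add: sym_matrices_def)
    then show ?thesis using Ar(1)[OF \<rho> \<rho>, of i j] that unfolding D_def by auto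
  qed
  have D0: "D i j = 0" if "i < n" "j < n" "i \<notin> Z" "j \<notin> Z" "i \<noteq> j" for i j
  proof -
    have "\<sigma> i \<noteq> \<sigma> j" using permutes_inj[OF \<sigma>] that(5) by (auto dest: injD)
    moreover have "\<tau> (\<sigma> i) = \<rho> i" "\<tau> (\<sigma> j) = \<rho> j" using that by (auto simp: Z_def)
    ultimately show ?thesis
      using \<sigma>n[OF that(1)] \<sigma>n[OF that(2)] Ar(2)[OF \<rho>[OF that(1)] \<rho>[OF that(2)]]
      by (auto simp: D_def matrix_of_def)
  qed
  have "(\<Sum>i<n. \<Sum>j<n. \<bar>D i j\<bar>) \<le> (\<Sum>i<n. \<Sum>j<n. of_bool (i \<in> Z) + of_bool (j \<in> Z) + of_bool (i = j))"
  proof (intro sum_mono)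
    fix i j assume "i \<in> {..<n}" "j \<in> {..<n}"
    then show "\<bar>D i j\<bar> \<le> of_bool (i \<in> Z) + of_bool (j \<in> Z) + of_bool (i = j)"
      using D1[of i j] D0[of i j] by (cases "i \<in> Z"; cases "j \<in> Z"; cases "i = j") auto
  qed
  also have "\<dots> = n * real (card Z) + n * real (card Z) + n"
  proof -
    have "(\<Sum>i<n. of_bool (i \<in> Z)) = real (card Z)"
    proof -
      have "Z \<subseteq> {..<n}" by (auto simp: Z_def)
      then show ?thesis by (simp add: of_bool_def sum.If_cases Int_absorb1)
    qed
    moreover have "(\<Sum>j<n. of_bool (i = j) :: real) = 1" if "i < n" for i
      using that by (simp add: of_bool_def)
    ultimately show ?thesis by (simp add: sum.distrib flip: sum_distrib_left)
  qed
  finally have sumD: "(\<Sum>i<n. \<Sum>j<n. \<bar>D i j\<bar>) \<le> n * (2 * real (card Z) + 1)" by (simp add: algebra_simps)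
  have "L1_norm (\<lambda>p. step n (\<lambda>i j. matrix_of n (\<lambda>(i, j). A (\<tau> i) (\<tau> j)) (\<sigma> i) (\<sigma> j)) p - step m A p) = L1_norm (step n D)"
    unfolding L1_norm_def
    by (rule Bochner_Integration.integral_cong[OF refl])
       (auto simp: step_def D_def \<rho>_def n block_div[OF m q])
  also have "\<dots> \<le> n * (2 * real (card Z) + 1) / n ^ 2"
    unfolding L1_norm_step[OF npos] using sumD by (intro divide_right_mono) auto
  also have "\<dots> = (2 * real (card Z) + 1) / n" using npos by (simp add: power2_eq_square)
  also have "\<dots> \<le> (2 * (\<Sum>a<m. \<bar>real (card {i \<in> {..<n}. \<tau> i = a}) - n / m\<bar>) + 1) / n"
    using bad by (intro divide_right_mono) auto
  finally show thesis using \<sigma> by (rule that[rotated])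
qed

text \<open>\<open>sample_close\<close> treats nearly balanced colourings, Chebyshev's inequality
  and the bound for \<open>F\<close> the others. With \<open>fact k\<close> blocks every
  \<open>m\<close> eventually divides the number of blocks, so one sequence serves all step
  graphons.\<close>

lemma (in polynomial_class_function) sample_average_tendsto:
  assumes m: "m > 0" and A: "A \<in> sym_matrices m"
  shows "(\<lambda>k. sample_average F (fact k) (m, A)) \<longlonglongrightarrow> F (step m A)"
proof (rule LIMSEQ_I)
  fix e :: real assume e: "e > 0"
  let ?f = "step m A"
  have f: "?f \<in> graphons" by (rule step_graphon[OF m A])
  obtain B where B: "\<And>h. h \<in> graphons \<Longrightarrow> \<bar>F h\<bar> \<le> B" using bounded by blast
  have B0: "B \<ge> 0" using B[OF f] by auto
  obtain r where r: "r > 0" "\<And>h. h \<in> graphons \<Longrightarrow> L1_norm (\<lambda>p. h p - ?f p) < r \<Longrightarrow> \<bar>F h - F ?f\<bar> < e / 2"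
    using L1_continuous[OF f, of "e / 2"] e by auto
  \<comment> \<open>If every class size deviates by at most \<open>d * n\<close>, the
    \<open>m\<close> classes contribute at most \<open>2 * m * d = r / 2\<close> to the distance,
    leaving \<open>r / 2\<close> for the diagonal.\<close>
  define d where "d = r / (4 * m)"
  have d: "d > 0" using r(1) m by (simp add: d_def)
  \<comment> \<open>The first bound gives \<open>1 / n < r / 2\<close>, the second makes the
    Chebyshev term less than \<open>e / 2\<close>, and the summand \<open>m\<close> ensures that
    \<open>m\<close> divides \<open>fact k\<close>.\<close>
  define n0 where "n0 = nat \<lceil>max (2 / r) (4 * B * m / (d\<^sup>2 * e))\<rceil> + m + 1"
  show "\<exists>k0. \<forall>k\<ge>k0. norm (sample_average F (fact k) (m, A) - F ?f) < e"
  proof (intro exI[of _ n0] allI impI)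
    fix k assume k: "k \<ge> n0"
    define n where "n = (fact k :: nat)"
    have "k \<le> n" unfolding n_def by (rule fact_ge_self)
    then have "real n > max (2 / r) (4 * B * m / (d\<^sup>2 * e))"
      using k unfolding n0_def by linarith
    then have n1: "1 / real n < r / 2" and n2: "4 * B * m / (d\<^sup>2 * e) < n"
      using r(1) \<open>k \<le> n\<close> k by (auto simp: field_simps n0_def)
    have "m \<le> k" using k by (simp add: n0_def)
    then have "m dvd n" unfolding n_def using m by (intro dvd_fact) auto
    then obtain q where q: "n = m * q" by blast
    have npos: "n > 0" by (simp add: n_def)
    then have qpos: "q > 0" using q by auto
    define X where "X \<tau> = (\<Sum>a<m. (real (card {i \<in> {..<n}. \<tau> i = a}) - n / m)\<^sup>2)" for \<tau>
    \<comment> \<open>A balanced colouring costs \<open>e / 2\<close>. For any other one the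
      quotient \<open>X \<tau> / (d * n)\<^sup>2\<close> is at least 1 and pays for the trivial
      bound \<open>2 * B\<close>.\<close>
    have point: "\<bar>F (sample n A \<tau>) - F ?f\<bar> \<le> e / 2 + 2 * B * (X \<tau> / (d * n)\<^sup>2)" if \<tau>: "\<tau> \<in> {..<n} \<rightarrow>\<^sub>E {..<m}" for \<tau>
    proof -
      have \<tau>': "\<tau> i < m" if "i < n" for i using \<tau> that by (auto simp: PiE_iff)
      let ?M = "matrix_of n (\<lambda>(i, j). A (\<tau> i) (\<tau> j))"
      have M: "?M \<in> sym_matrices n" by (rule matrix_of_sym[OF sample_cube[OF A \<tau>']])
      have s: "sample n A \<tau> \<in> graphons" unfolding sample_def by (rule step_graphon[OF npos M])
      show ?thesis
      proof (cases "\<forall>a<m. \<bar>real (card {i \<in> {..<n}. \<tau> i = a}) - n / m\<bar> \<le> d * n")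
        case True
        obtain \<sigma> where \<sigma>: "\<sigma> permutes {..<n}"
          "L1_norm (\<lambda>p. step n (\<lambda>i j. ?M (\<sigma> i) (\<sigma> j)) p - ?f p) \<le>
            (2 * (\<Sum>a<m. \<bar>real (card {i \<in> {..<n}. \<tau> i = a}) - n / m\<bar>) + 1) / n"
          by (rule sample_close[OF A m qpos q]) (use \<tau>' in blast)+
        have M': "(\<lambda>i j. ?M (\<sigma> i) (\<sigma> j)) \<in> sym_matrices n"
          using M permutes_in_image[OF \<sigma>(1)] by (simp add: sym_matrices_def)
        have s': "step n (\<lambda>i j. ?M (\<sigma> i) (\<sigma> j)) \<in> graphons" by (rule step_graphon[OF npos M'])
        have "(2 * (\<Sum>a<m. \<bar>real (card {i \<in> {..<n}. \<tau> i = a}) - n / m\<bar>) + 1) / n \<le> (2 * (m * (d * n)) + 1) / n"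
          using True by (intro divide_right_mono add_right_mono mult_left_mono sum_bounded_above[where A = "{..<m}", simplified]) auto
        also have "\<dots> = r / 2 + 1 / n" using npos m by (simp add: d_def field_simps)
        also have "\<dots> < r" using n1 by simp
        finally have "\<bar>F (step n (\<lambda>i j. ?M (\<sigma> i) (\<sigma> j))) - F ?f\<bar> < e / 2"
          using \<sigma>(2) by (intro r(2)[OF s']) auto
        moreover have "F (step n (\<lambda>i j. ?M (\<sigma> i) (\<sigma> j))) = F (sample n A \<tau>)"
          using class_function weakly_equivalent_step_permute[OF npos \<sigma>(1) M] s s'
          unfolding class_function_def sample_def by blast
        moreover have "0 \<le> 2 * B * (X \<tau> / (d * n)\<^sup>2)"
          using B0 by (auto simp: X_def intro!: mult_nonneg_nonneg divide_nonneg_nonneg sum_nonneg)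
        ultimately show ?thesis by simp
      next
        case False
        then obtain a where a: "a < m" "d * n < \<bar>real (card {i \<in> {..<n}. \<tau> i = a}) - n / m\<bar>" by auto
        have "(d * n)\<^sup>2 \<le> \<bar>real (card {i \<in> {..<n}. \<tau> i = a}) - n / m\<bar>\<^sup>2"
          using a(2) d by (intro power_mono) auto
        also have "\<dots> = (real (card {i \<in> {..<n}. \<tau> i = a}) - n / m)\<^sup>2" by simp
        also have "\<dots> \<le> X \<tau>"
          unfolding X_def using a(1) by (intro member_le_sum[where f = "\<lambda>a. (real (card {i \<in> {..<n}. \<tau> i = a}) - n / m)\<^sup>2"]) auto
        finally have "1 \<le> X \<tau> / (d * n)\<^sup>2" using d npos by (simp add: le_divide_eq)
        then have "2 * B * 1 \<le> 2 * B * (X \<tau> / (d * n)\<^sup>2)" using B0 by (intro mult_left_mono) auto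
        moreover have "\<bar>F (sample n A \<tau>) - F ?f\<bar> \<le> 2 * B" using B[OF s] B[OF f] by linarith
        ultimately show ?thesis using e by linarith
      qed
    qed
    let ?P = "{..<n} \<rightarrow>\<^sub>E {..<m}"
    have cardP: "real (card ?P) = real m ^ n" by (simp add: card_PiE)
    have mn: "real m ^ n > 0" using m by simp
    have "(\<Sum>\<tau>\<in>?P. X \<tau>) \<le> m * (n * real m ^ n)"
    proof -
      have "(\<Sum>\<tau>\<in>?P. X \<tau>) = (\<Sum>a<m. \<Sum>\<tau>\<in>?P. (real (card {i \<in> {..<n}. \<tau> i = a}) - n / m)\<^sup>2)"
        unfolding X_def by (rule sum.swap)
      also have "\<dots> \<le> (\<Sum>a<m. n * real m ^ n)"
        by (intro sum_mono sum_PiE_card_deviation[OF m]) simp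
      finally show ?thesis by simp
    qed
    then have SX: "(\<Sum>\<tau>\<in>?P. X \<tau>) / real m ^ n \<le> m * n" using mn by (simp add: divide_le_eq mult_ac)
    have "sample_average F n (m, A) - F ?f = (\<Sum>\<tau>\<in>?P. F (sample n A \<tau>) - F ?f) / real m ^ n"
      using mn cardP by (simp add: sample_average_def sum_subtractf diff_divide_distrib)
    also have "\<bar>\<dots>\<bar> \<le> (\<Sum>\<tau>\<in>?P. e / 2 + 2 * B * (X \<tau> / (d * n)\<^sup>2)) / real m ^ n"
      using mn point by (auto simp: abs_divide intro!: divide_right_mono order.trans[OF sum_abs] sum_mono)
    also have "\<dots> = e / 2 + 2 * B / (d * n)\<^sup>2 * ((\<Sum>\<tau>\<in>?P. X \<tau>) / real m ^ n)"
      using mn cardP by (simp add: sum.distrib add_divide_distrib sum_distrib_left sum_divide_distrib mult_ac)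
    also have "\<dots> \<le> e / 2 + 2 * B / (d * n)\<^sup>2 * (m * n)"
      using SX B0 by (intro add_left_mono mult_left_mono) auto
    also have "\<dots> = e / 2 + 2 * B * m / (d\<^sup>2 * n)"
      using npos d by (simp add: power2_eq_square field_simps)
    also have "\<dots> < e"
    proof -
      have "4 * B * m < n * (d\<^sup>2 * e)" using n2 d e by (simp add: divide_less_eq)
      then have "2 * B * m / (d\<^sup>2 * n) < e / 2" using d npos by (simp add: divide_less_eq mult_ac)
      then show ?thesis by simp
    qed
    finally show "norm (sample_average F (fact k) (m, A) - F ?f) < e" by (simp add: n_def)
  qed
qed

theorem (in polynomial_class_function) finite_combination:
  obtains c where "\<And>f. f \<in> graphons \<Longrightarrow> F f = (\<Sum>xs\<in>small_graphs N. c xs * hom_density (graph_of xs) f)"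
proof -
  have "lin_comb (small_graphs N) (mono_average (2 * N)) step_data (\<lambda>(m, A). F (step m A))"
  proof (rule lin_comb_limit[OF finite_small_graphs])
    show "lin_comb (small_graphs N) (mono_average (2 * N)) step_data (sample_average F (fact k))" for k
      by (rule sample_average_lin_comb) simp
    show "(\<lambda>k. sample_average F (fact k) x) \<longlonglongrightarrow> (case x of (m, A) \<Rightarrow> F (step m A))" if "x \<in> step_data" for x
      using that sample_average_tendsto by (auto simp: step_data_def)
  qed
  then obtain c where c0: "\<forall>x\<in>step_data. (case x of (m, A) \<Rightarrow> F (step m A)) =
      (\<Sum>xs\<in>small_graphs N. c xs * mono_average (2 * N) xs x)"
    unfolding lin_comb_def by blast
  have c: "F (step m A) = (\<Sum>xs\<in>small_graphs N. c xs * mono_average (2 * N) xs (m, A))"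
    if "m > 0" "A \<in> sym_matrices m" for m A
    using bspec[OF c0, of "(m, A)"] that by (simp add: step_data_def)
  have H: "is_multigraph (graph_of xs)" if "xs \<in> small_graphs N" for xs
    using graph_of_multigraph small_graphs_endpoints(2)[OF that] by (simp add: multigraphs_def)
  let ?G = "\<lambda>f. \<Sum>xs\<in>small_graphs N. c xs * hom_density (graph_of xs) f"
  have step: "F (step m A) = ?G (step m A)" if "m > 0" "A \<in> sym_matrices m" for m A
    unfolding c[OF that]
  proof (rule sum.cong[OF refl])
    fix xs assume xs: "xs \<in> small_graphs N"
    show "c xs * mono_average (2 * N) xs (m, A) = c xs * hom_density (graph_of xs) (step m A)"
      by (subst hom_density_graph_of[where n = "2 * N"]) (use that small_graphs_endpoints[OF xs] in auto)
  qed
  \<comment> \<open>A Lipschitz constant of the combination for the \<open>L1_norm\<close>. It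
    carries the identity from step graphons to their limits, where \<open>F\<close> is continuous as
    well.\<close>
  define C where "C = (\<Sum>xs\<in>small_graphs N. \<bar>c xs\<bar> * card (edges (graph_of xs)))"
  have C: "C \<ge> 0" unfolding C_def by (intro sum_nonneg) auto
  have G: "\<bar>?G f - ?G g\<bar> \<le> C * L1_norm (\<lambda>p. f p - g p)" if "f \<in> graphons" "g \<in> graphons" for f g
  proof -
    have "\<bar>?G f - ?G g\<bar> = \<bar>\<Sum>xs\<in>small_graphs N. c xs * (hom_density (graph_of xs) f - hom_density (graph_of xs) g)\<bar>"
      by (simp add: sum_subtractf right_diff_distrib)
    also have "\<dots> \<le> (\<Sum>xs\<in>small_graphs N. \<bar>c xs\<bar> * (card (edges (graph_of xs)) * L1_norm (\<lambda>p. f p - g p)))"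
      by (intro order.trans[OF sum_abs] sum_mono)
         (auto simp: abs_mult intro!: mult_left_mono hom_density_L1 H that)
    also have "\<dots> = C * L1_norm (\<lambda>p. f p - g p)"
      unfolding C_def sum_distrib_right by (simp only: mult.assoc)
    finally show ?thesis .
  qed
  have "F f = ?G f" if f: "f \<in> graphons" for f
  proof (rule ccontr)
    assume ne: "F f \<noteq> ?G f"
    define e where "e = \<bar>F f - ?G f\<bar>"
    have e: "e > 0" using ne by (simp add: e_def)
    obtain r where r: "r > 0" "\<And>g. g \<in> graphons \<Longrightarrow> L1_norm (\<lambda>p. g p - f p) < r \<Longrightarrow> \<bar>F g - F f\<bar> < e / 2"
      using L1_continuous[OF f, of "e / 2"] e by auto
    have "min r (e / (2 * (C + 1))) > 0" using r(1) e C by simp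
    from step_graphons_dense[OF f this] obtain m A where mA: "m > 0" "A \<in> sym_matrices m"
      "L1_norm (\<lambda>p. f p - step m A p) < min r (e / (2 * (C + 1)))" .
    have s: "step m A \<in> graphons" by (rule step_graphon[OF mA(1,2)])
    have "\<bar>F (step m A) - F f\<bar> < e / 2"
      using mA(3) L1_norm_commute[of f "step m A"] by (intro r(2)[OF s]) auto
    moreover have "\<bar>?G f - ?G (step m A)\<bar> \<le> e / 2"
    proof -
      have "\<bar>?G f - ?G (step m A)\<bar> \<le> C * L1_norm (\<lambda>p. f p - step m A p)" by (rule G[OF f s])
      also have "\<dots> \<le> (C + 1) * (e / (2 * (C + 1)))"
        using mA(3) C L1_norm_nonneg by (intro mult_mono) auto
      also have "\<dots> = e / 2" using C by (simp add: field_simps)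
      finally show ?thesis .
    qed
    moreover have False if "\<bar>a - x\<bar> < \<bar>x - y\<bar> / 2" "\<bar>y - a\<bar> \<le> \<bar>x - y\<bar> / 2" for a x y :: real
      using that abs_triangle_ineq[of "a - x" "y - a"] by (simp add: abs_minus_commute)
    ultimately show False unfolding e_def step[OF mA(1,2)] by blast
  qed
  then show thesis by (rule that)
qed

section \<open>Isolating a single density\<close>

lemma hom_density_segment:
  assumes H: "is_multigraph H" and f: "f \<in> graphons" and g: "g \<in> graphons"
  shows "\<exists>q. \<forall>l. hom_density H (\<lambda>p. f p + l * (g p - f p)) = poly q l"
proof -
  have "f \<in> bounded_kernels" "(\<lambda>p. g p - f p) \<in> bounded_kernels"
    using f g by (auto intro: bounded_kernels_diff graphons_bounded)
  then obtain q where "degree q \<le> card (edges H)"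
      and "\<And>l. decorated_density H (\<lambda>e p. f p + l * (g p - f p)) = poly q l"
    by (rule_tac decorated_density_line[OF H, of "\<lambda>_. f" "\<lambda>_ p. g p - f p"]) blast+
  then show ?thesis by (auto simp: hom_density_eq_decorated)
qed

text \<open>On the segment from a graphon good for \<D> to one good for \<open>D\<close>, all these
  functionals are nonzero polynomials. Their roots are finite in number, so some point of the
  segment avoids them all.\<close>

lemma generic_graphon:
  assumes "finite \<D>"
    and "\<And>D. D \<in> \<D> \<Longrightarrow> \<exists>f\<in>graphons. D f \<noteq> (0::real)"
    and "\<And>D f g. D \<in> \<D> \<Longrightarrow> f \<in> graphons \<Longrightarrow> g \<in> graphons \<Longrightarrow>
      \<exists>q. \<forall>l. D (\<lambda>p. f p + l * (g p - f p)) = poly q l"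
  shows "\<exists>f\<in>graphons. \<forall>D\<in>\<D>. D f \<noteq> 0"
  using assms
proof (induction \<D> rule: finite_induct)
  case empty
  then show ?case using const_graphon[of 0] by auto
next
  case (insert D \<D>)
  obtain f where f: "f \<in> graphons" "\<And>D'. D' \<in> \<D> \<Longrightarrow> D' f \<noteq> 0"
    using insert.IH insert.prems by blast
  obtain g where g: "g \<in> graphons" "D g \<noteq> 0"
    using insert.prems(1)[of D] by blast
  let ?s = "\<lambda>l p. f p + l * (g p - f p)"
  have "\<exists>q. \<forall>l. D' (?s l) = poly q l" if "D' \<in> insert D \<D>" for D'
    using insert.prems(2)[OF that f(1) g(1)] .
  then have "\<forall>D'\<in>insert D \<D>. \<exists>q. \<forall>l. D' (?s l) = poly q l" by blast
  from bchoice[OF this] obtain q where q: "\<And>D' l. D' \<in> insert D \<D> \<Longrightarrow> D' (?s l) = poly (q D') l"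
    by blast
  have "q D' \<noteq> 0" if D': "D' \<in> insert D \<D>" for D'
  proof (cases "D' = D")
    case True
    have "?s 1 = g" by auto
    then show ?thesis using q[OF D', of 1] g(2) True by auto
  next
    case False
    have "?s 0 = f" by auto
    then show ?thesis using q[OF D', of 0] f(2)[of D'] False D' by auto
  qed
  then have "finite (\<Union>D'\<in>insert D \<D>. {l. poly (q D') l = 0})"
    using insert.hyps(1) by (auto intro: poly_roots_finite)
  moreover have "infinite {0..1::real}" by (rule infinite_Icc) simp
  ultimately have "infinite ({0..1} - (\<Union>D'\<in>insert D \<D>. {l. poly (q D') l = 0}))"
    by (rule Diff_infinite_finite)
  from infinite_imp_nonempty[OF this] obtain l where "l \<in> {0..1} - (\<Union>D'\<in>insert D \<D>. {l. poly (q D') l = 0})"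
    by blast
  then have l: "l \<in> {0..1}" "\<And>D'. D' \<in> insert D \<D> \<Longrightarrow> poly (q D') l \<noteq> 0"
    by blast+
  have "?s l = (\<lambda>p. (1 - l) * f p + l * g p)" by (auto simp: algebra_simps)
  then have "?s l \<in> graphons" using graphons_convex[OF f(1) g(1) l(1)] by simp
  then show ?case using l(2) q by (intro bexI[of _ "?s l"]) auto
qed

text \<open>Comparison of the two leading exponentials on both sides.\<close>

lemma finite_argmax:
  fixes a :: "'i \<Rightarrow> real"
  assumes "finite I" "I \<noteq> {}"
  obtains i where "i \<in> I" "\<And>j. j \<in> I \<Longrightarrow> a j \<le> a i"
proof -
  have "Max (a ` I) \<in> a ` I" using assms by (intro Max_in) auto
  then obtain i where "i \<in> I" "a i = Max (a ` I)" by auto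
  then show thesis using assms by (intro that[of i]) auto
qed

lemma exponential_sum_power:
  fixes a c :: "'i \<Rightarrow> real"
  assumes I: "finite I" and a: "inj_on a I" "\<And>i. i \<in> I \<Longrightarrow> 0 < a i" and c: "\<And>i. i \<in> I \<Longrightarrow> c i \<noteq> 0"
    and m: "m \<ge> 2"
    and eq: "\<And>k. k > 0 \<Longrightarrow> (\<Sum>i\<in>I. c i * a i ^ k) ^ m = (\<Sum>i\<in>I. c i * a i ^ (m * k))"
  shows "card I \<le> 1"
proof (rule ccontr)
  assume "\<not> card I \<le> 1"
  then have ne: "I \<noteq> {}" by auto
  obtain i where i: "i \<in> I" "\<And>j. j \<in> I \<Longrightarrow> a j \<le> a i"
    using finite_argmax[OF I ne, of a] by blast
  define J where "J = I - {i}"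
  have J: "finite J" "J \<noteq> {}"
  proof -
    show "finite J" using I by (simp add: J_def)
    have "card J = card I - 1" unfolding J_def using i(1) by (rule card_Diff_singleton)
    then show "J \<noteq> {}" using \<open>\<not> card I \<le> 1\<close> by auto
  qed
  obtain j where j: "j \<in> J" "\<And>k. k \<in> J \<Longrightarrow> a k \<le> a j"
    using finite_argmax[OF J, of a] by blast
  define r where "r k = a k / a i" for k
  define s where "s k = a k / a j" for k
  have ai: "a i > 0" and aj: "a j > 0" using a i j by (auto simp: J_def)
  have lt: "a k < a i" if "k \<in> J" for k
  proof -
    have "a k \<noteq> a i" using inj_onD[OF a(1), of k i] i(1) that by (auto simp: J_def)
    then show ?thesis using i(2)[of k] that by (auto simp: J_def)
  qed
  have lt': "a k < a j" if "k \<in> J - {j}" for k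
  proof -
    have "a k \<noteq> a j" using inj_onD[OF a(1), of k j] j(1) that by (auto simp: J_def)
    then show ?thesis using j(2)[of k] that by auto
  qed
  have r: "0 < r k" "r k < 1" if "k \<in> J" for k
    using lt[OF that] a(2)[of k] ai that by (auto simp: r_def J_def)
  have s: "0 < s k" "s k < 1" if "k \<in> J - {j}" for k
    using lt'[OF that] a(2)[of k] aj that by (auto simp: s_def J_def)
  have nr: "norm (r k) < 1" if "k \<in> J" for k using r[OF that] by simp
  have ns: "norm (s k) < 1" if "k \<in> J - {j}" for k using s[OF that] by simp
  \<comment> \<open>After division by \<open>a i ^ n\<close> the largest term is the constant
    \<open>c i\<close>, and \<open>u\<close> is the remainder. It equals
    \<open>r j ^ n * v n\<close>, where \<open>v\<close> tends to the coefficient \<open>c j\<close>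
    of the second largest term.\<close>
  define u where "u n = (\<Sum>k\<in>J. c k * r k ^ n)" for n
  define v where "v n = c j + (\<Sum>k\<in>J - {j}. c k * s k ^ n)" for n
  have u0: "u \<longlonglongrightarrow> 0"
  proof -
    have "(\<lambda>n. \<Sum>k\<in>J. c k * r k ^ n) \<longlonglongrightarrow> (\<Sum>k\<in>J. c k * 0)"
      by (intro tendsto_intros LIMSEQ_power_zero nr)
    then show ?thesis by (simp add: u_def[abs_def])
  qed
  have v0: "v \<longlonglongrightarrow> c j"
  proof -
    have "(\<lambda>n. c j + (\<Sum>k\<in>J - {j}. c k * s k ^ n)) \<longlonglongrightarrow> c j + (\<Sum>k\<in>J - {j}. c k * 0)"
      by (intro tendsto_intros LIMSEQ_power_zero ns)
    then show ?thesis by (simp add: v_def[abs_def])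
  qed
  have uv: "u n = r j ^ n * v n" for n
  proof -
    have rs: "r k = r j * s k" for k using aj by (simp add: r_def s_def)
    have "c k * r k ^ n = r j ^ n * (c k * s k ^ n)" for k
      unfolding rs[of k] by (simp add: power_mult_distrib)
    then have "u n = (\<Sum>k\<in>J. r j ^ n * (c k * s k ^ n))"
      unfolding u_def by (intro sum.cong refl)
    also have "\<dots> = r j ^ n * (\<Sum>k\<in>J. c k * s k ^ n)" by (simp add: sum_distrib_left)
    also have "(\<Sum>k\<in>J. c k * s k ^ n) = v n"
      using J(1) j(1) aj by (simp add: sum.remove v_def s_def)
    finally show ?thesis .
  qed
  have main: "(c i + u n) ^ m = c i + u (m * n)" if "n > 0" for n
  proof -
    have sum: "(\<Sum>k\<in>I. c k * a k ^ N) = a i ^ N * (c i + u N)" for N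
    proof -
      have "(\<Sum>k\<in>I. c k * a k ^ N) = (\<Sum>k\<in>I. a i ^ N * (c k * r k ^ N))"
        using ai by (intro sum.cong refl) (simp add: r_def power_divide)
      also have "\<dots> = a i ^ N * (\<Sum>k\<in>I. c k * r k ^ N)" by (simp add: sum_distrib_left)
      also have "(\<Sum>k\<in>I. c k * r k ^ N) = c i + u N"
        using I i(1) ai by (simp add: sum.remove u_def J_def r_def)
      finally show ?thesis .
    qed
    have "a i ^ (m * n) * (c i + u n) ^ m = a i ^ (m * n) * (c i + u (m * n))"
      using eq[OF that] by (simp add: sum power_mult_distrib mult.commute flip: power_mult)
    then show ?thesis using ai by simp
  qed
  have um: "(\<lambda>n. u (m * n)) \<longlonglongrightarrow> 0"
    using LIMSEQ_subseq_LIMSEQ[OF u0, of "\<lambda>n. m * n"] m by (simp add: comp_def strict_mono_def)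
  have vm: "(\<lambda>n. v (m * n)) \<longlonglongrightarrow> c j"
    using LIMSEQ_subseq_LIMSEQ[OF v0, of "\<lambda>n. m * n"] m by (simp add: comp_def strict_mono_def)
  have ev: "\<forall>\<^sub>F n in sequentially. n > (0::nat)" by (rule eventually_gt_at_top)
  have cm: "c i ^ m = c i"
  proof -
    have "(\<lambda>n. (c i + u n) ^ m) \<longlonglongrightarrow> (c i + 0) ^ m" by (intro tendsto_intros u0)
    moreover have "(\<lambda>n. (c i + u n) ^ m) \<longlonglongrightarrow> c i + 0"
    proof (rule Lim_transform_eventually)
      show "(\<lambda>n. c i + u (m * n)) \<longlonglongrightarrow> c i + 0" by (intro tendsto_intros um)
      show "\<forall>\<^sub>F n in sequentially. c i + u (m * n) = (c i + u n) ^ m"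
        using ev by eventually_elim (simp add: main)
    qed
    ultimately show ?thesis using LIMSEQ_unique by fastforce
  qed
  \<comment> \<open>Since \<open>c i ^ m = c i\<close>, the identity gives \<open>u (m * n)\<close>
    as \<open>u n\<close> times this sum. Divided by \<open>r j ^ n\<close>, the right side tends to
    \<open>c j * (m * c i ^ (m - 1))\<close>, while the left side has order
    \<open>r j ^ ((m - 1) * n)\<close> and tends to 0 because \<open>m \<ge> 2\<close>.\<close>
  have "(\<lambda>n. v n * (\<Sum>l<m. c i ^ (m - Suc l) * (c i + u n) ^ l)) \<longlonglongrightarrow> c j * (\<Sum>l<m. c i ^ (m - Suc l) * (c i + 0) ^ l)"
    by (intro tendsto_intros u0 v0)
  moreover have "(\<Sum>l<m. c i ^ (m - Suc l) * (c i + 0) ^ l) = m * c i ^ (m - 1)"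
  proof -
    have "c i ^ (m - Suc l) * (c i + 0) ^ l = c i ^ (m - 1)" if "l < m" for l
      using that by (simp flip: power_add)
    then show ?thesis by simp
  qed
  moreover have "(\<lambda>n. v n * (\<Sum>l<m. c i ^ (m - Suc l) * (c i + u n) ^ l)) \<longlonglongrightarrow> 0"
  proof (rule Lim_transform_eventually)
    have rj: "0 < r j" "r j < 1" using r[OF j(1)] by auto
    have "(\<lambda>n. (r j ^ (m - 1)) ^ n * v (m * n)) \<longlonglongrightarrow> 0 * c j"
    proof (intro tendsto_mult vm LIMSEQ_power_zero)
      have "r j ^ (m - 1) < 1" 
      proof -
        have "m - 1 = Suc (m - 2)" using m by simp
        then show ?thesis using power_Suc_less_one[OF rj, of "m - 2"] by simp
      qed
      then show "norm (r j ^ (m - 1)) < 1" using rj by simp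
    qed
    then show "(\<lambda>n. (r j ^ (m - 1)) ^ n * v (m * n)) \<longlonglongrightarrow> 0" by simp
    show "\<forall>\<^sub>F n in sequentially. (r j ^ (m - 1)) ^ n * v (m * n) =
        v n * (\<Sum>l<m. c i ^ (m - Suc l) * (c i + u n) ^ l)"
      using ev
    proof eventually_elim
      case (elim n)
      have "(c i + u n) ^ m - c i ^ m = (c i + u n - c i) * (\<Sum>l<m. c i ^ (m - Suc l) * (c i + u n) ^ l)"
        by (rule power_diff_sumr2)
      then have "u (m * n) = u n * (\<Sum>l<m. c i ^ (m - Suc l) * (c i + u n) ^ l)"
        using main[OF elim] cm by simp
      then have "r j ^ (m * n) * v (m * n) = r j ^ n * (v n * (\<Sum>l<m. c i ^ (m - Suc l) * (c i + u n) ^ l))"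
        by (simp add: uv mult_ac)
      moreover have "r j ^ (m * n) = r j ^ n * (r j ^ (m - 1)) ^ n"
      proof -
        have "m * n = n + (m - 1) * n" using m by (cases m) auto
        then show ?thesis by (simp add: power_add power_mult)
      qed
      ultimately show ?case using rj by simp
    qed
  qed
  ultimately have "c j * (m * c i ^ (m - 1)) = 0" using LIMSEQ_unique by fastforce
  then show False using c[OF i(1)] c[of j] j(1) m by (auto simp: J_def)
qed

theorem single_density:
  fixes F :: "kernel \<Rightarrow> real" and t :: "'i \<Rightarrow> multigraph"
  assumes \<phi>: "measure_preserving unit_interval unit_square \<phi>"
    and mult: "multiplicative_on_tensor_powers \<phi> F"
    and F: "\<And>f. f \<in> graphons \<Longrightarrow> F f = (\<Sum>i\<in>I. c i * hom_density (t i) f)"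
    and I: "finite I" and t: "\<And>i. i \<in> I \<Longrightarrow> is_multigraph (t i)"
    and nz: "\<exists>f\<in>graphons. F f \<noteq> 0"
  shows "\<exists>i\<in>I. \<forall>f\<in>graphons. F f = hom_density (t i) f"
proof -
  \<comment> \<open>\<open>P n\<close> says that \<open>n\<close> of the densities suffice. In a
    minimal representation no coefficient vanishes and no two densities coincide on graphons, as
    such terms could be dropped or merged.\<close>
  define P where "P n \<longleftrightarrow> (\<exists>J c. J \<subseteq> I \<and> card J = n \<and> (\<forall>f\<in>graphons. F f = (\<Sum>i\<in>J. c i * hom_density (t i) f)))" for n
  have "P (card I)" unfolding P_def using F by blast
  then have PL: "P (LEAST n. P n)" and least: "\<And>n. P n \<Longrightarrow> (LEAST n. P n) \<le> n"
    by (auto intro: LeastI Least_le)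
  then obtain J c where J: "J \<subseteq> I" "card J = (LEAST n. P n)" and FJ: "\<And>f. f \<in> graphons \<Longrightarrow> F f = (\<Sum>i\<in>J. c i * hom_density (t i) f)"
    unfolding P_def by blast
  have finJ: "finite J" using J(1) I by (rule finite_subset)
  have tJ: "is_multigraph (t i)" if "i \<in> J" for i using J(1) t that by blast
  have minimal: False if "i \<in> J" "\<And>f. f \<in> graphons \<Longrightarrow> F f = (\<Sum>i\<in>J - {i}. d i * hom_density (t i) f)" for i d
  proof -
    have "P (card (J - {i}))" unfolding P_def using that(2) J(1) by blast
    then have "card J \<le> card (J - {i})" using least J(2) by simp
    then show False using that(1) finJ by (meson card_Diff1_less not_le)
  qed
  have c: "c i \<noteq> 0" if "i \<in> J" for i
  proof
    assume "c i = 0"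
    then show False using that finJ by (intro minimal[OF that, of c]) (simp add: FJ sum.remove)
  qed
  have distinct: "\<exists>f\<in>graphons. hom_density (t i) f - hom_density (t j) f \<noteq> 0" if ij: "i \<in> J" "j \<in> J" "i \<noteq> j" for i j
  proof (rule ccontr)
    assume "\<not> ?thesis"
    then have eq: "hom_density (t i) f = hom_density (t j) f" if "f \<in> graphons" for f using that by simp
    show False
    proof (rule minimal[OF ij(1), of "c(j := c j + c i)"])
      fix f assume f: "f \<in> graphons"
      have j: "j \<in> J - {i}" using ij by simp
      have "F f = c i * hom_density (t j) f + (\<Sum>k\<in>J - {i}. c k * hom_density (t k) f)"
        using FJ[OF f] eq[OF f] finJ ij(1) by (simp add: sum.remove)
      also have "\<dots> = (\<Sum>k\<in>J - {i}. (c(j := c j + c i)) k * hom_density (t k) f)"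
        using finJ j by (simp add: sum.remove[OF _ j] algebra_simps)
      finally show "F f = (\<Sum>k\<in>J - {i}. (c(j := c j + c i)) k * hom_density (t k) f)" .
    qed
  qed
  obtain m where m: "m > 0" "even m" "\<And>f. f \<in> graphons \<Longrightarrow> F f ^ m = F (tensor_power \<phi> f m)"
    using mult unfolding multiplicative_on_tensor_powers_def by blast
  have m2: "m \<ge> 2" using m(1,2) by (cases m rule: nat.exhaust) (auto simp: Suc_le_eq odd_pos)
  \<comment> \<open>All functionals that must be nonzero at one common graphon: the densities, which
    are then positive, and their differences, which make them distinct.\<close>
  define \<D> where "\<D> = (\<lambda>i f. hom_density (t i) f) ` J \<union> (\<lambda>(i, j) f. hom_density (t i) f - hom_density (t j) f) ` {(i, j). i \<in> J \<and> j \<in> J \<and> i \<noteq> j}"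
  have "\<exists>f\<in>graphons. \<forall>D\<in>\<D>. D f \<noteq> 0"
  proof (rule generic_graphon)
    have "finite {(i, j). i \<in> J \<and> j \<in> J \<and> i \<noteq> j}"
      by (rule finite_subset[of _ "J \<times> J"]) (use finJ in auto)
    then show "finite \<D>" using finJ by (simp add: \<D>_def)
    show "\<exists>f\<in>graphons. D f \<noteq> 0" if D: "D \<in> \<D>" for D
    proof -
      consider i where "i \<in> J" "D = hom_density (t i)" | i j where "i \<in> J" "j \<in> J" "i \<noteq> j" "D = (\<lambda>f. hom_density (t i) f - hom_density (t j) f)"
        using D by (auto simp: \<D>_def)
      then show ?thesis
      proof cases
        case 1
        then show ?thesis using hom_density_one[OF tJ] const_graphon[of 1] by (intro bexI[of _ "\<lambda>_. 1"]) auto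
      next
        case 2
        then show ?thesis using distinct by blast
      qed
    qed
    fix D f g assume D: "D \<in> \<D>" and f: "f \<in> graphons" and g: "g \<in> graphons"
    have seg: "\<exists>q. \<forall>l. hom_density (t i) (\<lambda>p. f p + l * (g p - f p)) = poly q l" if "i \<in> J" for i
      by (rule hom_density_segment[OF tJ[OF that] f g])
    consider i where "i \<in> J" "D = hom_density (t i)" | i j where "i \<in> J" "j \<in> J" "D = (\<lambda>f. hom_density (t i) f - hom_density (t j) f)"
      using D by (auto simp: \<D>_def)
    then show "\<exists>q. \<forall>l. D (\<lambda>p. f p + l * (g p - f p)) = poly q l"
    proof cases
      case 1
      then show ?thesis using seg by simp
    next
      case 2
      obtain q q' where "\<And>l. hom_density (t i) (\<lambda>p. f p + l * (g p - f p)) = poly q l"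
        "\<And>l. hom_density (t j) (\<lambda>p. f p + l * (g p - f p)) = poly q' l"
        using seg[OF 2(1)] seg[OF 2(2)] by blast
      then show ?thesis using 2(3) by (intro exI[of _ "q - q'"]) simp
    qed
  qed
  then obtain f where f: "f \<in> graphons" and gen: "\<And>D. D \<in> \<D> \<Longrightarrow> D f \<noteq> 0" by blast
  have "card J \<le> 1"
  proof (rule exponential_sum_power[OF finJ _ _ c m2])
    show "inj_on (\<lambda>i. hom_density (t i) f) J"
    proof (rule inj_onI, rule ccontr)
      fix i j assume ij: "i \<in> J" "j \<in> J" "hom_density (t i) f = hom_density (t j) f" "i \<noteq> j"
      have "(\<lambda>f. hom_density (t i) f - hom_density (t j) f) \<in> \<D>"
        unfolding \<D>_def using ij by (intro UnI2 image_eqI[of _ _ "(i, j)"]) auto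
      from gen[OF this] ij(3) show False by simp
    qed
    show "0 < hom_density (t i) f" if "i \<in> J" for i
    proof -
      have "(\<lambda>f. hom_density (t i) f) \<in> \<D>" unfolding \<D>_def using that by blast
      from gen[OF this] show ?thesis using hom_density_range[OF \<phi> tJ[OF that] f] by (auto simp: less_le)
    qed
    \<comment> \<open>The condition is applied to the \<open>k\<close>-th tensor power of
      \<open>f\<close>. Multiplicativity, used twice, gives each density the exponent
      \<open>m * k\<close>.\<close>
    fix k :: nat assume k: "k > 0"
    have pow: "F (tensor_power \<phi> g n) = (\<Sum>i\<in>J. c i * hom_density (t i) g ^ n)" if "g \<in> graphons" "n > 0" for g n
      using FJ[OF tensor_power_graphon[OF \<phi> that]] hom_density_tensor_power[OF \<phi> tJ that] by simp
    have g: "tensor_power \<phi> f k \<in> graphons" by (rule tensor_power_graphon[OF \<phi> f k])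
    have "(\<Sum>i\<in>J. c i * hom_density (t i) f ^ k) ^ m = F (tensor_power \<phi> f k) ^ m" by (simp add: pow[OF f k])
    also have "\<dots> = (\<Sum>i\<in>J. c i * hom_density (t i) (tensor_power \<phi> f k) ^ m)"
      using m(3)[OF g] pow[OF g m(1)] by simp
    also have "\<dots> = (\<Sum>i\<in>J. c i * hom_density (t i) f ^ (m * k))"
      by (intro sum.cong refl) (simp add: hom_density_tensor_power[OF \<phi> tJ f k] mult.commute flip: power_mult)
    finally show "(\<Sum>i\<in>J. c i * hom_density (t i) f ^ k) ^ m = (\<Sum>i\<in>J. c i * hom_density (t i) f ^ (m * k))" .
  qed auto
  moreover have "J \<noteq> {}" using nz FJ by auto
  ultimately have "card J = 1" using finJ by (simp add: le_Suc_eq)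
  then obtain i where i: "J = {i}" by (auto simp: card_1_singleton_iff)
  define o1 :: kernel where "o1 = (\<lambda>_. 1)"
  have o1: "o1 \<in> graphons" unfolding o1_def by (rule const_graphon) simp
  have one: "hom_density (t i) o1 = 1" unfolding o1_def using tJ i by (intro hom_density_one) simp
  \<comment> \<open>Every density is 1 at the constant graphon 1, so there the condition is an
    equation for the coefficient alone.\<close>
  have "c i ^ m = c i"
    using m(3)[OF o1] FJ[OF o1] FJ[OF tensor_power_graphon[OF \<phi> o1 m(1)]]
      hom_density_tensor_power[OF \<phi> tJ o1 m(1)] one i by simp
  then have "c i * c i ^ (m - 1) = c i * 1" using m(1) by (cases m) auto
  then have "c i ^ (m - 1) = 1" using c[of i] i by simp
  \<comment> \<open>The odd exponent excludes \<open>-1\<close>. For odd \<open>m\<close> the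
    negative of a density would satisfy the same tensor power identity.\<close>
  moreover have "odd (m - 1)" using m by simp
  moreover have "\<bar>c i\<bar> = 1"
  proof -
    have "\<bar>c i\<bar> ^ (m - 1) = 1 ^ (m - 1)" using \<open>c i ^ (m - 1) = 1\<close> by (simp flip: power_abs)
    moreover have "m - 1 > 0" using m2 by simp
    ultimately show ?thesis using power_eq_iff_eq_base[of "m - 1" "\<bar>c i\<bar>" 1] by simp
  qed
  ultimately have "c i = 1" by (auto simp: abs_if split: if_splits)
  then show ?thesis using FJ i J(1) by (intro bexI[of _ i]) auto
qed

section \<open>Quasirandom 0/1-valued graphons\<close>

text \<open>Multiplication by a unit followed by a translation permutes the residues.\<close>

lemma sum_affine_mod:
  fixes k c q :: int and g :: "int \<Rightarrow> real"
  assumes q: "q > 0" and k: "coprime k q"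
  shows "(\<Sum>x\<in>{0..<q}. g ((k * x + c) mod q)) = (\<Sum>x\<in>{0..<q}. g x)"
proof -
  let ?f = "\<lambda>x. (k * x + c) mod q"
  have inj: "inj_on ?f {0..<q}"
  proof (rule inj_onI)
    fix x y assume xy: "x \<in> {0..<q}" "y \<in> {0..<q}" "?f x = ?f y"
    then have "q dvd (k * x + c) - (k * y + c)" by (simp add: mod_eq_dvd_iff)
    then have "q dvd k * (x - y)" by (simp add: algebra_simps)
    then have "q dvd x - y" using k by (simp add: coprime_commute coprime_dvd_mult_right_iff)
    then have "x mod q = y mod q" by (simp add: mod_eq_dvd_iff)
    then show "x = y" using xy by simp
  qed
  have "?f ` {0..<q} \<subseteq> {0..<q}" using q by auto
  then have "?f ` {0..<q} = {0..<q}" using inj by (intro endo_inj_surj) auto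
  then have "(\<Sum>x\<in>{0..<q}. g x) = (\<Sum>x\<in>?f ` {0..<q}. g x)" by simp
  also have "\<dots> = (\<Sum>x\<in>{0..<q}. g (?f x))" using inj by (simp add: sum.reindex)
  finally show ?thesis by simp
qed

text \<open>The entries \<open>x x' + y + y'\<close> modulo a prime are pairwise independent: for \<open>x' \<noteq> x''\<close> the pair
  of entries in two columns is equidistributed over the rows.\<close>

lemma quasirandom_columns:
  fixes q x' x'' y' y'' :: int and h :: "int \<Rightarrow> real"
  assumes q: "prime q" and h0: "(\<Sum>v\<in>{0..<q}. h v) = 0"
    and x: "x' \<in> {0..<q}" "x'' \<in> {0..<q}" "x' \<noteq> x''"
  shows "(\<Sum>x\<in>{0..<q}. \<Sum>y\<in>{0..<q}. h ((x * x' + y + y') mod q) * h ((x * x'' + y + y'') mod q)) = 0"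
proof -
  have q0: "q > 0" using q by (simp add: prime_gt_0_int)
  have "\<not> q dvd x'' - x'"
  proof
    assume "q dvd x'' - x'"
    then have "x'' mod q = x' mod q" by (simp add: mod_eq_dvd_iff)
    then show False using x by simp
  qed
  then have cop: "coprime (x'' - x') q" using q prime_imp_coprime coprime_commute by blast
  \<comment> \<open>The first entry is taken as the new variable \<open>v\<close> in place of
    \<open>y\<close>. The second entry is then affine in \<open>x\<close> with slope
    \<open>x'' - x'\<close>, a unit modulo the prime, so summing over \<open>x\<close> makes it run
    through all residues.\<close>
  have shift: "(\<Sum>y\<in>{0..<q}. h ((x * x' + y + y') mod q) * h ((x * x'' + y + y'') mod q)) =
      (\<Sum>v\<in>{0..<q}. h v * h (((x'' - x') * x + (v + y'' - y')) mod q))" for x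
  proof -
    have "h ((x * x' + y + y') mod q) * h ((x * x'' + y + y'') mod q) =
        (\<lambda>v. h v * h (((x'' - x') * x + (v + y'' - y')) mod q)) ((1 * y + (x * x' + y')) mod q)" for y
    proof -
      have "((x'' - x') * x + ((1 * y + (x * x' + y')) mod q + y'' - y')) mod q =
          ((x'' - x') * x + ((1 * y + (x * x' + y')) + y'' - y')) mod q"
        by (metis (no_types, lifting) add.commute add_diff_eq mod_add_left_eq)
      also have "\<dots> = (x * x'' + y + y'') mod q" by (simp add: algebra_simps)
      finally show ?thesis by (simp add: algebra_simps)
    qed
    then show ?thesis
      using sum_affine_mod[OF q0, of 1 "\<lambda>v. h v * h (((x'' - x') * x + (v + y'' - y')) mod q)" "x * x' + y'"]
      by simp
  qed
  have "(\<Sum>x\<in>{0..<q}. \<Sum>y\<in>{0..<q}. h ((x * x' + y + y') mod q) * h ((x * x'' + y + y'') mod q)) =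
      (\<Sum>v\<in>{0..<q}. h v * (\<Sum>x\<in>{0..<q}. h (((x'' - x') * x + (v + y'' - y')) mod q)))"
    unfolding shift by (subst sum.swap) (simp add: sum_distrib_left)
  also have "\<dots> = 0" using sum_affine_mod[OF q0 cop, of h] h0 by simp
  finally show ?thesis .
qed

text \<open>An index below \<open>q * q\<close> encodes the pair of its quotient and remainder
  modulo \<open>q\<close>. The formula is symmetric in the two indices, as a graphon
  requires.\<close>

definition qentry :: "nat \<Rightarrow> nat \<Rightarrow> nat \<Rightarrow> nat" where
  "qentry q i j = ((i div q) * (j div q) + i mod q + j mod q) mod q"

lemma sum_lessThan_mult:
  fixes g :: "nat \<Rightarrow> 'a::comm_monoid_add"
  shows "(\<Sum>i<m * k. g i) = (\<Sum>a<m. \<Sum>r<k. g (a * k + r))"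
proof (induction m)
  case (Suc m)
  have "(\<Sum>i<a + k. g i) = (\<Sum>i<a. g i) + (\<Sum>r<k. g (a + r))" for a
    by (induction k) (auto simp: add_ac)
  from this[of "m * k"] show ?case using Suc by (simp add: add.commute)
qed simp

lemma sum_int_lessThan: "(\<Sum>x\<in>{0..<int q}. g x) = (\<Sum>x<q. g (int x))"
proof -
  have "{0..<int q} = int ` {..<q}" by (simp add: image_int_atLeastLessThan flip: atLeast0LessThan)
  then show ?thesis by (simp add: sum.reindex)
qed

text \<open>By Cauchy-Schwarz in \<open>i\<close> it suffices to bound the Gram matrix of the
  columns. Columns with different quotients are orthogonal; the other \<open>q ^ 3\<close> pairs
  contribute at most \<open>q ^ 2\<close> each. With \<open>q ^ 2\<close> from the weights
  \<open>s\<close> this gives \<open>q ^ 7\<close>, which saves a factor \<open>q\<close> over the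
  trivial bound.\<close>

lemma quasirandom_bilinear:
  fixes s t :: "nat \<Rightarrow> real" and h :: "nat \<Rightarrow> real"
  assumes q: "prime q" and h0: "(\<Sum>v<q. h v) = 0" and h1: "\<And>v. \<bar>h v\<bar> \<le> 1"
    and s: "\<And>i. 0 \<le> s i \<and> s i \<le> c" and t: "\<And>i. 0 \<le> t i \<and> t i \<le> c"
  shows "(\<Sum>i<q * q. \<Sum>j<q * q. h (qentry q i j) * (s i * t j))\<^sup>2 \<le> c ^ 4 * real q ^ 7"
proof -
  have q0: "q > 0" using q by (simp add: prime_gt_0_nat)
  have c: "c \<ge> 0" using s[of 0] by linarith
  define T where "T i = (\<Sum>j<q * q. h (qentry q i j) * t j)" for i
  have col: "\<bar>\<Sum>i<q * q. h (qentry q i j) * h (qentry q i k)\<bar> \<le> (if j div q = k div q then real (q * q) else 0)"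
    if j: "j < q * q" and k: "k < q * q" for j k
  proof (cases "j div q = k div q")
    case True
    have "\<bar>\<Sum>i<q * q. h (qentry q i j) * h (qentry q i k)\<bar> \<le> (\<Sum>i<q * q. 1)"
      using h1 by (intro order.trans[OF sum_abs] sum_mono) (auto simp: abs_mult intro: mult_le_one)
    then show ?thesis using True by simp
  next
    case False
    define h' where "h' z = h (nat z)" for z
    have q': "prime (int q)" using q by simp
    have h0': "(\<Sum>v\<in>{0..<int q}. h' v) = 0" using h0 by (simp add: sum_int_lessThan h'_def)
    have dq: "j div q < q" "k div q < q" using j k by (auto simp: less_mult_imp_div_less)
    have "(\<Sum>i<q * q. h (qentry q i j) * h (qentry q i k)) =
        (\<Sum>x<q. \<Sum>y<q. h (qentry q (x * q + y) j) * h (qentry q (x * q + y) k))"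
      by (rule sum_lessThan_mult)
    also have "\<dots> = (\<Sum>x<q. \<Sum>y<q. h' ((int x * int (j div q) + int y + int (j mod q)) mod int q) *
        h' ((int x * int (k div q) + int y + int (k mod q)) mod int q))"
    proof (intro sum.cong refl)
      fix x y assume "x \<in> {..<q}" "y \<in> {..<q}"
      then have "h (qentry q (x * q + y) l) = h' ((int x * int (l div q) + int y + int (l mod q)) mod int q)" for l
        using q0 by (simp add: qentry_def h'_def flip: of_nat_mult of_nat_add of_nat_mod)
      then show "h (qentry q (x * q + y) j) * h (qentry q (x * q + y) k) =
        h' ((int x * int (j div q) + int y + int (j mod q)) mod int q) *
        h' ((int x * int (k div q) + int y + int (k mod q)) mod int q)" by simp
    qed
    also have "\<dots> = (\<Sum>x\<in>{0..<int q}. \<Sum>y\<in>{0..<int q}. h' ((x * int (j div q) + y + int (j mod q)) mod int q) *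
        h' ((x * int (k div q) + y + int (k mod q)) mod int q))"
      by (simp only: sum_int_lessThan)
    also have "\<dots> = 0"
      by (rule quasirandom_columns[OF q' h0']) (use False dq in auto)
    finally show ?thesis by simp
  qed
  have "(\<Sum>i<q * q. (T i)\<^sup>2) = (\<Sum>j<q * q. \<Sum>k<q * q. t j * t k * (\<Sum>i<q * q. h (qentry q i j) * h (qentry q i k)))"
  proof -
    have "(\<Sum>i<q * q. (T i)\<^sup>2) = (\<Sum>i<q * q. \<Sum>j<q * q. \<Sum>k<q * q. t j * t k * (h (qentry q i j) * h (qentry q i k)))"
      unfolding T_def power2_eq_square sum_product by (intro sum.cong refl) (simp add: mult_ac)
    also have "\<dots> = (\<Sum>j<q * q. \<Sum>i<q * q. \<Sum>k<q * q. t j * t k * (h (qentry q i j) * h (qentry q i k)))"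
      by (rule sum.swap)
    also have "\<dots> = (\<Sum>j<q * q. \<Sum>k<q * q. \<Sum>i<q * q. t j * t k * (h (qentry q i j) * h (qentry q i k)))"
      by (intro sum.cong refl sum.swap)
    finally show ?thesis by (simp add: sum_distrib_left)
  qed
  also have "\<dots> \<le> (\<Sum>j<q * q. \<Sum>k<q * q. c * c * (if j div q = k div q then real (q * q) else 0))"
  proof (intro sum_mono)
    fix j k assume jk: "j \<in> {..<q * q}" "k \<in> {..<q * q}"
    let ?S = "\<Sum>i<q * q. h (qentry q i j) * h (qentry q i k)"
    have "t j * t k * ?S \<le> t j * t k * \<bar>?S\<bar>" using t by (intro mult_left_mono) auto
    also have "\<dots> \<le> c * c * (if j div q = k div q then real (q * q) else 0)"
      using t c col[of j k] jk by (intro mult_mono) auto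
    finally show "t j * t k * ?S \<le> c * c * (if j div q = k div q then real (q * q) else 0)" .
  qed
  also have "\<dots> = c * c * real q ^ 5"
  proof -
    have "(\<Sum>k<q * q. if j div q = k div q then real (q * q) else 0) = real q ^ 3" if "j < q * q" for j
    proof -
      have "j div q < q" using that by (simp add: less_mult_imp_div_less)
      have "(\<Sum>k<q * q. if j div q = k div q then real (q * q) else 0) =
          (\<Sum>x<q. \<Sum>y<q. if j div q = (x * q + y) div q then real (q * q) else 0)"
        by (rule sum_lessThan_mult)
      also have "\<dots> = (\<Sum>x<q. if j div q = x then real q * real (q * q) else 0)"
        using q0 by (intro sum.cong refl) auto
      also have "\<dots> = real q * real (q * q)" using \<open>j div q < q\<close> by simp
      finally show ?thesis by (simp add: power3_eq_cube)
    qed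
    then have "(\<Sum>j<q * q. \<Sum>k<q * q. c * c * (if j div q = k div q then real (q * q) else 0)) =
        (\<Sum>j<q * q. c * c * real q ^ 3)"
      by (intro sum.cong refl) (simp only: sum_distrib_left[symmetric] lessThan_iff)
    then show ?thesis by (simp add: eval_nat_numeral)
  qed
  finally have T2: "(\<Sum>i<q * q. (T i)\<^sup>2) \<le> c * c * real q ^ 5" .
  have S2: "(\<Sum>i<q * q. (s i)\<^sup>2) \<le> real q * real q * (c * c)"
  proof -
    have "(\<Sum>i<q * q. (s i)\<^sup>2) \<le> (\<Sum>i<q * q. c * c)"
      using s c by (intro sum_mono) (auto simp: power2_eq_square intro!: mult_mono)
    then show ?thesis by simp
  qed
  have "(\<Sum>i<q * q. \<Sum>j<q * q. h (qentry q i j) * (s i * t j)) = (\<Sum>i<q * q. s i * T i)"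
    unfolding T_def sum_distrib_left by (intro sum.cong refl) (simp add: mult_ac)
  then have "(\<Sum>i<q * q. \<Sum>j<q * q. h (qentry q i j) * (s i * t j))\<^sup>2 \<le> (\<Sum>i<q * q. (s i)\<^sup>2) * (\<Sum>i<q * q. (T i)\<^sup>2)"
    using Cauchy_Schwarz_ineq_sum[of s T "{..<q * q}"] by simp
  also have "\<dots> \<le> (real q * real q * (c * c)) * (c * c * real q ^ 5)"
    using S2 T2 c by (intro mult_mono sum_nonneg) auto
  also have "\<dots> = c ^ 4 * real q ^ 7" by (simp add: eval_nat_numeral mult_ac)
  finally show ?thesis .
qed

lemma cut_norm_least:
  assumes h: "h \<in> bounded_kernels"
    and b: "\<And>S T. S \<in> sets unit_interval \<Longrightarrow> T \<in> sets unit_interval \<Longrightarrow>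
      \<bar>LINT p|unit_square. h p * (indicator S (fst p) * indicator T (snd p))\<bar> \<le> c"
  shows "cut_norm h \<le> c"
  unfolding cut_norm_def
proof (rule cSUP_least)
  fix ST assume "ST \<in> sets unit_interval \<times> sets unit_interval"
  then obtain S T where "ST = (S, T)" "S \<in> sets unit_interval" "T \<in> sets unit_interval" by blast
  then show "(case ST of (S, T) \<Rightarrow> \<bar>LINT p:S \<times> T|lebesgue. h p\<bar>) \<le> c"
    using set_integral_unit_square[OF h] b by simp
qed auto

text \<open>Each entry of \<open>A\<close> is inflated to \<open>q * q\<close> by
  \<open>q * q\<close> zeros and ones. On each of the \<open>m ^ 2\<close> blocks the bilinear bound
  with \<open>c = 1 / n\<close> and \<open>n = m * q ^ 2\<close> gives
  \<open>1 / (m ^ 2 * sqrt q)\<close>, in total \<open>1 / sqrt q\<close>. Rounding the entries to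
  multiples of \<open>1 / q\<close> costs at most \<open>1 / q\<close>, again at most
  \<open>1 / sqrt q\<close>.\<close>

lemma zero_one_near_step:
  assumes m: "m > 0" and A: "A \<in> sym_matrices m" and q: "prime (q :: nat)"
  obtains g where "g \<in> graphons" "\<And>p. p \<in> {0..1} \<times> {0..1} \<Longrightarrow> g p = 0 \<or> g p = 1"
    "cut_norm (\<lambda>p. g p - step m A p) \<le> 2 / sqrt q"
proof -
  have q0: "q > 0" using q by (simp add: prime_gt_0_nat)
  define N where "N = q * q"
  define n where "n = m * N"
  have N0: "N > 0" and n0: "n > 0" using q0 m by (auto simp: N_def n_def)
  \<comment> \<open>For \<open>p\<close> between 0 and 1 this counts the residues below the
    threshold \<open>p * q\<close>. Subtracting \<open>r p / q\<close>, and not \<open>p\<close>,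
    gives \<open>h p\<close> mean exactly zero.\<close>
  define r where "r p = real (nat \<lceil>p * real q\<rceil>)" for p :: real
  define h where "h p v = of_bool (real v < p * q) - r p / q" for p :: real and v :: nat
  define a where "a i = i div N" for i
  define e where "e i j = qentry q (i mod N) (j mod N)" for i j
  define G where "G i j = (of_bool (real (e i j) < A (a i) (a j) * q) :: real)" for i j
  have aless: "a i < m" if "i < n" for i using that by (simp add: a_def n_def less_mult_imp_div_less)
  have Ar: "0 \<le> A x y \<and> A x y \<le> 1" "A x y = A y x" if "x < m" "y < m" for x y
    using A that by (auto simp: sym_matrices_def)
  have esym: "e i j = e j i" for i j by (simp add: e_def qentry_def mult.commute add.commute add.left_commute)
  have Gsym: "G \<in> sym_matrices n"
    using Ar(2) aless by (auto simp: sym_matrices_def G_def esym of_bool_def)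
  have g: "step n G \<in> graphons" by (rule step_graphon[OF n0 Gsym])
  have f: "step m A \<in> graphons" by (rule step_graphon[OF m A])
  have bk: "(\<lambda>p. step n G p - step m A p) \<in> bounded_kernels" by (intro bounded_kernels_diff graphons_bounded f g)
  have rp: "0 \<le> r p - p * q" "r p - p * q \<le> 1" "0 \<le> r p" "r p \<le> q" if "0 \<le> p" "p \<le> 1" for p :: real
  proof -
    have pq: "0 \<le> p * q" "p * q \<le> q" using that by (auto simp: mult_left_le_one_le)
    then have rr: "real_of_int \<lceil>p * q\<rceil> = r p" unfolding r_def by simp
    then show "0 \<le> r p - p * q" "r p - p * q \<le> 1" "0 \<le> r p" using pq by linarith+
    have "\<lceil>p * q\<rceil> \<le> int q" using pq by (simp only: ceiling_le_iff of_int_of_nat_eq)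
    then have "real_of_int \<lceil>p * q\<rceil> \<le> real_of_int (int q)" by (simp only: of_int_le_iff)
    then show "r p \<le> q" by (simp only: rr of_int_of_nat_eq)
  qed
  have h0: "(\<Sum>v<q. h p v) = 0" if p: "0 \<le> p" "p \<le> 1" for p :: real
  proof -
    have "{v \<in> {..<q}. real v < p * q} = {..<nat \<lceil>p * real q\<rceil>}"
    proof (intro set_eqI iffI)
      fix v assume "v \<in> {..<nat \<lceil>p * real q\<rceil>}"
      then have "int v < \<lceil>p * q\<rceil>" by auto
      then have v: "real v < p * q" by (simp add: less_ceiling_iff)
      moreover have "p * q \<le> q" using p by (simp add: mult_left_le_one_le)
      ultimately have "real v < real q" by linarith
      with v show "v \<in> {v \<in> {..<q}. real v < p * q}" by simp
    next
      fix v assume "v \<in> {v \<in> {..<q}. real v < p * q}"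
      then have "int v < \<lceil>p * q\<rceil>" by (simp add: less_ceiling_iff)
      then show "v \<in> {..<nat \<lceil>p * real q\<rceil>}" by auto
    qed
    then have "(\<Sum>v<q. of_bool (real v < p * q) :: real) = r p"
      by (simp add: r_def of_bool_def sum.If_cases Int_def)
    then show ?thesis using q0 by (simp add: h_def sum_subtractf)
  qed
  have h1: "\<bar>h p v\<bar> \<le> 1" if p: "0 \<le> p" "p \<le> 1" for p :: real and v
  proof -
    have "0 \<le> r p / q" "r p / q \<le> 1" using rp(3,4)[OF p] q0 by auto
    then show ?thesis by (auto simp: h_def)
  qed
  have "cut_norm (\<lambda>p. step n G p - step m A p) \<le> 2 / sqrt q"
  proof (rule cut_norm_least[OF bk])
    fix S T assume S: "S \<in> sets unit_interval" and T: "T \<in> sets unit_interval"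
    define w where "w X i = (LINT x|unit_interval. indicator (block n -` {i} \<inter> {0..1}) x * indicator X x :: real)" for X i
    have iX: "(indicator X :: real \<Rightarrow> real) \<in> borel_measurable unit_interval" "\<And>x. \<bar>indicator X x :: real\<bar> \<le> 1"
      if "X \<in> sets unit_interval" for X
      using that by (auto simp: indicator_def)
    have w: "0 \<le> w X i \<and> w X i \<le> 1 / n" if X: "X \<in> sets unit_interval" and i: "i < n" for X i
    proof
      note b = block_preimage_measure[OF n0 i]
      show "0 \<le> w X i" unfolding w_def by (intro Bochner_Integration.integral_nonneg) auto
      have "w X i \<le> (LINT x|unit_interval. indicator (block n -` {i} \<inter> {0..1}) x)"
        unfolding w_def
      proof (rule integral_mono)
        show "integrable unit_interval (\<lambda>x. indicator (block n -` {i} \<inter> {0..1}) x * indicator X x :: real)"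
        proof (rule unit_interval.integrable_const_bound[where B = 1])
          show "(\<lambda>x. indicator (block n -` {i} \<inter> {0..1}) x * indicator X x :: real) \<in> borel_measurable unit_interval"
            using b(1) iX(1)[OF X] by (intro borel_measurable_times) simp_all
        qed (auto simp: indicator_def)
        show "integrable unit_interval (indicator (block n -` {i} \<inter> {0..1}) :: real \<Rightarrow> real)"
          using b(1) by (intro integrable_real_indicator) (auto simp: less_top[symmetric])
      qed (auto simp: indicator_def)
      also have "\<dots> = 1 / n" using b by simp
      finally show "w X i \<le> 1 / n" .
    qed
    define E where "E i j = G i j - A (a i) (a j)" for i j
    have "(LINT p|unit_square. (step n G p - step m A p) * (indicator S (fst p) * indicator T (snd p))) =
        (LINT (x, y)|unit_square. step n E (x, y) * (indicator S x * indicator T y))"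
      by (rule Bochner_Integration.integral_cong[OF refl])
         (auto simp: step_def E_def a_def n_def block_div[OF m N0] mult.commute)
    also have "\<dots> = (\<Sum>i<n. \<Sum>j<n. E i j * (w S i * w T j))"
      unfolding w_def by (rule integral_step(2)[OF n0 iX(1)[OF S] iX(1)[OF T] iX(2)[OF S] iX(2)[OF T]])
    also have "\<dots> = (\<Sum>i<n. \<Sum>j<n. h (A (a i) (a j)) (e i j) * (w S i * w T j)) +
        (\<Sum>i<n. \<Sum>j<n. (r (A (a i) (a j)) / q - A (a i) (a j)) * (w S i * w T j))"
      by (simp add: E_def G_def h_def sum.distrib[symmetric] distrib_right[symmetric])
    finally have eq: "(LINT p|unit_square. (step n G p - step m A p) * (indicator S (fst p) * indicator T (snd p))) = \<dots>" .
    have "\<bar>\<Sum>i<n. \<Sum>j<n. (r (A (a i) (a j)) / q - A (a i) (a j)) * (w S i * w T j)\<bar> \<le> (\<Sum>i<n. \<Sum>j<n. 1 / q * (1 / n * (1 / n)))"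
    proof (intro order.trans[OF sum_abs] sum_mono)
      fix i j assume ij: "i \<in> {..<n}" "j \<in> {..<n}"
      then have p: "0 \<le> A (a i) (a j)" "A (a i) (a j) \<le> 1" using Ar aless by auto
      have "r (A (a i) (a j)) / q - A (a i) (a j) = (r (A (a i) (a j)) - A (a i) (a j) * q) / q"
        using q0 by (simp add: diff_divide_distrib)
      then have "\<bar>r (A (a i) (a j)) / q - A (a i) (a j)\<bar> \<le> 1 / q"
        using rp(1,2)[OF p] q0 by (simp add: abs_divide divide_right_mono)
      then show "\<bar>(r (A (a i) (a j)) / q - A (a i) (a j)) * (w S i * w T j)\<bar> \<le> 1 / q * (1 / n * (1 / n))"
        unfolding abs_mult using w[OF S, of i] w[OF T, of j] ij by (intro mult_mono) auto
    qed
    also have "\<dots> = 1 / q" using n0 by simp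
    finally have 2: "\<bar>\<Sum>i<n. \<Sum>j<n. (r (A (a i) (a j)) / q - A (a i) (a j)) * (w S i * w T j)\<bar> \<le> 1 / q" .
    have "(\<Sum>i<n. \<Sum>j<n. h (A (a i) (a j)) (e i j) * (w S i * w T j)) =
        (\<Sum>x<m. \<Sum>y<m. \<Sum>i<N. \<Sum>j<N. h (A x y) (qentry q i j) * (w S (x * N + i) * w T (y * N + j)))"
    proof -
      have "(\<Sum>i<n. \<Sum>j<n. h (A (a i) (a j)) (e i j) * (w S i * w T j)) =
          (\<Sum>x<m. \<Sum>i<N. \<Sum>y<m. \<Sum>j<N. h (A (a (x * N + i)) (a (y * N + j))) (e (x * N + i) (y * N + j)) * (w S (x * N + i) * w T (y * N + j)))"
        unfolding n_def sum_lessThan_mult ..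
      also have "\<dots> = (\<Sum>x<m. \<Sum>i<N. \<Sum>y<m. \<Sum>j<N. h (A x y) (qentry q i j) * (w S (x * N + i) * w T (y * N + j)))"
        using N0 by (intro sum.cong refl) (auto simp: a_def e_def)
      also have "\<dots> = (\<Sum>x<m. \<Sum>y<m. \<Sum>i<N. \<Sum>j<N. h (A x y) (qentry q i j) * (w S (x * N + i) * w T (y * N + j)))"
        by (intro sum.cong refl sum.swap)
      finally show ?thesis .
    qed
    also have "\<bar>\<dots>\<bar> \<le> (\<Sum>x<m. \<Sum>y<m. 1 / (real m ^ 2 * sqrt q))"
    proof (rule order.trans[OF sum_abs], rule sum_mono, rule order.trans[OF sum_abs], rule sum_mono)
      fix x y assume xy: "x \<in> {..<m}" "y \<in> {..<m}"
      then have p: "0 \<le> A x y" "A x y \<le> 1" using Ar by auto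
      let ?Z = "\<Sum>i<N. \<Sum>j<N. h (A x y) (qentry q i j) * (w S (x * N + i) * w T (y * N + j))"
      \<comment> \<open>The weights are extended by zero, since the bilinear bound asks for their
        range at all indices.\<close>
      define s where "s i = (if i < N then w S (x * N + i) else 0)" for i
      define t where "t j = (if j < N then w T (y * N + j) else 0)" for j
      have idx: "z * N + i < n" if "z < m" "i < N" for z i
      proof -
        have "z * N + i < (z + 1) * N" using that by simp
        also have "\<dots> \<le> n" unfolding n_def using that by (intro mult_right_mono) auto
        finally show ?thesis .
      qed
      have s: "0 \<le> s i \<and> s i \<le> 1 / n" for i using w[OF S idx, of x i] xy by (auto simp: s_def)
      have t: "0 \<le> t i \<and> t i \<le> 1 / n" for i using w[OF T idx, of y i] xy by (auto simp: t_def)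
      have "?Z = (\<Sum>i<q * q. \<Sum>j<q * q. h (A x y) (qentry q i j) * (s i * t j))"
        unfolding N_def[symmetric] by (intro sum.cong refl) (auto simp: s_def t_def)
      then have "?Z\<^sup>2 \<le> (1 / n) ^ 4 * real q ^ 7"
        using quasirandom_bilinear[OF q h0[OF p] h1[OF p] s t] by simp
      also have "\<dots> = (1 / (real m ^ 2 * sqrt q))\<^sup>2"
        using q0 m by (simp add: n_def N_def power_divide power_mult_distrib field_simps eval_nat_numeral)
      finally have "\<bar>?Z\<bar>\<^sup>2 \<le> (1 / (real m ^ 2 * sqrt q))\<^sup>2" by simp
      then show "\<bar>?Z\<bar> \<le> 1 / (real m ^ 2 * sqrt q)" by (rule power2_le_imp_le) auto
    qed
    also have "\<dots> = 1 / sqrt q" using m by (simp add: power2_eq_square)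
    finally have 1: "\<bar>\<Sum>i<n. \<Sum>j<n. h (A (a i) (a j)) (e i j) * (w S i * w T j)\<bar> \<le> 1 / sqrt q" .
    have "1 / real q \<le> 1 / sqrt q"
    proof -
      have "real q * 1 \<le> real q * real q" using q0 by (intro mult_left_mono) auto
      then have "sqrt q \<le> q" by (intro real_le_lsqrt) (auto simp: power2_eq_square)
      then show ?thesis using q0 by (intro divide_left_mono) auto
    qed
    moreover have "2 / sqrt q = 1 / sqrt q + 1 / sqrt q" by simp
    ultimately have "\<bar>x + y\<bar> \<le> 2 / sqrt q" if "\<bar>x\<bar> \<le> 1 / sqrt q" "\<bar>y\<bar> \<le> 1 / q" for x y :: real
      using that abs_triangle_ineq[of x y] by linarith
    then show "\<bar>LINT p|unit_square. (step n G p - step m A p) * (indicator S (fst p) * indicator T (snd p))\<bar> \<le> 2 / sqrt q"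
      unfolding eq using 1 2 by blast
  qed
  moreover have "step n G p = 0 \<or> step n G p = 1" for p
    by (cases p) (simp add: step_def G_def)
  ultimately show thesis using g by (intro that[of "step n G"])
qed

lemma zero_one_cut_dense_step:
  assumes m: "m > 0" and A: "A \<in> sym_matrices m" and e: "e > 0"
  obtains g where "g \<in> graphons" "\<And>p. p \<in> {0..1} \<times> {0..1} \<Longrightarrow> g p = 0 \<or> g p = 1"
    "cut_norm (\<lambda>p. g p - step m A p) < e"
proof -
  obtain q where q: "prime q" "q > nat \<lceil>(2 / e)\<^sup>2\<rceil>" using bigger_prime by blast
  then have "(2 / e)\<^sup>2 < real q" by linarith
  then have "2 / e < sqrt q" by (rule real_less_rsqrt)
  moreover have "sqrt q > 0" using q(1) by (simp add: prime_gt_0_nat)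
  ultimately have lt: "2 / sqrt q < e" using e by (simp add: field_simps)
  obtain g where "g \<in> graphons" "\<And>p. p \<in> {0..1} \<times> {0..1} \<Longrightarrow> g p = 0 \<or> g p = 1"
    "cut_norm (\<lambda>p. g p - step m A p) \<le> 2 / sqrt q"
    by (rule zero_one_near_step[OF m A q(1)]) blast
  with lt show thesis by (intro that[of g]) auto
qed

lemma simplification_exists:
  assumes H: "H \<in> multigraphs"
  obtains H' where "H' \<in> simple_graphs"
    "\<And>g. g \<in> graphons \<Longrightarrow> (\<And>p. p \<in> {0..1} \<times> {0..1} \<Longrightarrow> g p = 0 \<or> g p = 1) \<Longrightarrow> hom_density H g = hom_density H' g"
proof -
  let ?ends = "\<lambda>e. {src H e, tgt H e}"
  have mg: "is_multigraph H" and iso: "no_isolated_vertices H" using H by (auto simp: multigraphs_def)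
  \<comment> \<open>One edge is kept for each set of endpoints. All endpoint sets survive, so no
    vertex becomes isolated.\<close>
  obtain E' where E': "E' \<subseteq> edges H" "inj_on ?ends E'" "?ends ` edges H = ?ends ` E'"
    using subset_image_inj[of "?ends ` edges H" ?ends "edges H"] by auto
  define H' where "H' = H\<lparr>edges := E'\<rparr>"
  have mg': "is_multigraph H'"
    using mg E'(1) finite_subset[OF E'(1)] by (auto simp: is_multigraph_def H'_def)
  have "no_isolated_vertices H'"
    unfolding no_isolated_vertices_def
  proof
    fix v assume "v \<in> verts H'"
    then obtain e where e: "e \<in> edges H" "v \<in> ?ends e"
      using iso by (auto simp: no_isolated_vertices_def H'_def)
    then obtain e' where "e' \<in> E'" "?ends e = ?ends e'" using E'(3) by blast
    then show "\<exists>e\<in>edges H'. v \<in> {src H' e, tgt H' e}" using e(2) by (auto simp: H'_def intro!: bexI[of _ e'])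
  qed
  then have "H' \<in> simple_graphs"
    using mg' E'(2) by (simp add: simple_graphs_def multigraphs_def no_multiple_edges_def H'_def)
  moreover have "hom_density H g = hom_density H' g"
    if g: "g \<in> graphons" and g01: "\<And>p. p \<in> {0..1} \<times> {0..1} \<Longrightarrow> g p = 0 \<or> g p = 1" for g
  proof -
    have "hom_density H g = (LINT x|completion (unit_cube (verts H)). (\<Prod>e\<in>E'. g (x (src H e), x (tgt H e))))"
      unfolding hom_density_def
    proof (rule Bochner_Integration.integral_cong[OF refl])
      fix x assume "x \<in> space (completion (unit_cube (verts H)))"
      then have x: "x \<in> space (unit_cube (verts H))" by simp
      let ?g = "\<lambda>e. g (x (src H e), x (tgt H e))"
      have v: "?g e = 0 \<or> ?g e = 1" if "e \<in> edges H" for e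
        using g01 edge_in_unit_square[OF mg that x] by simp
      \<comment> \<open>Parallel edges may be oriented oppositely; the symmetry of \<open>g\<close>
        on the square absorbs this.\<close>
      have same: "?g e = ?g e'" if "e \<in> edges H" "?ends e = ?ends e'" for e e'
      proof -
        have "x (src H e) \<in> {0..1}" "x (tgt H e) \<in> {0..1}"
          using edge_in_unit_square[OF mg that(1) x] by auto
        then have "g (x (src H e), x (tgt H e)) = g (x (tgt H e), x (src H e))" by (rule graphons_symmetric[OF g])
        then show ?thesis using that(2) by (auto simp: doubleton_eq_iff)
      qed
      show "(\<Prod>e\<in>edges H. ?g e) = (\<Prod>e\<in>E'. ?g e)"
      proof (cases "\<forall>e\<in>E'. ?g e = 1")
        case True
        have "?g e = 1" if e: "e \<in> edges H" for e
        proof -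
          have "?ends e \<in> ?ends ` E'" using imageI[OF e, of ?ends] E'(3) by simp
          then obtain e' where e': "e' \<in> E'" "?ends e = ?ends e'" by (rule imageE)
          have "?g e = ?g e'" by (rule same[OF e e'(2)])
          then show ?thesis using True e'(1) by simp
        qed
        then show ?thesis using True by simp
      next
        case False
        then obtain e where "e \<in> E'" "?g e = 0" using v E'(1) by blast
        moreover have "finite (edges H)" "finite E'" using mg mg' by (auto simp: is_multigraph_def H'_def)
        ultimately have "(\<Prod>e\<in>edges H. ?g e) = 0" "(\<Prod>e\<in>E'. ?g e) = 0"
          using E'(1) by (auto intro!: prod_zero bexI[of _ e])
        then show ?thesis by simp
      qed
    qed
    then show ?thesis by (simp add: hom_density_def H'_def)
  qed
  ultimately show thesis by (rule that)
qed

text \<open>0/1-valued graphons do not see multiplicities and are dense in the cut norm.\<close>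

lemma cut_continuous_hom_density:
  assumes H: "H \<in> multigraphs"
    and cont: "\<And>f e. f \<in> graphons \<Longrightarrow> e > 0 \<Longrightarrow>
      \<exists>r>0. \<forall>g\<in>graphons. cut_norm (\<lambda>p. g p - f p) < r \<longrightarrow> \<bar>hom_density H g - hom_density H f\<bar> < e"
  obtains H' where "H' \<in> simple_graphs" "\<And>f. f \<in> graphons \<Longrightarrow> hom_density H f = hom_density H' f"
proof -
  obtain H' where H': "H' \<in> simple_graphs"
    and eq: "\<And>g. g \<in> graphons \<Longrightarrow> (\<And>p. p \<in> {0..1} \<times> {0..1} \<Longrightarrow> g p = 0 \<or> g p = 1) \<Longrightarrow> hom_density H g = hom_density H' g"
    using simplification_exists[OF H] by blast
  have mg: "is_multigraph H" and mg': "is_multigraph H'"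
    using H H' by (auto simp: multigraphs_def simple_graphs_def)
  define k where "k = real (card (edges H')) + real (card (edges H)) + 1"
  have k: "k > 0" by (simp add: k_def)
  have kle: "real (card (edges H')) * y \<le> k * y" "real (card (edges H)) * y \<le> k * y" if "y \<ge> 0" for y
    using that by (auto simp: k_def intro!: mult_right_mono)
  \<comment> \<open>A 0/1-valued \<open>g\<close> near the step graphon mediates. The density of
    \<open>H\<close> moves little by the assumed continuity, that of \<open>H'\<close> by the
    counting lemma, and at \<open>g\<close> they agree.\<close>
  have step: "hom_density H (step m A) = hom_density H' (step m A)" if mA: "m > 0" "A \<in> sym_matrices m" for m A
  proof (rule ccontr)
    assume ne: "\<not> ?thesis"
    let ?f = "step m A"
    have f: "?f \<in> graphons" by (rule step_graphon[OF mA])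
    define e where "e = \<bar>hom_density H ?f - hom_density H' ?f\<bar>"
    have e: "e > 0" using ne by (simp add: e_def)
    obtain r where r: "r > 0" "\<And>g. g \<in> graphons \<Longrightarrow> cut_norm (\<lambda>p. g p - ?f p) < r \<Longrightarrow> \<bar>hom_density H g - hom_density H ?f\<bar> < e / 2"
      using cont[OF f, of "e / 2"] e by auto
    have "min r (e / (2 * k)) > 0" using r(1) e k by simp
    from zero_one_cut_dense_step[OF mA this] obtain g where g: "g \<in> graphons"
      "\<And>p. p \<in> {0..1} \<times> {0..1} \<Longrightarrow> g p = 0 \<or> g p = 1" "cut_norm (\<lambda>p. g p - ?f p) < min r (e / (2 * k))"
      by blast
    have c0: "0 \<le> cut_norm (\<lambda>p. g p - ?f p)"
      by (intro cut_norm_nonneg bounded_kernels_diff graphons_bounded f g(1))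
    have "\<bar>hom_density H g - hom_density H ?f\<bar> < e / 2" using r(2)[OF g(1)] g(3) by simp
    moreover have "\<bar>hom_density H' g - hom_density H' ?f\<bar> \<le> e / 2"
    proof -
      have "\<bar>hom_density H' g - hom_density H' ?f\<bar> \<le> k * cut_norm (\<lambda>p. g p - ?f p)"
        using hom_density_cut_norm[OF H' g(1) f] kle(1)[OF c0] by linarith
      also have "\<dots> \<le> k * (e / (2 * k))" using g(3) k by (intro mult_left_mono) auto
      finally show ?thesis using k by simp
    qed
    moreover have "hom_density H g = hom_density H' g" by (rule eq[OF g(1,2)])
    ultimately have "\<bar>hom_density H ?f - hom_density H' ?f\<bar> < e / 2 + e / 2"
      using abs_triangle_ineq4[of "hom_density H' g - hom_density H' ?f" "hom_density H g - hom_density H ?f"] by simp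
    then show False by (simp add: e_def)
  qed
  have "hom_density H f = hom_density H' f" if f: "f \<in> graphons" for f
  proof (rule ccontr)
    assume ne: "hom_density H f \<noteq> hom_density H' f"
    define e where "e = \<bar>hom_density H f - hom_density H' f\<bar>"
    have e: "e > 0" using ne by (simp add: e_def)
    have "e / (3 * k) > 0" using e k by simp
    from step_graphons_dense[OF f this] obtain m A where mA: "m > 0" "A \<in> sym_matrices m"
      "L1_norm (\<lambda>p. f p - step m A p) < e / (3 * k)" .
    have s: "step m A \<in> graphons" by (rule step_graphon[OF mA(1,2)])
    have "k * L1_norm (\<lambda>p. f p - step m A p) \<le> k * (e / (3 * k))" using mA(3) k by (intro mult_left_mono) auto
    then have le: "k * L1_norm (\<lambda>p. f p - step m A p) \<le> e / 3" using k by simp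
    have "\<bar>hom_density H f - hom_density H (step m A)\<bar> \<le> e / 3"
      using hom_density_L1[OF mg f s] kle(2)[OF L1_norm_nonneg] le by (meson order_trans)
    moreover have "\<bar>hom_density H' f - hom_density H' (step m A)\<bar> \<le> e / 3"
      using hom_density_L1[OF mg' f s] kle(1)[OF L1_norm_nonneg] le by (meson order_trans)
    ultimately have "\<bar>hom_density H f - hom_density H' f\<bar> \<le> e / 3 + e / 3"
      using abs_triangle_ineq4[of "hom_density H f - hom_density H (step m A)" "hom_density H' f - hom_density H' (step m A)"]
        step[OF mA(1,2)] by simp
    then show False using e by (simp add: e_def)
  qed
  with H' show thesis by (rule that)
qed

section \<open>The characterisation\<close>

lemma bounded_kernels_zero_diff: "L1_norm (\<lambda>p. f p - f p) = 0" "cut_norm (\<lambda>p. f p - f p) = 0"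
proof -
  show L1: "L1_norm (\<lambda>p. f p - f p) = 0" by (simp add: L1_norm_def)
  have "(\<lambda>p. f p - f p) \<in> bounded_kernels" using bounded_kernels_zero by simp
  from cut_norm_le_L1[OF this] cut_norm_nonneg[OF this] L1 show "cut_norm (\<lambda>p. f p - f p) = 0" by simp
qed

lemma lipschitz_continuous_map:
  assumes z: "\<And>f. N (\<lambda>p. f p - f p) = 0"
    and lip: "\<And>f g. f \<in> graphons \<Longrightarrow> g \<in> graphons \<Longrightarrow> \<bar>F g - F f\<bar> \<le> real k * N (\<lambda>p. g p - f p)"
  shows "continuous_map (graphon_topology N) euclideanreal F"
  unfolding continuous_map_graphon_topology[of N, OF z]
proof (intro ballI allI impI)
  fix f and e :: real assume f: "f \<in> graphons" and e: "e > 0"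
  show "\<exists>r>0. \<forall>g\<in>graphons. N (\<lambda>p. g p - f p) < r \<longrightarrow> \<bar>F g - F f\<bar> < e"
  proof (intro exI[of _ "e / (real k + 1)"] conjI ballI impI)
    show "0 < e / (real k + 1)" using e by simp
    fix g assume g: "g \<in> graphons" "N (\<lambda>p. g p - f p) < e / (real k + 1)"
    show "\<bar>F g - F f\<bar> < e"
    proof (cases "k = 0")
      case True
      then show ?thesis using lip[OF f g(1)] e by simp
    next
      case False
      then have "real k * N (\<lambda>p. g p - f p) < real k * (e / (real k + 1))" using g(2) by (intro mult_strict_left_mono) auto
      also have "\<dots> \<le> e" using e by (simp add: field_simps)
      finally show ?thesis using lip[OF f g(1)] by simp
    qed
  qed
qed

lemma L1_continuous_characterisation:
  assumes \<phi>: "measure_preserving unit_interval unit_square \<phi>" and F: "class_function F" and nz: "\<exists>f\<in>graphons. F f \<noteq> 0"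
    and cont: "continuous_map L1_topology euclideanreal F" and deriv: "some_derivative_vanishes F"
    and mult: "multiplicative_on_tensor_powers \<phi> F"
  shows "\<exists>H\<in>multigraphs. \<forall>f\<in>graphons. F f = hom_density H f"
proof -
  obtain N where N: "N > 0" "\<And>f g. f \<in> graphons \<Longrightarrow> (\<forall>i\<in>{1..N}. g i \<in> Adm f) \<Longrightarrow> gateaux_exists F N f g \<and> gateaux F N f g = 0"
    using deriv unfolding some_derivative_vanishes_def by blast
  interpret polynomial_class_function F N
  proof
    show "class_function F" "N > 0" by fact+
    show "gateaux_exists F N f g \<and> gateaux F N f g = 0" if "f \<in> graphons" "\<And>i. i \<in> {1..N} \<Longrightarrow> g i \<in> Adm f" for f g
      using N(2)[OF that(1)] that(2) by blast
    show "\<exists>r>0. \<forall>g\<in>graphons. L1_norm (\<lambda>p. g p - f p) < r \<longrightarrow> \<bar>F g - F f\<bar> < e" if "f \<in> graphons" "e > 0" for f e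
      using cont that unfolding continuous_map_graphon_topology[of L1_norm, OF bounded_kernels_zero_diff(1)] by blast
  qed
  obtain c where c: "\<And>f. f \<in> graphons \<Longrightarrow> F f = (\<Sum>xs\<in>small_graphs N. c xs * hom_density (graph_of xs) f)"
    using finite_combination by blast
  have mg: "graph_of xs \<in> multigraphs" if "xs \<in> small_graphs N" for xs
    by (rule graph_of_multigraph) (rule small_graphs_endpoints(2)[OF that])
  have "\<exists>xs\<in>small_graphs N. \<forall>f\<in>graphons. F f = hom_density (graph_of xs) f"
    by (rule single_density[OF \<phi> mult c finite_small_graphs _ nz]) (use mg in \<open>auto simp: multigraphs_def\<close>)
  then show ?thesis using mg by blast
qed

lemma hom_density_properties:
  assumes \<phi>: "measure_preserving unit_interval unit_square \<phi>" and H: "H \<in> multigraphs"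
    and F: "\<And>f. f \<in> graphons \<Longrightarrow> F f = hom_density H f"
  shows "continuous_map L1_topology euclideanreal F" "some_derivative_vanishes F" "multiplicative_on_tensor_powers \<phi> F"
proof -
  have mg: "is_multigraph H" using H by (simp add: multigraphs_def)
  show "continuous_map L1_topology euclideanreal F"
    by (rule lipschitz_continuous_map[where k = "card (edges H)"]) (use hom_density_L1[OF mg] F bounded_kernels_zero_diff in auto)
  show "some_derivative_vanishes F" by (rule hom_density_some_derivative_vanishes[OF mg F])
  show "multiplicative_on_tensor_powers \<phi> F"
    unfolding multiplicative_on_tensor_powers_def
    by (rule exI[of _ 2]) (simp add: F tensor_power_graphon[OF \<phi>] hom_density_tensor_power[OF \<phi> mg])
qed

theorem theorem3p30:
  fixes F :: "(real \<times> real \<Rightarrow> real) \<Rightarrow> real"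
    and \<phi> :: "real \<Rightarrow> real \<times> real"
  assumes "measure_preserving unit_interval unit_square \<phi>"
    and "class_function F"
    and "\<exists>f\<in>graphons. F f \<noteq> 0"
  shows "((\<exists>H\<in>multigraphs. \<forall>f\<in>graphons. F f = hom_density H f) \<longleftrightarrow>
      continuous_map L1_topology euclideanreal F \<and>
      some_derivative_vanishes F \<and>
      multiplicative_on_tensor_powers \<phi> F) \<and>
    ((\<exists>H\<in>simple_graphs. \<forall>f\<in>graphons. F f = hom_density H f) \<longleftrightarrow>
      continuous_map cut_topology euclideanreal F \<and>
      some_derivative_vanishes F \<and>
      multiplicative_on_tensor_powers \<phi> F)"
proof (intro conjI iffI)
  assume "\<exists>H\<in>multigraphs. \<forall>f\<in>graphons. F f = hom_density H f"
  then obtain H where "H \<in> multigraphs" "\<And>f. f \<in> graphons \<Longrightarrow> F f = hom_density H f" by blast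
  from hom_density_properties[OF assms(1) this]
  show "continuous_map L1_topology euclideanreal F" "some_derivative_vanishes F" "multiplicative_on_tensor_powers \<phi> F"
    by simp_all
next
  assume "continuous_map L1_topology euclideanreal F \<and> some_derivative_vanishes F \<and> multiplicative_on_tensor_powers \<phi> F"
  then show "\<exists>H\<in>multigraphs. \<forall>f\<in>graphons. F f = hom_density H f"
    using L1_continuous_characterisation[OF assms] by blast
next
  assume "\<exists>H\<in>simple_graphs. \<forall>f\<in>graphons. F f = hom_density H f"
  then obtain H where H: "H \<in> simple_graphs" and F: "\<And>f. f \<in> graphons \<Longrightarrow> F f = hom_density H f" by blast
  have mg: "H \<in> multigraphs" using H by (simp add: simple_graphs_def)
  show "continuous_map cut_topology euclideanreal F"
    by (rule lipschitz_continuous_map[where k = "card (edges H)"])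
       (simp_all only: bounded_kernels_zero_diff F hom_density_cut_norm[OF H])
  show "some_derivative_vanishes F" "multiplicative_on_tensor_powers \<phi> F"
    using hom_density_properties[OF assms(1) mg F] by simp_all
next
  assume asm: "continuous_map cut_topology euclideanreal F \<and> some_derivative_vanishes F \<and> multiplicative_on_tensor_powers \<phi> F"
  then have cut: "\<forall>f\<in>graphons. \<forall>e>0. \<exists>r>0. \<forall>g\<in>graphons. cut_norm (\<lambda>p. g p - f p) < r \<longrightarrow> \<bar>F g - F f\<bar> < e"
    by (simp add: continuous_map_graphon_topology[of cut_norm, OF bounded_kernels_zero_diff(2)])
  \<comment> \<open>The cut norm is at most the \<open>L1_norm\<close>, so continuity for the cut
    norm is the stronger condition. The multigraph case then provides \<open>H\<close>, which
    remains to be made simple.\<close>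
  have "continuous_map L1_topology euclideanreal F"
    unfolding continuous_map_graphon_topology[of L1_norm, OF bounded_kernels_zero_diff(1)]
  proof (intro ballI allI impI)
    fix f and e :: real assume f: "f \<in> graphons" and "e > 0"
    then obtain r where r: "r > 0" "\<And>g. g \<in> graphons \<Longrightarrow> cut_norm (\<lambda>p. g p - f p) < r \<Longrightarrow> \<bar>F g - F f\<bar> < e"
      using cut by blast
    have "cut_norm (\<lambda>p. g p - f p) \<le> L1_norm (\<lambda>p. g p - f p)" if "g \<in> graphons" for g
      by (intro cut_norm_le_L1 bounded_kernels_diff graphons_bounded f that)
    with r show "\<exists>r>0. \<forall>g\<in>graphons. L1_norm (\<lambda>p. g p - f p) < r \<longrightarrow> \<bar>F g - F f\<bar> < e"
      by (intro exI[of _ r]) (auto intro: le_less_trans)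
  qed
  then obtain H where H: "H \<in> multigraphs" and F: "\<And>f. f \<in> graphons \<Longrightarrow> F f = hom_density H f"
    using L1_continuous_characterisation[OF assms] asm by blast
  have "\<exists>r>0. \<forall>g\<in>graphons. cut_norm (\<lambda>p. g p - f p) < r \<longrightarrow> \<bar>hom_density H g - hom_density H f\<bar> < e"
    if f: "f \<in> graphons" and e: "e > 0" for f and e :: real
  proof -
    obtain r where r: "r > 0" "\<And>g. g \<in> graphons \<Longrightarrow> cut_norm (\<lambda>p. g p - f p) < r \<Longrightarrow> \<bar>F g - F f\<bar> < e"
      using bspec[OF cut f] e by blast
    then show ?thesis by (intro exI[of _ r]) (simp add: F[symmetric] f)
  qed
  then obtain H' where "H' \<in> simple_graphs" "\<And>f. f \<in> graphons \<Longrightarrow> hom_density H f = hom_density H' f"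
    using cut_continuous_hom_density[OF H] by blast
  then show "\<exists>H\<in>simple_graphs. \<forall>f\<in>graphons. F f = hom_density H f" using F by auto
qed

end
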